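(* Let $m\ge1$, $d\ge2$, $k_1,\dots,k_m\geq 2$ be integers, and let $$X=\{xy_1^{k_1}\cdots y_m^{k_m}=z^d+s_{d-1}(y_1,\dots,y_m)z^{d-1}+\dots+s_0(y_1,\dots,y_m)\}\subset\mathbb{K}^{m+2},$$ with $s_j\in\mathbb{K}[y_1,\dots,y_m]$, be a Danielewski variety. If there are no five pairwise distinct indices $i_1,i_2,i_3,i_4,i_5\in\{1,\dots,m\}$ such that $k_{i_1}=k_{i_2}=k_{i_3}=k_{i_4}=k_{i_5}$, then the group $\mathrm{Aut}(X)$ is solvable.
   Context: $\mathbb{K}$ is an algebraically closed field of characteristic zero. $\mathrm{Aut}(X)$ is the group of automorphisms of the affine variety $X$. *)

theory Defs
  imports
    "HOL-Algebra.Bij"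
    "HOL-Algebra.Solvable_Groups"
    "HOL-Computational_Algebra.Polynomial"
    "HOL-Library.Poly_Mapping"
begin

section \<open>Multivariate polynomials and their values\<close>

text \<open>A polynomial in the variables \<open>'v\<close> over \<open>'a\<close>: a finitely supported family of coefficients
  indexed by monomials, a monomial being a finitely supported family of exponents.\<close>

type_synonym ('v, 'a) mpoly = "('v \<Rightarrow>\<^sub>0 nat) \<Rightarrow>\<^sub>0 'a"

definition mpoly_eval :: "('v, 'a::comm_semiring_1) mpoly \<Rightarrow> ('v \<Rightarrow> 'a) \<Rightarrow> 'a" where
  "mpoly_eval p x =
     (\<Sum>m\<in>Poly_Mapping.keys p. Poly_Mapping.lookup p m * (\<Prod>v\<in>Poly_Mapping.keys m. x v ^ Poly_Mapping.lookup m v))"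


section \<open>Automorphism groups of affine varieties\<close>

text \<open>Affine space with coordinates \<open>'v\<close> is the type \<open>'v \<Rightarrow> 'a\<close>; over an algebraically closed
  field a closed subvariety is identified with its set of points.\<close>

definition regular_map ::
    "('v \<Rightarrow> 'a::comm_semiring_1) set \<Rightarrow> ('w \<Rightarrow> 'a) set \<Rightarrow> (('v \<Rightarrow> 'a) \<Rightarrow> ('w \<Rightarrow> 'a)) \<Rightarrow> bool" where
  "regular_map V W f \<longleftrightarrow>
     f \<in> V \<rightarrow> W \<and> (\<forall>w. \<exists>p. \<forall>x\<in>V. f x w = mpoly_eval p x)"

definition variety_automorphisms ::
    "('v \<Rightarrow> 'a::comm_semiring_1) set \<Rightarrow> (('v \<Rightarrow> 'a) \<Rightarrow> ('v \<Rightarrow> 'a)) set" where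
  "variety_automorphisms V =
     {f \<in> Bij V. regular_map V V f \<and> regular_map V V (inv_into V f)}"

definition Aut ::
    "('v \<Rightarrow> 'a::comm_semiring_1) set \<Rightarrow> (('v \<Rightarrow> 'a) \<Rightarrow> ('v \<Rightarrow> 'a)) monoid" where
  "Aut V = BijGroup V \<lparr>carrier := variety_automorphisms V\<rparr>"


section \<open>Danielewski varieties\<close>

text \<open>The coordinates \<open>x\<close>, \<open>y\<^sub>1, \<dots>, y\<^sub>m\<close>, \<open>z\<close> of the ambient space of dimension \<open>m + 2\<close>,
  where the index set \<open>{1, \<dots>, m}\<close> is the type \<open>'n\<close>.\<close>

datatype 'n coord = coord_x | coord_y 'n | coord_z

text \<open>Only the coefficients \<open>s j\<close> with \<open>j < d\<close> occur.\<close>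

definition danielewski_variety ::
    "('n::finite \<Rightarrow> nat) \<Rightarrow> nat \<Rightarrow> (nat \<Rightarrow> ('n, 'a::comm_semiring_1) mpoly)
      \<Rightarrow> ('n coord \<Rightarrow> 'a) set" where
  "danielewski_variety k d s =
     {u. u coord_x * (\<Prod>i\<in>UNIV. u (coord_y i) ^ k i) =
         u coord_z ^ d + (\<Sum>j<d. mpoly_eval (s j) (\<lambda>i. u (coord_y i)) * u coord_z ^ j)}"


section \<open>Automorphisms form a group\<close>

lemma mpoly_eval_superset:
  assumes "finite S" "Poly_Mapping.keys p \<subseteq> S"
  shows "mpoly_eval p x = (\<Sum>m\<in>S. Poly_Mapping.lookup p m * (\<Prod>v\<in>Poly_Mapping.keys m. x v ^ Poly_Mapping.lookup m v))"
  unfolding mpoly_eval_def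
  using assms by (intro sum.mono_neutral_left) (auto simp: in_keys_iff)

lemma monom_eval_superset:
  fixes x :: "'v \<Rightarrow> 'a::comm_semiring_1"
  assumes "finite S" "Poly_Mapping.keys m \<subseteq> S"
  shows "(\<Prod>v\<in>Poly_Mapping.keys m. x v ^ Poly_Mapping.lookup m v) = (\<Prod>v\<in>S. x v ^ Poly_Mapping.lookup m v)"
  using assms by (intro prod.mono_neutral_left) (auto simp: in_keys_iff)

lemma mpoly_eval_0 [simp]: "mpoly_eval 0 x = 0"
  by (simp add: mpoly_eval_def)

lemma mpoly_eval_single [simp]:
  "mpoly_eval (Poly_Mapping.single m c) x = c * (\<Prod>v\<in>Poly_Mapping.keys m. x v ^ Poly_Mapping.lookup m v)"
  by (subst mpoly_eval_superset[of "{m}"]) (auto simp: lookup_single)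

lemma mpoly_eval_1 [simp]: "mpoly_eval 1 x = 1"
  using mpoly_eval_single[of 0 1 x] by (simp del: mpoly_eval_single)

lemma mpoly_eval_add [simp]: "mpoly_eval (p + q) x = mpoly_eval p x + mpoly_eval q x"
proof -
  let ?S = "Poly_Mapping.keys p \<union> Poly_Mapping.keys q"
  have "Poly_Mapping.keys (p + q) \<subseteq> ?S"
    by (rule keys_add)
  then show ?thesis
    by (simp add: mpoly_eval_superset[of ?S] lookup_add distrib_right sum.distrib)
qed

lemma mpoly_eval_sum [simp]: "mpoly_eval (\<Sum>i\<in>I. p i) x = (\<Sum>i\<in>I. mpoly_eval (p i) x)"
  by (induction I rule: infinite_finite_induct) simp_all

lemma monom_eval_add:
  fixes x :: "'v \<Rightarrow> 'a::comm_semiring_1"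
  shows "(\<Prod>v\<in>Poly_Mapping.keys (m + n). x v ^ Poly_Mapping.lookup (m + n) v) =
    (\<Prod>v\<in>Poly_Mapping.keys m. x v ^ Poly_Mapping.lookup m v) *
    (\<Prod>v\<in>Poly_Mapping.keys n. x v ^ Poly_Mapping.lookup n v)"
proof -
  let ?S = "Poly_Mapping.keys m \<union> Poly_Mapping.keys n"
  have "Poly_Mapping.keys (m + n) \<subseteq> ?S"
    by (rule keys_add)
  then have "(\<Prod>v\<in>Poly_Mapping.keys (m + n). x v ^ Poly_Mapping.lookup (m + n) v) =
      (\<Prod>v\<in>?S. x v ^ Poly_Mapping.lookup (m + n) v)"
    by (intro monom_eval_superset) auto
  then show ?thesis
    by (simp only: lookup_add power_add prod.distrib
        monom_eval_superset[of ?S m x, simplified] monom_eval_superset[of ?S n x, simplified])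
qed

lemma mpoly_as_sum:
  fixes p :: "('v, 'a::comm_semiring_1) mpoly"
  shows "p = (\<Sum>m\<in>Poly_Mapping.keys p. Poly_Mapping.single m (Poly_Mapping.lookup p m))"
  by (rule poly_mapping_eqI) (auto simp: lookup_sum lookup_single when_def in_keys_iff)

lemma mpoly_eval_mult [simp]: "mpoly_eval (p * q) x = mpoly_eval p x * mpoly_eval q x"
proof -
  have "mpoly_eval (p * q) x =
      mpoly_eval (\<Sum>m\<in>Poly_Mapping.keys p. \<Sum>n\<in>Poly_Mapping.keys q.
        Poly_Mapping.single (m + n) (Poly_Mapping.lookup p m * Poly_Mapping.lookup q n)) x"
    by (subst mpoly_as_sum[of p], subst mpoly_as_sum[of q])
       (simp only: sum_product Poly_Mapping.mult_single)
  also have "\<dots> = mpoly_eval p x * mpoly_eval q x"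
    by (simp add: monom_eval_add sum_product mpoly_eval_def[of p] mpoly_eval_def[of q] ac_simps)
  finally show ?thesis .
qed

lemma mpoly_eval_power [simp]: "mpoly_eval (p ^ n) x = mpoly_eval p x ^ n"
  by (induction n) simp_all

lemma mpoly_eval_prod [simp]: "mpoly_eval (\<Prod>i\<in>I. p i) x = (\<Prod>i\<in>I. mpoly_eval (p i) x)"
  by (induction I rule: infinite_finite_induct) simp_all

lemma regular_map_id: "regular_map V V (\<lambda>x\<in>V. x)"
  unfolding regular_map_def
proof (intro conjI allI)
  fix w
  show "\<exists>p. \<forall>x\<in>V. (\<lambda>x\<in>V. x) x w = mpoly_eval p x"
    by (rule exI[of _ "Poly_Mapping.single (Poly_Mapping.single w 1) 1"]) simp
qed simp

lemma regular_map_compose: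
  assumes "regular_map U V f" "regular_map V W g"
  shows "regular_map U W (compose U g f)"
proof -
  obtain q where q: "f x v = mpoly_eval (q v) x" if "x \<in> U" for x v
    using assms(1) unfolding regular_map_def by metis
  have fU: "f x \<in> V" if "x \<in> U" for x
    using assms(1) that unfolding regular_map_def by auto
  have "\<exists>r. \<forall>x\<in>U. compose U g f x w = mpoly_eval r x" for w
  proof -
    obtain p where p: "g y w = mpoly_eval p y" if "y \<in> V" for y
      using assms(2) unfolding regular_map_def by metis
    have "compose U g f x w = mpoly_eval (\<Sum>m\<in>Poly_Mapping.keys p.
        Poly_Mapping.single 0 (Poly_Mapping.lookup p m) * (\<Prod>v\<in>Poly_Mapping.keys m. q v ^ Poly_Mapping.lookup m v)) x" if "x \<in> U" for x
      using that fU by (simp add: compose_eq p q mpoly_eval_def[of p])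
    then show ?thesis
      by blast
  qed
  moreover have "compose U g f \<in> U \<rightarrow> W"
    using assms unfolding regular_map_def by (auto simp: compose_def)
  ultimately show ?thesis
    unfolding regular_map_def by blast
qed

lemma regular_map_cong:
  assumes "\<And>x. x \<in> V \<Longrightarrow> f x = g x"
  shows "regular_map V W f \<longleftrightarrow> regular_map V W g"
  using assms unfolding regular_map_def by (simp add: Pi_iff)

lemma subgroup_variety_automorphisms: "subgroup (variety_automorphisms V) (BijGroup V)"
proof
  show "variety_automorphisms V \<subseteq> carrier (BijGroup V)"
    by (auto simp: variety_automorphisms_def BijGroup_def)
next
  fix f g
  assume f: "f \<in> variety_automorphisms V" and g: "g \<in> variety_automorphisms V"
  then have B: "f \<in> Bij V" "g \<in> Bij V"
    by (auto simp: variety_automorphisms_def)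
  have "inv_into V (compose V f g) x = compose V (inv_into V g) (inv_into V f) x"
    if "x \<in> V" for x
  proof -
    have inj: "inj_on (compose V f g) V"
      using compose_Bij[OF B] by (simp add: Bij_def bij_betw_def)
    have "inv_into V f x \<in> V" "inv_into V g (inv_into V f x) \<in> V"
      using B that by (auto intro: Bij_inv_into_mem)
    moreover have "f ` V = V" "g ` V = V"
      using B by (auto simp: Bij_def bij_betw_def)
    ultimately show ?thesis
      using that inj by (intro inv_into_f_eq) (auto simp: compose_eq f_inv_into_f)
  qed
  then have "regular_map V V (inv_into V (compose V f g))"
    using f g
    by (subst regular_map_cong) (auto simp: variety_automorphisms_def intro: regular_map_compose)
  then show "f \<otimes>\<^bsub>BijGroup V\<^esub> g \<in> variety_automorphisms V"
    using f g B
    by (auto simp: variety_automorphisms_def BijGroup_def compose_Bij intro: regular_map_compose)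
next
  have "inv_into V (\<lambda>x\<in>V. x) x = (\<lambda>x\<in>V. x) x" if "x \<in> V" for x
    using that by (auto intro!: inv_into_f_eq inj_onI)
  then have "regular_map V V (inv_into V (\<lambda>x\<in>V. x))"
    using regular_map_id regular_map_cong by blast
  then show "\<one>\<^bsub>BijGroup V\<^esub> \<in> variety_automorphisms V"
    by (simp add: variety_automorphisms_def BijGroup_def id_Bij regular_map_id)
next
  fix f
  assume f: "f \<in> variety_automorphisms V"
  then have B: "f \<in> Bij V"
    by (simp add: variety_automorphisms_def)
  let ?g = "\<lambda>x\<in>V. inv_into V f x"
  have g: "?g \<in> Bij V"
    using B by (rule restrict_inv_into_Bij)
  have "inv_into V ?g x = f x" if "x \<in> V" for x
  proof (rule inv_into_f_eq)
    show "inj_on ?g V"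
      using g by (simp add: Bij_def bij_betw_def)
    show "f x \<in> V"
      using B that by (auto simp: Bij_def bij_betw_def)
    then show "?g (f x) = x"
      using B that by (auto simp: Bij_def bij_betw_def inv_into_f_f)
  qed
  moreover have "?g x = inv_into V f x" if "x \<in> V" for x
    using that by simp
  ultimately have "?g \<in> variety_automorphisms V"
    using f g regular_map_cong[of V "inv_into V ?g" f V]
      regular_map_cong[of V ?g "inv_into V f" V]
    by (simp add: variety_automorphisms_def)
  then show "inv\<^bsub>BijGroup V\<^esub> f \<in> variety_automorphisms V"
    using B by (simp add: inv_BijGroup)
qed

lemma group_Aut: "group (Aut V)"
  unfolding Aut_def
  by (rule subgroup.subgroup_is_group[OF subgroup_variety_automorphisms group_BijGroup])

end

theory Submission
  imports Defs "HOL-Library.Countable"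
begin

text \<open>Write \<open>M = y\<^sub>1^k\<^sub>1 \<cdots> y\<^sub>m^k\<^sub>m\<close> and \<open>P = z^d + \<dots>\<close> for the two sides of the equation \<open>x M = P\<close>.
Its coordinate ring \<open>A\<close> is the subring of the Laurent ring \<open>K[y\<^sub>1, 1/y\<^sub>1, \<dots>, y\<^sub>m, 1/y\<^sub>m, z]\<close>
generated by the \<open>y\<^sub>i\<close>, by \<open>z\<close> and by \<open>x = P / M\<close>. Laurent monomials are ordered lexicographically,
the degree in \<open>z\<close> first. Every polynomial function on \<open>X\<close> is a combination of the functions
\<open>x^p y^a z^r\<close> with \<open>r < d\<close>, and these have pairwise distinct leading monomials in the Laurent ring. So
the functions on \<open>X\<close> are the elements of \<open>A\<close> (\<open>Phi_eqI\<close>, \<open>Phi_eqD\<close>), and the leading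
monomials of \<open>A\<close> form an explicit semigroup, called \<open>cone\<close> below.

The heart of the proof is that every nonzero locally nilpotent derivation \<open>D\<close> of \<open>A\<close> kills
exactly the elements of \<open>z\<close>-degree 0, which are the polynomials in the \<open>y\<^sub>i\<close>, and lowers the \<open>z\<close>-degree of
all others by one (\<open>D_eq_0\<close>, \<open>D_lowers\<close>). To leading order \<open>D\<close> sends a monomial of exponent \<open>t\<close> to
\<open>L t\<close> times the monomial of exponent \<open>t + e\<close>, for a fixed \<open>e\<close> and an additive \<open>L\<close>. Nilpotency makes each
\<open>L t\<close> a natural multiple of \<open>- L e\<close>, and \<open>t + e\<close> stays in \<open>cone\<close> whenever \<open>L t \<noteq> 0\<close>; for \<open>d \<ge> 2\<close>
and \<open>k\<^sub>i \<ge> 2\<close> integer arithmetic then leaves only \<open>L y\<^sub>i = 0\<close> for all \<open>i\<close> (\<open>cone_degree_vanishes\<close>).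

Let \<open>\<phi>\<close> be an automorphism of \<open>A\<close>. Both \<open>M \<partial>/\<partial>z\<close> and its conjugate under \<open>\<phi>\<close> are derivations of this
kind, so \<open>\<phi>\<close> preserves the \<open>z\<close>-degree. Hence \<open>\<phi> z = c z + b(y)\<close> with a constant \<open>c \<noteq> 0\<close>
(\<open>phi_Z\<close>), and the part of \<open>\<phi> M \<cdot> \<phi> x = \<phi> P\<close> of \<open>z\<close>-degree \<open>d\<close> shows that \<open>\<phi> M\<close> divides a monomial.
So \<open>\<phi> y\<^sub>i = c\<^sub>i y\<^bsub>\<sigma>(i)\<^esub>\<close> for a permutation \<open>\<sigma>\<close>, and comparing exponents shows that \<open>\<sigma>\<close> preserves \<open>k\<close>
(\<open>phi_Y\<close>).

For the group \<open>Aut X\<close> this gives a chain of subgroups in which commutators of one term lie in the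
next. The permutations of a level set of \<open>k\<close>, which has at most four elements, are exhausted in
three steps, because the symmetric group on four letters has derived length three. Commutators of
automorphisms that scale each \<open>y\<^sub>i\<close> fix all \<open>y\<^sub>i\<close>; commutators of automorphisms that fix all \<open>y\<^sub>i\<close> are shears
\<open>z \<mapsto> z + h(y)\<close>; shears commute.\<close>

section \<open>Ordered exponents of Laurent monomials\<close>

datatype 'n expo = Expo (zdeg: int) (ydeg: "'n \<Rightarrow> int")

instantiation expo :: (type) ab_group_add
begin

definition "0 = Expo 0 (\<lambda>_. 0)"
definition "s + t = Expo (zdeg s + zdeg t) (\<lambda>i. ydeg s i + ydeg t i)"
definition "- s = Expo (- zdeg s) (\<lambda>i. - ydeg s i)"
definition "s - t = Expo (zdeg s - zdeg t) (\<lambda>i. ydeg s i - ydeg t i)"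

instance
  by standard (auto simp: zero_expo_def plus_expo_def uminus_expo_def minus_expo_def
      intro: expo.expand)

end

lemma zdeg_simps [simp]:
  "zdeg 0 = 0" "zdeg (s + t) = zdeg s + zdeg t" "zdeg (- s) = - zdeg s" "zdeg (s - t) = zdeg s - zdeg t"
  by (simp_all add: zero_expo_def plus_expo_def uminus_expo_def minus_expo_def)

lemma ydeg_simps [simp]:
  "ydeg 0 i = 0" "ydeg (s + t) i = ydeg s i + ydeg t i" "ydeg (- s) i = - ydeg s i"
  "ydeg (s - t) i = ydeg s i - ydeg t i"
  by (simp_all add: zero_expo_def plus_expo_def uminus_expo_def minus_expo_def)

lemma expo_eqI: "zdeg s = zdeg t \<Longrightarrow> (\<And>i. ydeg s i = ydeg t i) \<Longrightarrow> s = t"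
  by (cases s, cases t) auto

lemma expo_eq_iff: "s = t \<longleftrightarrow> zdeg s = zdeg t \<and> (\<forall>i. ydeg s i = ydeg t i)"
  by (auto intro: expo_eqI)

lemma zdeg_sum [simp]: "zdeg (\<Sum>i\<in>I. f i :: 'n expo) = (\<Sum>i\<in>I. zdeg (f i))"
  by (induction I rule: infinite_finite_induct) auto

lemma ydeg_sum [simp]: "ydeg (\<Sum>i\<in>I. f i :: 'n expo) j = (\<Sum>i\<in>I. ydeg (f i) j)"
  by (induction I rule: infinite_finite_induct) auto

text \<open>The lexicographic order compares the degree in \<open>z\<close> first, so that a leading monomial carries the full
degree in \<open>z\<close>. The index type has no order of its own; the injection \<open>to_nat\<close> provides one.\<close>

definition expo_less :: "'n::finite expo \<Rightarrow> 'n expo \<Rightarrow> bool" where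
  "expo_less s t \<longleftrightarrow> zdeg s < zdeg t \<or> zdeg s = zdeg t \<and>
     (\<exists>i. ydeg s i < ydeg t i \<and> (\<forall>j. to_nat j < to_nat i \<longrightarrow> ydeg s j = ydeg t j))"

instantiation expo :: (finite) linorder
begin

definition less_expo :: "'a expo \<Rightarrow> 'a expo \<Rightarrow> bool" where
  "less_expo = expo_less"

definition less_eq_expo :: "'a expo \<Rightarrow> 'a expo \<Rightarrow> bool" where
  "less_eq_expo s t \<longleftrightarrow> expo_less s t \<or> s = t"

lemma less_expo_iff: "s < t \<longleftrightarrow> zdeg s < zdeg t \<or> zdeg s = zdeg t \<and>
     (\<exists>i. ydeg s i < ydeg t i \<and> (\<forall>j. to_nat j < to_nat i \<longrightarrow> ydeg s j = ydeg t j))" for s t :: "'a expo"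
  by (simp add: less_expo_def expo_less_def)

instance
proof
  have irrefl: "\<not> s < s" for s :: "'a expo"
    by (auto simp: less_expo_iff)
  have trans: "s < u" if st: "s < t" and tu: "t < u" for s t u :: "'a expo"
  proof (cases "zdeg s = zdeg t \<and> zdeg t = zdeg u")
    case True
    obtain i where i: "ydeg s i < ydeg t i" "\<And>j. to_nat j < to_nat i \<Longrightarrow> ydeg s j = ydeg t j"
      using st True by (auto simp: less_expo_iff)
    obtain i' where i': "ydeg t i' < ydeg u i'" "\<And>j. to_nat j < to_nat i' \<Longrightarrow> ydeg t j = ydeg u j"
      using tu True by (auto simp: less_expo_iff)
    define l where "l = (if to_nat i < to_nat i' then i else i')"
    have "ydeg s l < ydeg u l"
      using i i' by (cases "to_nat i" "to_nat i'" rule: linorder_cases)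
        (auto simp: l_def simp del: to_nat_split, (metis less_trans to_nat_split)?)
    moreover have "ydeg s j = ydeg u j" if "to_nat j < to_nat l" for j
      using i(2)[of j] i'(2)[of j] that by (auto simp: l_def split: if_splits)
    ultimately show ?thesis
      using True by (auto simp: less_expo_iff)
  next
    case False
    then show ?thesis
      using st tu by (auto simp: less_expo_iff)
  qed
  have total: "s < t \<or> s = t \<or> t < s" for s t :: "'a expo"
  proof (cases "zdeg s = zdeg t \<and> s \<noteq> t")
    case True
    then obtain j where j: "ydeg s j \<noteq> ydeg t j"
      by (auto simp: expo_eq_iff)
    obtain i where i: "ydeg s i \<noteq> ydeg t i" "\<And>j. to_nat j < to_nat i \<Longrightarrow> ydeg s j = ydeg t j"
      using ex_has_least_nat[of "\<lambda>i. ydeg s i \<noteq> ydeg t i" j to_nat] j by (meson linorder_not_less)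
    then have "(\<forall>j. to_nat j < to_nat i \<longrightarrow> ydeg s j = ydeg t j)
        \<and> (\<forall>j. to_nat j < to_nat i \<longrightarrow> ydeg t j = ydeg s j)"
      by auto
    then show ?thesis
      using True i(1) unfolding less_expo_iff by (metis linorder_neq_iff)
  next
    case False
    then show ?thesis
      by (auto simp: less_expo_iff)
  qed
  fix s t u :: "'a expo"
  show "s < t \<longleftrightarrow> s \<le> t \<and> \<not> t \<le> s"
    using irrefl trans by (auto simp: less_eq_expo_def less_expo_def[symmetric])
  show "s \<le> s"
    by (simp add: less_eq_expo_def less_expo_def[symmetric])
  show "s \<le> t \<Longrightarrow> t \<le> u \<Longrightarrow> s \<le> u"
    using trans by (auto simp: less_eq_expo_def less_expo_def[symmetric])
  show "s \<le> t \<Longrightarrow> t \<le> s \<Longrightarrow> s = t"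
    using irrefl trans by (auto simp: less_eq_expo_def less_expo_def[symmetric])
  show "s \<le> t \<or> t \<le> s"
    using total by (auto simp: less_eq_expo_def less_expo_def[symmetric])
qed

end

instance expo :: (finite) linordered_ab_group_add
  by standard (auto simp: less_eq_expo_def less_expo_def[symmetric] less_expo_iff)

lemma zdeg_mono: "s \<le> t \<Longrightarrow> zdeg s \<le> zdeg t"
  by (auto simp: less_eq_expo_def less_expo_def[symmetric] less_expo_iff)

lemma zdeg_less: "zdeg s < zdeg t \<Longrightarrow> s < t"
  by (simp add: less_expo_iff)

lemma nonneg_expo:
  assumes "zdeg s \<ge> 0" "\<And>i. ydeg s i \<ge> 0"
  shows "s \<ge> 0"
proof (rule ccontr)
  assume "\<not> s \<ge> 0"
  then have "s < 0"
    by simp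
  then show False
    using assms by (auto simp: less_expo_iff) (metis linorder_not_less)
qed

section \<open>Linear extension of maps on monomials\<close>

lemma poly_mapping_sum_singles:
  fixes p :: "'g \<Rightarrow>\<^sub>0 'b::comm_monoid_add"
  shows "p = (\<Sum>s\<in>Poly_Mapping.keys p. Poly_Mapping.single s (Poly_Mapping.lookup p s))"
  by (rule poly_mapping_eqI) (auto simp: lookup_sum lookup_single when_def in_keys_iff)

lemma poly_mapping_induct [case_names zero single add]:
  fixes p :: "'g \<Rightarrow>\<^sub>0 'b::comm_monoid_add"
  assumes zero: "P 0"
    and single: "\<And>s c. P (Poly_Mapping.single s c)"
    and add: "\<And>p q. P p \<Longrightarrow> P q \<Longrightarrow> P (p + q)"
  shows "P p"
proof -
  have "P (\<Sum>s\<in>I. Poly_Mapping.single s (f s))" for I and f :: "'g \<Rightarrow> 'b"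
    by (induction I rule: infinite_finite_induct) (auto intro: assms)
  then show ?thesis
    by (metis poly_mapping_sum_singles)
qed

text \<open>The evaluations, substitutions and derivations below are all determined by their values on
single terms \<open>c \<cdot> X^s\<close>; \<open>h s c\<close> is that value. Additivity of \<open>h s\<close> makes the extension additive, and
multiplicativity of \<open>h\<close> in both arguments makes it multiplicative.\<close>

definition lin_ext :: "('g \<Rightarrow> 'b::zero \<Rightarrow> 'r::comm_monoid_add) \<Rightarrow> ('g \<Rightarrow>\<^sub>0 'b) \<Rightarrow> 'r" where
  "lin_ext h p = (\<Sum>s\<in>Poly_Mapping.keys p. h s (Poly_Mapping.lookup p s))"

lemma lin_ext_superset:
  assumes "\<And>s. h s 0 = 0" "finite S" "Poly_Mapping.keys p \<subseteq> S"
  shows "lin_ext h p = (\<Sum>s\<in>S. h s (Poly_Mapping.lookup p s))"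
  unfolding lin_ext_def using assms by (intro sum.mono_neutral_left) (auto simp: in_keys_iff)

lemma lin_ext_zero [simp]: "lin_ext h 0 = 0"
  by (simp add: lin_ext_def)

lemma lin_ext_single:
  assumes "\<And>s. h s 0 = 0"
  shows "lin_ext h (Poly_Mapping.single s c) = h s c"
  by (subst lin_ext_superset[of _ "{s}"]) (auto simp: assms)

lemma lin_ext_add:
  assumes "\<And>s. h s 0 = 0" "\<And>s a b. h s (a + b) = h s a + h s b"
  shows "lin_ext h (p + q) = lin_ext h p + lin_ext h q"
proof -
  let ?S = "Poly_Mapping.keys p \<union> Poly_Mapping.keys q"
  have "Poly_Mapping.keys (p + q) \<subseteq> ?S"
    by (rule keys_add)
  then show ?thesis
    by (simp add: lin_ext_superset[of h ?S] assms lookup_add sum.distrib)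
qed

lemma lin_ext_mult:
  fixes h :: "'g::monoid_add \<Rightarrow> 'b::semiring_0 \<Rightarrow> 'r::semiring_0"
  assumes h: "\<And>s. h s 0 = 0" "\<And>s a b. h s (a + b) = h s a + h s b"
    and m: "\<And>s t a b. h (s + t) (a * b) = h s a * h t b"
  shows "lin_ext h (p * q) = lin_ext h p * lin_ext h q"
proof (induction p rule: poly_mapping_induct)
  case (single s c)
  show ?case
    by (induction q rule: poly_mapping_induct)
       (simp_all add: lin_ext_single lin_ext_add h m mult_single distrib_left)
qed (simp_all add: lin_ext_add h distrib_right)

section \<open>Leading terms\<close>

definition const :: "'a \<Rightarrow> 'g::zero \<Rightarrow>\<^sub>0 'a::zero" where
  "const c = Poly_Mapping.single 0 c"

lemma const_simps [simp]:
  "const 0 = 0" "const 1 = (1 :: 'g::monoid_add \<Rightarrow>\<^sub>0 'b::semiring_1)"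
  "(const (a + b) :: 'g \<Rightarrow>\<^sub>0 'b) = const a + const b"
  "(const (a * b) :: 'g \<Rightarrow>\<^sub>0 'b) = const a * const b"
  by (simp_all add: const_def single_add mult_single)

lemma lookup_const_mult [simp]:
  fixes a :: "'g::monoid_add \<Rightarrow>\<^sub>0 'b::comm_semiring_1"
  shows "Poly_Mapping.lookup (const c * a) s = c * Poly_Mapping.lookup a s"
  by (induction a rule: poly_mapping_induct)
     (auto simp: const_def mult_single lookup_single when_def distrib_left lookup_add)

text \<open>Boundedness by \<open>s\<close> together with the coefficient at \<open>s\<close> describes leading terms without a case
distinction for \<open>0\<close>: the coefficient at \<open>s\<close> may vanish.\<close>

abbreviation bounded_by :: "('g::linorder \<Rightarrow>\<^sub>0 'b::zero) \<Rightarrow> 'g \<Rightarrow> bool" where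
  "bounded_by a s \<equiv> Poly_Mapping.keys a \<subseteq> {..s}"

lemma bounded_by_lookup: "bounded_by a s \<Longrightarrow> s < t \<Longrightarrow> Poly_Mapping.lookup a t = 0"
  by (meson atMost_iff in_keys_iff linorder_not_le subsetD)

lemma bounded_by_add: "bounded_by a s \<Longrightarrow> bounded_by b s \<Longrightarrow> bounded_by (a + b) s"
  using keys_add[of a b] by blast

text \<open>Only the two top terms contribute to the coefficient at \<open>s + t\<close>, since every other pair of
exponents has a smaller sum.\<close>

lemma top_mult:
  fixes a b :: "'g::linordered_ab_group_add \<Rightarrow>\<^sub>0 'b::comm_ring_1"
  assumes "bounded_by a s" "bounded_by b t"
  shows bounded_by_mult: "bounded_by (a * b) (s + t)"
    and lookup_top_mult: "Poly_Mapping.lookup (a * b) (s + t) = Poly_Mapping.lookup a s * Poly_Mapping.lookup b t"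
proof -
  show "bounded_by (a * b) (s + t)"
    using keys_mult[of a b] assms by (fastforce intro: add_mono)
  define a' where "a' = a - Poly_Mapping.single s (Poly_Mapping.lookup a s)"
  define b' where "b' = b - Poly_Mapping.single t (Poly_Mapping.lookup b t)"
  have a: "a = Poly_Mapping.single s (Poly_Mapping.lookup a s) + a'"
    and b: "b = Poly_Mapping.single t (Poly_Mapping.lookup b t) + b'"
    by (simp_all add: a'_def b'_def)
  have ka: "Poly_Mapping.keys a' \<subseteq> {..<s}" and kb: "Poly_Mapping.keys b' \<subseteq> {..<t}"
    using assms by (auto simp: a'_def b'_def in_keys_iff lookup_minus lookup_single when_def
        order_le_less split: if_splits)
  have z: "Poly_Mapping.lookup (f * g) (s + t) = 0"
    if "Poly_Mapping.keys f \<subseteq> {..s}" "Poly_Mapping.keys g \<subseteq> {..t}"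
      "Poly_Mapping.keys f \<subseteq> {..<s} \<or> Poly_Mapping.keys g \<subseteq> {..<t}" for f g :: "'g \<Rightarrow>\<^sub>0 'b"
  proof -
    have "s + t \<noteq> u + v" if "u \<in> Poly_Mapping.keys f" "v \<in> Poly_Mapping.keys g" for u v
    proof -
      have "u \<le> s" "v \<le> t" "u < s \<or> v < t"
        using that \<open>Poly_Mapping.keys f \<subseteq> {..s}\<close> \<open>Poly_Mapping.keys g \<subseteq> {..t}\<close>
          \<open>Poly_Mapping.keys f \<subseteq> {..<s} \<or> Poly_Mapping.keys g \<subseteq> {..<t}\<close> by auto
      then have "u + v < s + t"
        by (auto intro: add_less_le_mono add_le_less_mono)
      then show ?thesis by simp
    qed
    then have "s + t \<notin> Poly_Mapping.keys (f * g)"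
      using keys_mult[of f g] by blast
    then show ?thesis
      by (simp add: in_keys_iff)
  qed
  have ls: "Poly_Mapping.keys (Poly_Mapping.single v c) \<subseteq> {..v}" for v :: 'g and c :: 'b
    by simp
  have ka': "Poly_Mapping.keys a' \<subseteq> {..s}" and kb': "Poly_Mapping.keys b' \<subseteq> {..t}"
    using ka kb by auto
  have "a * b = Poly_Mapping.single (s + t) (Poly_Mapping.lookup a s * Poly_Mapping.lookup b t)
      + Poly_Mapping.single s (Poly_Mapping.lookup a s) * b' + a' * Poly_Mapping.single t (Poly_Mapping.lookup b t) + a' * b'"
    by (subst a, subst b) (simp add: algebra_simps mult_single)
  then show "Poly_Mapping.lookup (a * b) (s + t) = Poly_Mapping.lookup a s * Poly_Mapping.lookup b t"
    using z[OF ls kb'] z[OF ka' ls] z[OF ka' kb'] ka kb by (simp add: lookup_add)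
qed

definition lm :: "('g::linorder \<Rightarrow>\<^sub>0 'b::zero) \<Rightarrow> 'g" where
  "lm a = Max (Poly_Mapping.keys a)"

lemma keys_nonempty: "a \<noteq> 0 \<Longrightarrow> Poly_Mapping.keys a \<noteq> {}"
  by (metis all_not_in_conv lookup_zero not_in_keys_iff_lookup_eq_zero poly_mapping_eqI)

lemma bounded_by_lm: "bounded_by a (lm a)"
  by (auto simp: lm_def)

lemma lookup_lm: "a \<noteq> 0 \<Longrightarrow> Poly_Mapping.lookup a (lm a) \<noteq> 0"
  using Max_in[of "Poly_Mapping.keys a"] keys_nonempty[of a] by (auto simp: lm_def in_keys_iff)

lemma lm_eqI: "bounded_by a s \<Longrightarrow> Poly_Mapping.lookup a s \<noteq> 0 \<Longrightarrow> lm a = s"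
  unfolding lm_def by (rule Max_eqI) (auto simp: in_keys_iff)

lemma lm_le_iff: "a \<noteq> 0 \<Longrightarrow> lm a \<le> s \<longleftrightarrow> bounded_by a s"
  unfolding lm_def using keys_nonempty[of a] by (subst Max_le_iff) auto

lemma lm_mult:
  fixes a b :: "'g::linordered_ab_group_add \<Rightarrow>\<^sub>0 'b::idom"
  assumes "a \<noteq> 0" "b \<noteq> 0"
  shows "lm (a * b) = lm a + lm b"
  using assms by (intro lm_eqI) (auto simp: bounded_by_mult bounded_by_lm lookup_top_mult lookup_lm)

lemma lm_single [simp]: "c \<noteq> 0 \<Longrightarrow> lm (Poly_Mapping.single s c) = s"
  by (simp add: lm_def)

lemma lin_ext_sub:
  fixes h :: "'g \<Rightarrow> 'b::ab_group_add \<Rightarrow> 'r::ab_group_add"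
  assumes "\<And>s. h s 0 = 0" "\<And>s a b. h s (a + b) = h s a + h s b"
  shows "lin_ext h (p - q) = lin_ext h p - lin_ext h q"
  using lin_ext_add[of h "p - q" q] assms by (simp add: algebra_simps)

section \<open>Substitution into polynomials\<close>

definition mpoly_subst ::
    "('v \<Rightarrow> 'g \<Rightarrow>\<^sub>0 'a) \<Rightarrow> ('v, 'a) mpoly \<Rightarrow> ('g::comm_monoid_add \<Rightarrow>\<^sub>0 'a::comm_semiring_1)" where
  "mpoly_subst h = lin_ext (\<lambda>m c. const c * (\<Prod>v\<in>Poly_Mapping.keys m. h v ^ Poly_Mapping.lookup m v))"

lemma mpoly_subst_zero [simp]: "mpoly_subst h 0 = 0"
  by (simp add: mpoly_subst_def)

lemma mpoly_subst_add [simp]: "mpoly_subst h (p + q) = mpoly_subst h p + mpoly_subst h q"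
  unfolding mpoly_subst_def by (rule lin_ext_add) (simp_all add: distrib_right)

lemma mpoly_subst_mult [simp]: "mpoly_subst h (p * q) = mpoly_subst h p * mpoly_subst h q"
  unfolding mpoly_subst_def
  by (rule lin_ext_mult) (simp_all add: distrib_right monom_eval_add ac_simps)

lemma mpoly_subst_single:
  "mpoly_subst h (Poly_Mapping.single m c) =
     const c * (\<Prod>v\<in>Poly_Mapping.keys m. h v ^ Poly_Mapping.lookup m v)"
  unfolding mpoly_subst_def by (rule lin_ext_single) simp

lemma mpoly_subst_const [simp]: "mpoly_subst h (const c) = const c"
  by (subst (1) const_def) (simp add: mpoly_subst_single)

lemma mpoly_subst_one [simp]: "mpoly_subst h 1 = 1"
  using mpoly_subst_const[of h 1] by simp

lemma mpoly_subst_power [simp]: "mpoly_subst h (p ^ n) = mpoly_subst h p ^ n"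
  by (induction n) simp_all

lemma mpoly_subst_prod [simp]: "mpoly_subst h (\<Prod>i\<in>I. p i) = (\<Prod>i\<in>I. mpoly_subst h (p i))"
  by (induction I rule: infinite_finite_induct) simp_all

definition var :: "'v \<Rightarrow> ('v, 'a::comm_semiring_1) mpoly" where
  "var v = Poly_Mapping.single (Poly_Mapping.single v 1) 1"

lemma mpoly_subst_var [simp]: "mpoly_subst h (var v) = h v"
  by (simp add: var_def mpoly_subst_single)

lemma mpoly_eval_var [simp]: "mpoly_eval (var v) x = x v"
  by (simp add: var_def)

lemma mpoly_eval_const [simp]: "mpoly_eval (const c) x = c"
  by (simp add: const_def)

lemma mpoly_eval_diff [simp]:
  fixes p q :: "('v, 'a::comm_ring_1) mpoly"
  shows "mpoly_eval (p - q) x = mpoly_eval p x - mpoly_eval q x"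
  using mpoly_eval_add[of "p - q" q x] by (simp add: algebra_simps del: mpoly_eval_add)

lemma mpoly_subst_diff [simp]:
  fixes p q :: "('v, 'a::comm_ring_1) mpoly"
  shows "mpoly_subst h (p - q) = mpoly_subst h p - mpoly_subst h q"
  using mpoly_subst_add[of h "p - q" q] by (simp add: algebra_simps del: mpoly_subst_add)

lemma mpoly_induct [case_names const var add mult]:
  fixes p :: "('v, 'a::comm_semiring_1) mpoly"
  assumes const: "\<And>c. P (const c)" and var: "\<And>v. P (var v)"
    and add: "\<And>p q. P p \<Longrightarrow> P q \<Longrightarrow> P (p + q)"
    and mult: "\<And>p q. P p \<Longrightarrow> P q \<Longrightarrow> P (p * q)"
  shows "P p"
proof (induction p rule: poly_mapping_induct)
  case (single m c)
  have one: "P 1"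
    using const[of 1] by simp
  have pow: "P (var v ^ n)" for v n
    by (induction n) (simp_all add: one mult[OF var])
  have prod: "P (\<Prod>v\<in>I. var v ^ f v)" for I f
    by (induction I rule: infinite_finite_induct) (simp_all add: one mult[OF pow])
  have vp: "var v ^ n = Poly_Mapping.single (Poly_Mapping.single v n) (1::'a)" for v :: 'v and n
    by (induction n) (simp_all add: var_def mult_single flip: single_add)
  have ps: "(\<Prod>v\<in>I. Poly_Mapping.single (f v) (1::'a)) = Poly_Mapping.single (\<Sum>v\<in>I. f v) 1"
    for I :: "'v set" and f :: "'v \<Rightarrow> 'v \<Rightarrow>\<^sub>0 nat"
    by (induction I rule: infinite_finite_induct) (simp_all add: mult_single)
  have "Poly_Mapping.single m c = const c * (\<Prod>v\<in>Poly_Mapping.keys m. var v ^ Poly_Mapping.lookup m v)"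
    unfolding vp ps poly_mapping_sum_singles[of m, symmetric] by (simp add: const_def mult_single)
  then show ?case
    using mult[OF const prod, of c "Poly_Mapping.lookup m" "Poly_Mapping.keys m"] by simp
next
  case zero
  then show ?case using const[of 0] by simp
qed (auto intro: add)

section \<open>Laurent polynomials as functions on the torus\<close>

type_synonym ('n, 'a) laurent = "'n expo \<Rightarrow>\<^sub>0 'a"

definition torus_char :: "'a::field \<Rightarrow> ('n::finite \<Rightarrow> 'a) \<Rightarrow> 'n expo \<Rightarrow> 'a" where
  "torus_char z y s = z powi zdeg s * (\<Prod>i\<in>UNIV. y i powi ydeg s i)"

definition laurent_eval :: "'a::field \<Rightarrow> ('n::finite \<Rightarrow> 'a) \<Rightarrow> ('n, 'a) laurent \<Rightarrow> 'a" where
  "laurent_eval z y = lin_ext (\<lambda>s c. c * torus_char z y s)"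

lemma torus_char_zero [simp]: "torus_char z y 0 = 1"
  by (simp add: torus_char_def)

lemma torus_char_add:
  assumes "z \<noteq> 0" "\<And>i. y i \<noteq> 0"
  shows "torus_char z y (s + t) = torus_char z y s * torus_char z y t"
  using assms by (simp add: torus_char_def power_int_add prod.distrib)

lemma torus_char_nonzero:
  assumes "z \<noteq> 0" "\<And>i. y i \<noteq> 0"
  shows "torus_char z y s \<noteq> 0"
  using assms by (simp add: torus_char_def)

lemma torus_char_mult_point:
  "torus_char (z * z') (\<lambda>i. y i * y' i) s = torus_char z y s * torus_char z' y' s"
  by (simp add: torus_char_def power_int_mult_distrib prod.distrib)

lemma two_powi_eq_one:
  assumes "(2::'a::field_char_0) powi n = 1"
  shows "n = 0"
proof -
  have pos: "m = 0" if "(2::'a) ^ m = 1" for m :: nat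
  proof -
    have "of_nat (2 ^ m) = (of_nat 1 :: 'a)"
      using that by simp
    then show ?thesis
      by (simp only: of_nat_eq_iff) simp
  qed
  show ?thesis
  proof (cases "n \<ge> 0")
    case True
    then show ?thesis
      using pos[of "nat n"] assms by (simp add: power_int_def)
  next
    case False
    then show ?thesis
      using pos[of "nat (- n)"] assms by (simp add: power_int_def inverse_eq_divide power_one_over)
  qed
qed

text \<open>The number 2 has infinite multiplicative order in characteristic zero, so a point with one
coordinate 2 and all others 1 separates exponents that differ in that coordinate.\<close>

lemma torus_char_distinct:
  fixes s t :: "'n::finite expo"
  assumes "s \<noteq> t"
  obtains z :: "'a::field_char_0" and y where "z \<noteq> 0" "\<And>i. y i \<noteq> 0" "torus_char z y s \<noteq> torus_char z y t"
proof -
  have two: "a = b" if "(2::'a) powi a = 2 powi b" for a b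
  proof -
    have "(2::'a) powi (a - b) = 1"
      using that by (simp add: power_int_diff)
    then show ?thesis
      using two_powi_eq_one[of "a - b"] by simp
  qed
  show ?thesis
  proof (cases "zdeg s = zdeg t")
    case False
    then show ?thesis
      using two[of "zdeg s" "zdeg t"] that[of 2 "\<lambda>_. 1"] by (auto simp: torus_char_def)
  next
    case True
    then obtain i where i: "ydeg s i \<noteq> ydeg t i"
      using assms by (auto simp: expo_eq_iff)
    define y :: "'n \<Rightarrow> 'a" where "y j = (if j = i then 2 else 1)" for j
    have "(\<Prod>j\<in>UNIV. y j powi f j) = 2 powi f i" for f
      by (subst prod.remove[of _ i]) (auto simp: y_def)
    then show ?thesis
      using two[of "ydeg s i" "ydeg t i"] i by (intro that[of 1 y]) (auto simp: torus_char_def, simp add: y_def split: if_splits)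
  qed
qed

text \<open>Dedekind's argument: translating a relation by a point that separates two of its characters and
subtracting a multiple of the original relation gives a shorter one.\<close>

lemma torus_chars_independent:
  fixes c :: "'n::finite expo \<Rightarrow> 'a::field_char_0"
  assumes "finite K"
    and "\<And>z y. z \<noteq> 0 \<Longrightarrow> (\<And>i. y i \<noteq> 0) \<Longrightarrow> (\<Sum>s\<in>K. c s * torus_char z y s) = 0"
    and "s \<in> K"
  shows "c s = 0"
  using assms
proof (induction K arbitrary: c s rule: finite_induct)
  case (insert a K)
  have K0: "c s = 0" if s: "s \<in> K" for s
  proof -
    have "s \<noteq> a"
      using s insert.hyps by auto
    then obtain w :: 'a and x where wx: "w \<noteq> 0" "\<And>i. x i \<noteq> 0" "torus_char w x s \<noteq> torus_char w x a"
      using torus_char_distinct by blast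
    \<comment> \<open>The term of \<open>a\<close> cancels in this difference, so the induction hypothesis applies.\<close>
    have "(\<Sum>s\<in>K. (c s * (torus_char w x s - torus_char w x a)) * torus_char z y s) = 0"
      if zy: "z \<noteq> 0" "\<And>i. y i \<noteq> 0" for z y
    proof -
      have "(\<Sum>s\<in>insert a K. c s * torus_char (w * z) (\<lambda>i. x i * y i) s)
          - torus_char w x a * (\<Sum>s\<in>insert a K. c s * torus_char z y s) = 0"
        using insert.prems(1) wx zy by simp
      then show ?thesis
        using insert.hyps
        by (simp add: torus_char_mult_point sum_distrib_left sum_subtractf algebra_simps)
    qed
    then have "c s * (torus_char w x s - torus_char w x a) = 0"
      using insert.IH[of "\<lambda>s. c s * (torus_char w x s - torus_char w x a)" s] s by blast
    then show ?thesis
      using wx by simp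
  qed
  moreover have "c a = 0"
    using insert.prems(1)[of 1 "\<lambda>_. 1"] insert.hyps K0 torus_char_nonzero[of 1 "\<lambda>_. 1::'a" a]
    by simp
  ultimately show ?case
    using insert.prems by auto
qed simp

lemma laurent_eqI:
  fixes a b :: "('n::finite, 'a::field_char_0) laurent"
  assumes "\<And>z y. z \<noteq> 0 \<Longrightarrow> (\<And>i. y i \<noteq> 0) \<Longrightarrow> laurent_eval z y a = laurent_eval z y b"
  shows "a = b"
proof -
  have "laurent_eval z y (a - b) = 0" if "z \<noteq> 0" "\<And>i. y i \<noteq> 0" for z y
    using assms[OF that] by (simp add: laurent_eval_def lin_ext_sub distrib_right)
  then have "Poly_Mapping.lookup (a - b) s = 0" if "s \<in> Poly_Mapping.keys (a - b)" for s
    using torus_chars_independent[of "Poly_Mapping.keys (a - b)" "Poly_Mapping.lookup (a - b)" s] that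
    by (simp add: laurent_eval_def lin_ext_def)
  then have "a - b = 0"
    by (metis all_not_in_conv in_keys_iff keys_nonempty)
  then show ?thesis
    by simp
qed

lemma laurent_eval_single [simp]:
  "laurent_eval z y (Poly_Mapping.single s c) = c * torus_char z y s"
  unfolding laurent_eval_def by (rule lin_ext_single) simp

lemma laurent_eval_const [simp]: "laurent_eval z y (const c) = c"
  by (simp add: const_def)

lemma laurent_eval_add [simp]: "laurent_eval z y (a + b) = laurent_eval z y a + laurent_eval z y b"
  unfolding laurent_eval_def by (rule lin_ext_add) (simp_all add: distrib_right)

lemma laurent_eval_zero [simp]: "laurent_eval z y 0 = 0"
  by (simp add: laurent_eval_def)

lemma laurent_eval_sum [simp]: "laurent_eval z y (\<Sum>i\<in>I. f i) = (\<Sum>i\<in>I. laurent_eval z y (f i))"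
  by (induction I rule: infinite_finite_induct) simp_all

context
  fixes z :: "'a::field" and y :: "'n::finite \<Rightarrow> 'a"
  assumes nz: "z \<noteq> 0" "\<And>i. y i \<noteq> 0"
begin

lemma laurent_eval_mult: "laurent_eval z y (a * b) = laurent_eval z y a * laurent_eval z y b"
  unfolding laurent_eval_def using nz
  by (intro lin_ext_mult) (simp_all add: distrib_right torus_char_add)

lemma laurent_eval_power: "laurent_eval z y (a ^ n) = laurent_eval z y a ^ n"
  using laurent_eval_const[of z y 1] by (induction n) (simp_all add: laurent_eval_mult)

lemma laurent_eval_prod: "laurent_eval z y (\<Prod>i\<in>I. f i) = (\<Prod>i\<in>I. laurent_eval z y (f i))"
  using laurent_eval_const[of z y 1]
  by (induction I rule: infinite_finite_induct) (simp_all add: laurent_eval_mult)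

lemma laurent_eval_mpoly_subst:
  "laurent_eval z y (mpoly_subst h p) = mpoly_eval p (\<lambda>v. laurent_eval z y (h v))"
proof (induction p rule: mpoly_induct)
qed (simp_all add: laurent_eval_mult)

end

section \<open>Leading terms with respect to z alone\<close>

definition zlow :: "int \<Rightarrow> ('n, 'a::zero) laurent set" where
  "zlow n = {a. \<forall>t\<in>Poly_Mapping.keys a. zdeg t < n}"

lemma zlow_zero [simp]: "0 \<in> zlow n"
  by (simp add: zlow_def)

lemma zlow_add: "a \<in> zlow n \<Longrightarrow> b \<in> zlow n \<Longrightarrow> a + b \<in> zlow n"
  using keys_add[of a b] by (auto simp: zlow_def)

lemma zlow_uminus: "a \<in> zlow n \<Longrightarrow> - a \<in> zlow n" for a :: "('n, 'a::ab_group_add) laurent"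
  by (auto simp: zlow_def in_keys_iff)

lemma zlow_diff: "a \<in> zlow n \<Longrightarrow> b \<in> zlow n \<Longrightarrow> a - b \<in> zlow n" for a :: "('n, 'a::ab_group_add) laurent"
  using zlow_add[of a n "- b"] zlow_uminus[of b n] by simp

lemma zlow_sum: "(\<And>i. i \<in> I \<Longrightarrow> f i \<in> zlow n) \<Longrightarrow> (\<Sum>i\<in>I. f i) \<in> zlow n"
  by (induction I rule: infinite_finite_induct) (simp_all add: zlow_add)

lemma zlow_mono: "a \<in> zlow m \<Longrightarrow> m \<le> n \<Longrightarrow> a \<in> zlow n"
  by (force simp: zlow_def)

lemma zlow_mult:
  fixes a b :: "('n, 'a::comm_semiring_1) laurent"
  assumes "a \<in> zlow m" "b \<in> zlow (n + 1)"
  shows "a * b \<in> zlow (m + n)"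
  unfolding zlow_def
proof (intro CollectI ballI)
  fix t assume "t \<in> Poly_Mapping.keys (a * b)"
  then obtain u v where "t = u + v" "u \<in> Poly_Mapping.keys a" "v \<in> Poly_Mapping.keys b"
    using keys_mult[of a b] by blast
  then show "zdeg t < m + n"
    using assms by (fastforce simp: zlow_def)
qed

lemma zlow_single: "zdeg s < n \<Longrightarrow> Poly_Mapping.single s c \<in> zlow n"
  by (simp add: zlow_def)

text \<open>A finer notion than the leading monomial of the lexicographic order: a single term is split off such
that all remaining terms have smaller degree in \<open>z\<close>. The generators of the coordinate ring and their
products have this property.\<close>

definition zlead :: "('n, 'a::comm_ring_1) laurent \<Rightarrow> 'n expo \<Rightarrow> 'a \<Rightarrow> bool" where
  "zlead a s c \<longleftrightarrow> a - Poly_Mapping.single s c \<in> zlow (zdeg s)"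

lemma zlead_single [simp]: "zlead (Poly_Mapping.single s c) s c"
  by (simp add: zlead_def)

lemma zlead_add_zlow: "zlead a s c \<Longrightarrow> b \<in> zlow (zdeg s) \<Longrightarrow> zlead (a + b) s c"
  using zlow_add[of "a - Poly_Mapping.single s c" "zdeg s" b] by (simp add: zlead_def algebra_simps)

lemma zlead_in_zlow:
  assumes "zlead a s c"
  shows "a \<in> zlow (zdeg s + 1)"
  using zlow_add[of "a - Poly_Mapping.single s c" "zdeg s + 1" "Poly_Mapping.single s c"] assms
  by (simp add: zlead_def zlow_single zlow_mono[of _ "zdeg s"])

lemma zlead_mult:
  assumes "zlead a s c" "zlead b t d"
  shows "zlead (a * b) (s + t) (c * d)"
proof -
  have "a * b - Poly_Mapping.single (s + t) (c * d) =
      (a - Poly_Mapping.single s c) * b + (b - Poly_Mapping.single t d) * Poly_Mapping.single s c"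
    by (simp add: algebra_simps mult_single)
  moreover have "(a - Poly_Mapping.single s c) * b \<in> zlow (zdeg s + zdeg t)"
    using assms zlead_in_zlow[of b t d] by (intro zlow_mult) (auto simp: zlead_def)
  moreover have "(b - Poly_Mapping.single t d) * Poly_Mapping.single s c \<in> zlow (zdeg t + zdeg s)"
    using assms by (intro zlow_mult) (auto simp: zlead_def zlow_single)
  ultimately show ?thesis
    by (simp add: zlead_def zlow_add add.commute)
qed

text \<open>The exponent of an \<open>n\<close>-th power.\<close>

fun nmult :: "nat \<Rightarrow> 'b::monoid_add \<Rightarrow> 'b" where
  "nmult 0 s = 0" | "nmult (Suc n) s = s + nmult n s"

lemma nmult_zdeg [simp]: "zdeg (nmult n s) = int n * zdeg s"
  by (induction n) (simp_all add: algebra_simps)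

lemma nmult_ydeg [simp]: "ydeg (nmult n s) i = int n * ydeg s i"
  by (induction n) (simp_all add: algebra_simps)

lemma zlead_one: "zlead 1 0 1"
  by (simp add: zlead_def)

lemma zlead_power: "zlead a s c \<Longrightarrow> zlead (a ^ n) (nmult n s) (c ^ n)"
  by (induction n) (simp_all add: zlead_one zlead_mult)

lemma zlead_bounded_by:
  fixes a :: "('n::finite, 'a::comm_ring_1) laurent"
  assumes "zlead a s c"
  shows "bounded_by a s" "Poly_Mapping.lookup a s = c"
proof -
  have *: "Poly_Mapping.lookup (a - Poly_Mapping.single s c) t = 0" if "zdeg s \<le> zdeg t" for t
  proof (rule ccontr)
    assume "Poly_Mapping.lookup (a - Poly_Mapping.single s c) t \<noteq> 0"
    then have "t \<in> Poly_Mapping.keys (a - Poly_Mapping.single s c)"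
      by (simp add: in_keys_iff)
    then have "zdeg t < zdeg s"
      using assms by (simp add: zlead_def zlow_def)
    then show False
      using that by simp
  qed
  show "bounded_by a s"
  proof
    fix t assume "t \<in> Poly_Mapping.keys a"
    then have "t = s \<or> zdeg t < zdeg s"
      using *[of t] by (cases "zdeg s \<le> zdeg t") (auto simp: lookup_minus lookup_single in_keys_iff when_def split: if_splits)
    then show "t \<in> {..s}"
      using zdeg_less[of t s] by auto
  qed
  show "Poly_Mapping.lookup a s = c"
    using *[of s] by (simp add: lookup_minus)
qed

lemma mpoly_subst_sum [simp]: "mpoly_subst h (\<Sum>i\<in>I. p i) = (\<Sum>i\<in>I. mpoly_subst h (p i))"
  by (induction I rule: infinite_finite_induct) simp_all

section \<open>The coordinate ring of a Danielewski variety\<close>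

locale danielewski =
  fixes k :: "'n::finite \<Rightarrow> nat" and d :: nat and q :: "nat \<Rightarrow> ('n, 'a::field_char_0) mpoly"
  assumes d2: "d \<ge> 2" and k2: "\<And>i. k i \<ge> 2"
begin

abbreviation V :: "('n coord \<Rightarrow> 'a) set" where
  "V \<equiv> danielewski_variety k d q"

definition yexp :: "'n \<Rightarrow> 'n expo" where "yexp i = Expo 0 (\<lambda>j. if j = i then 1 else 0)"
definition zexp :: "'n expo" where "zexp = Expo 1 (\<lambda>_. 0)"
definition mexp :: "'n expo" where "mexp = Expo 0 (\<lambda>i. int (k i))"
definition xexp :: "'n expo" where "xexp = Expo (int d) (\<lambda>i. - int (k i))"

lemma exp_simps [simp]:
  "zdeg (yexp i) = 0" "ydeg (yexp i) j = (if j = i then 1 else 0)"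
  "zdeg zexp = 1" "ydeg zexp j = 0" "zdeg mexp = 0" "ydeg mexp j = int (k j)"
  "zdeg xexp = int d" "ydeg xexp j = - int (k j)"
  by (simp_all add: yexp_def zexp_def mexp_def xexp_def)

definition Y :: "'n \<Rightarrow> ('n, 'a) laurent" where "Y i = Poly_Mapping.single (yexp i) 1"
definition Z :: "('n, 'a) laurent" where "Z = Poly_Mapping.single zexp 1"
definition M :: "('n, 'a) laurent" where "M = Poly_Mapping.single mexp 1"
definition P :: "('n, 'a) laurent" where "P = Z ^ d + (\<Sum>j<d. mpoly_subst Y (q j) * Z ^ j)"
text \<open>The image of the coordinate \<open>x\<close>, that is, \<open>P / M\<close>.\<close>

definition X :: "('n, 'a) laurent" where "X = Poly_Mapping.single (- mexp) 1 * P"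

lemma X_mult_M: "X * M = P"
  by (simp add: X_def M_def mult.commute[of _ P] mult.assoc mult_single)

lemma Z_power: "Z ^ n = Poly_Mapping.single (nmult n zexp) 1"
  by (induction n) (simp_all add: Z_def mult_single)

lemma Y_power: "Y i ^ n = Poly_Mapping.single (nmult n (yexp i)) 1"
  by (induction n) (simp_all add: Y_def mult_single)

lemma prod_single: "(\<Prod>i\<in>I. Poly_Mapping.single (f i) (1::'a)) = Poly_Mapping.single (\<Sum>i\<in>I. f i :: 'n expo) 1"
  by (induction I rule: infinite_finite_induct) (simp_all add: mult_single)

lemma prod_Y_power: "(\<Prod>i\<in>UNIV. Y i ^ n i) = Poly_Mapping.single (Expo 0 (\<lambda>i. int (n i))) 1"
proof -
  have "(\<Sum>i\<in>UNIV. nmult (n i) (yexp i)) = Expo 0 (\<lambda>i. int (n i))"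
    by (rule expo_eqI) (simp_all add: if_distrib cong: if_cong)
  then show ?thesis
    by (simp add: Y_power prod_single)
qed

lemma M_eq: "M = (\<Prod>i\<in>UNIV. Y i ^ k i)"
  by (simp add: prod_Y_power M_def mexp_def)

primrec gen :: "'n coord \<Rightarrow> ('n, 'a) laurent" where
  "gen coord_x = X" | "gen (coord_y i) = Y i" | "gen coord_z = Z"

definition Phi :: "('n coord, 'a) mpoly \<Rightarrow> ('n, 'a) laurent" where
  "Phi = mpoly_subst gen"

definition A :: "('n, 'a) laurent set" where "A = range Phi"

lemma Phi_simps [simp]:
  "Phi 0 = 0" "Phi 1 = 1" "Phi (p + p') = Phi p + Phi p'" "Phi (p - p') = Phi p - Phi p'"
  "Phi (p * p') = Phi p * Phi p'" "Phi (p ^ n) = Phi p ^ n"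
  "Phi (\<Sum>i\<in>I. f i) = (\<Sum>i\<in>I. Phi (f i))" "Phi (\<Prod>i\<in>I. f i) = (\<Prod>i\<in>I. Phi (f i))"
  "Phi (const c) = const c" "Phi (var v) = gen v"
  by (simp_all add: Phi_def)

lemma A_closed [intro, simp]:
  "0 \<in> A" "1 \<in> A" "const c \<in> A" "gen v \<in> A"
  "a \<in> A \<Longrightarrow> b \<in> A \<Longrightarrow> a + b \<in> A"
  "a \<in> A \<Longrightarrow> b \<in> A \<Longrightarrow> a - b \<in> A"
  "a \<in> A \<Longrightarrow> b \<in> A \<Longrightarrow> a * b \<in> A"
  unfolding A_def image_iff
  using Phi_simps[symmetric] by (blast, blast, blast, blast, metis UNIV_I, metis UNIV_I, metis UNIV_I)

lemma A_power [intro, simp]: "a \<in> A \<Longrightarrow> a ^ n \<in> A"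
  by (induction n) simp_all

lemma A_prod [intro]: "(\<And>i. i \<in> I \<Longrightarrow> f i \<in> A) \<Longrightarrow> (\<Prod>i\<in>I. f i) \<in> A"
  by (induction I rule: infinite_finite_induct) simp_all

lemma A_sum [intro]: "(\<And>i. i \<in> I \<Longrightarrow> f i \<in> A) \<Longrightarrow> (\<Sum>i\<in>I. f i) \<in> A"
  by (induction I rule: infinite_finite_induct) simp_all

lemma A_gens [simp]: "X \<in> A" "Y i \<in> A" "Z \<in> A"
  using A_closed(4)[of coord_x] A_closed(4)[of "coord_y i"] A_closed(4)[of coord_z] by simp_all

lemma M_in_A [simp]: "M \<in> A"
  by (auto simp: M_eq)

lemma A_induct [consumes 1, case_names const gen add mult]:
  assumes "a \<in> A" "\<And>c. Q (const c)" "\<And>v. Q (gen v)"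
    "\<And>a b. a \<in> A \<Longrightarrow> b \<in> A \<Longrightarrow> Q a \<Longrightarrow> Q b \<Longrightarrow> Q (a + b)"
    "\<And>a b. a \<in> A \<Longrightarrow> b \<in> A \<Longrightarrow> Q a \<Longrightarrow> Q b \<Longrightarrow> Q (a * b)"
  shows "Q a"
proof -
  have "Q (Phi p)" for p
    by (induction p rule: mpoly_induct) (auto intro!: assms(2-) simp: A_def)
  then show ?thesis
    using assms(1) by (auto simp: A_def)
qed

text \<open>The points with all \<open>y\<^sub>i\<close> and \<open>z\<close> nonzero are parametrized by a torus, on which a Laurent polynomial
is determined by its values.\<close>

lemma Phi_eqI:
  assumes "\<And>u. u \<in> V \<Longrightarrow> mpoly_eval p u = mpoly_eval p' u"
  shows "Phi p = Phi p'"
proof (rule laurent_eqI)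
  fix z :: 'a and y :: "'n \<Rightarrow> 'a"
  assume nz: "z \<noteq> 0" "\<And>i. y i \<noteq> 0"
  \<comment> \<open>The point of the variety over the torus point \<open>(z, y)\<close>; its \<open>x\<close>-coordinate is \<open>P / M\<close>.\<close>
  define u where "u = (\<lambda>v. laurent_eval z y (gen v))"
  have "laurent_eval z y (X * M) = laurent_eval z y P"
    by (simp add: X_mult_M)
  then have "u \<in> V"
    unfolding danielewski_variety_def P_def M_eq using nz
    by (simp add: u_def laurent_eval_mult laurent_eval_prod laurent_eval_power laurent_eval_mpoly_subst)
  then show "laurent_eval z y (Phi p) = laurent_eval z y (Phi p')"
    using assms[of u] nz by (simp add: Phi_def laurent_eval_mpoly_subst u_def)
qed

section \<open>Normal forms\<close>

text \<open>The leading exponents of the nonzero elements of \<open>A\<close>: the exponent of \<open>x^p y^a z^r\<close> with \<open>r < d\<close>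
has \<open>z\<close>-degree \<open>p d + r\<close> and \<open>y\<^sub>i\<close>-degree \<open>a\<^sub>i - k\<^sub>i p\<close>, so \<open>p\<close>, \<open>r\<close> and \<open>a\<close> can be read off.\<close>

definition cone :: "'n expo set" where
  "cone = {t. zdeg t \<ge> 0 \<and> (\<forall>i. ydeg t i + int (k i) * (zdeg t div int d) \<ge> 0)}"

definition basis_poly :: "'n expo \<Rightarrow> ('n coord, 'a) mpoly" where
  "basis_poly t = var coord_x ^ nat (zdeg t div int d) * var coord_z ^ nat (zdeg t mod int d) *
     (\<Prod>i\<in>UNIV. var (coord_y i) ^ nat (ydeg t i + int (k i) * (zdeg t div int d)))"

text \<open>Functions that agree on the variety with a combination of basis polynomials. The argument is carried
out with functions on \<open>V\<close> and not with Laurent polynomials because it must also cover the points where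
\<open>M\<close> vanishes.\<close>

definition nf :: "(('n coord \<Rightarrow> 'a) \<Rightarrow> 'a) set" where
  "nf = {g. \<exists>c. Poly_Mapping.keys c \<subseteq> cone \<and>
     (\<forall>u\<in>V. g u = (\<Sum>t\<in>Poly_Mapping.keys c. Poly_Mapping.lookup c t * mpoly_eval (basis_poly t) u))}"

lemma nf_cong: "g \<in> nf \<Longrightarrow> (\<And>u. u \<in> V \<Longrightarrow> g u = g' u) \<Longrightarrow> g' \<in> nf"
  by (simp add: nf_def)

lemma nf_add:
  assumes "g \<in> nf" "g' \<in> nf"
  shows "(\<lambda>u. g u + g' u) \<in> nf"
proof -
  obtain c where c: "Poly_Mapping.keys c \<subseteq> cone"
    "\<And>u. u \<in> V \<Longrightarrow> g u = lin_ext (\<lambda>t a. a * mpoly_eval (basis_poly t) u) c"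
    using assms(1) by (auto simp: nf_def lin_ext_def)
  obtain c' where c': "Poly_Mapping.keys c' \<subseteq> cone"
    "\<And>u. u \<in> V \<Longrightarrow> g' u = lin_ext (\<lambda>t a. a * mpoly_eval (basis_poly t) u) c'"
    using assms(2) by (auto simp: nf_def lin_ext_def)
  have "Poly_Mapping.keys (c + c') \<subseteq> cone"
    using c c' keys_add[of c c'] by blast
  moreover have "g u + g' u = lin_ext (\<lambda>t a. a * mpoly_eval (basis_poly t) u) (c + c')" if "u \<in> V" for u
    using c c' that by (simp add: lin_ext_add distrib_right)
  ultimately show ?thesis
    unfolding nf_def lin_ext_def by blast
qed

lemma nf_basis_poly: "t \<in> cone \<Longrightarrow> (\<lambda>u. c * mpoly_eval (basis_poly t) u) \<in> nf"
  unfolding nf_def by (intro CollectI exI[of _ "Poly_Mapping.single t c"]) auto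

lemma nf_zero: "(\<lambda>u. 0) \<in> nf"
  unfolding nf_def by (intro CollectI exI[of _ 0]) auto

lemma nf_sum: "(\<And>i. i \<in> I \<Longrightarrow> g i \<in> nf) \<Longrightarrow> (\<lambda>u. \<Sum>i\<in>I. g i u) \<in> nf"
  by (induction I rule: infinite_finite_induct) (simp_all add: nf_zero nf_add)

lemma nf_mult_if:
  assumes "\<And>t c. t \<in> cone \<Longrightarrow> (\<lambda>u. c * (f u * mpoly_eval (basis_poly t) u)) \<in> nf" and "g \<in> nf"
  shows "(\<lambda>u. f u * g u) \<in> nf"
proof -
  obtain c where c: "Poly_Mapping.keys c \<subseteq> cone"
    "\<And>u. u \<in> V \<Longrightarrow> g u = (\<Sum>t\<in>Poly_Mapping.keys c. Poly_Mapping.lookup c t * mpoly_eval (basis_poly t) u)"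
    using assms(2) by (auto simp: nf_def)
  have "(\<lambda>u. \<Sum>t\<in>Poly_Mapping.keys c. Poly_Mapping.lookup c t * (f u * mpoly_eval (basis_poly t) u)) \<in> nf"
    using c by (intro nf_sum assms(1)) auto
  then show ?thesis
    by (rule nf_cong) (simp add: c sum_distrib_left ac_simps)
qed

lemma nf_const: "g \<in> nf \<Longrightarrow> (\<lambda>u. c * g u) \<in> nf"
  by (rule nf_mult_if) (simp_all add: mult.assoc[symmetric] nf_basis_poly)

lemma nf_mult_y: "g \<in> nf \<Longrightarrow> (\<lambda>u. u (coord_y i) * g u) \<in> nf"
proof (rule nf_mult_if)
  fix t c assume t: "t \<in> cone"
  let ?e = "\<lambda>t j. ydeg t j + int (k j) * (zdeg t div int d)"
  have "nat (?e (t + yexp i) j) = nat (?e t j) + (if j = i then 1 else 0)" for j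
    using t by (auto simp: cone_def nat_add_distrib algebra_simps)
  then have "mpoly_eval (basis_poly (t + yexp i)) u = u (coord_y i) * mpoly_eval (basis_poly t) u" for u
    by (simp add: basis_poly_def power_add prod.distrib if_distrib[of "\<lambda>n. _ ^ n"] cong: if_cong)
  moreover have "t + yexp i \<in> cone"
    using t by (auto simp: cone_def add_increasing2 algebra_simps)
  ultimately show "(\<lambda>u. c * (u (coord_y i) * mpoly_eval (basis_poly t) u)) \<in> nf"
    using nf_basis_poly[of "t + yexp i" c] by simp
qed

lemma nf_mult_ypoly: "g \<in> nf \<Longrightarrow> (\<lambda>u. mpoly_eval p (\<lambda>i. u (coord_y i)) * g u) \<in> nf"
  by (induction p arbitrary: g rule: mpoly_induct)
     (simp_all add: nf_const nf_mult_y distrib_right nf_add mult.assoc)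

lemma nf_mult_x: "g \<in> nf \<Longrightarrow> (\<lambda>u. u coord_x * g u) \<in> nf"
proof (rule nf_mult_if)
  fix t c assume t: "t \<in> cone"
  have "(zdeg t + int d) div int d = zdeg t div int d + 1" "zdeg t div int d \<ge> 0"
    using t d2 by (auto simp: cone_def pos_imp_zdiv_nonneg_iff)
  then have "mpoly_eval (basis_poly (t + xexp)) u = u coord_x * mpoly_eval (basis_poly t) u" and "t + xexp \<in> cone" for u
    using t by (simp_all add: basis_poly_def nat_add_distrib cone_def algebra_simps)
  then show "(\<lambda>u. c * (u coord_x * mpoly_eval (basis_poly t) u)) \<in> nf"
    using nf_basis_poly[of "t + xexp" c] by simp
qed

text \<open>Multiplication by \<open>z\<close> is the only case that leaves the basis: when the exponent of \<open>z\<close> reaches \<open>d\<close>, the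
equation of the variety replaces \<open>z^d\<close> by \<open>x M\<close> and terms of lower degree in \<open>z\<close>.\<close>

lemma nf_mult_z: "g \<in> nf \<Longrightarrow> (\<lambda>u. u coord_z * g u) \<in> nf"
proof (rule nf_mult_if)
  fix t c assume t: "t \<in> cone"
  define p r where "p = zdeg t div int d" and "r = zdeg t mod int d"
  define e where "e = (\<lambda>i. nat (ydeg t i + int (k i) * p))"
  have zt: "zdeg t = p * int d + r"
    by (simp add: p_def r_def)
  have p0: "p \<ge> 0" and r: "0 \<le> r" "r < int d" and e0: "ydeg t i + int (k i) * p \<ge> 0" for i
    using t d2 by (auto simp: cone_def p_def r_def pos_imp_zdiv_nonneg_iff)
  have bas_t: "mpoly_eval (basis_poly t) u = u coord_x ^ nat p * u coord_z ^ nat r * (\<Prod>i\<in>UNIV. u (coord_y i) ^ e i)" for u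
    by (simp add: basis_poly_def p_def r_def e_def)
  show "(\<lambda>u. c * (u coord_z * mpoly_eval (basis_poly t) u)) \<in> nf"
  proof (cases "r + 1 < int d")
    case True
    have "(zdeg t + 1) div int d = p" "(zdeg t + 1) mod int d = r + 1"
      using True r unfolding zt by (simp_all add: add.assoc)
    then have "mpoly_eval (basis_poly (t + zexp)) u = u coord_z * mpoly_eval (basis_poly t) u" "t + zexp \<in> cone" for u
      using t r p0 e0 by (simp_all add: basis_poly_def nat_add_distrib cone_def flip: p_def r_def)
    then show ?thesis
      using nf_basis_poly[of "t + zexp" c] by simp
  next
    case False
    then have rd: "r = int d - 1"
      using r by simp
    have zt': "zdeg t + 1 = (p + 1) * int d"
      by (simp add: zt rd algebra_simps)
    then have "(zdeg t + 1) div int d = p + 1" "(zdeg t + 1) mod int d = 0"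
      using d2 by simp_all
    moreover have "nat (ydeg t i + int (k i) * (p + 1)) = e i + k i" for i
      using e0[of i] by (simp add: e_def nat_add_distrib algebra_simps)
    ultimately have up: "t + zexp \<in> cone"
      "mpoly_eval (basis_poly (t + zexp)) u =
         u coord_x ^ nat p * (\<Prod>i\<in>UNIV. u (coord_y i) ^ e i) * (u coord_x * (\<Prod>i\<in>UNIV. u (coord_y i) ^ k i))" for u
      using e0 p0 zt' by (auto simp: cone_def basis_poly_def nat_add_distrib power_add prod.distrib algebra_simps add_increasing)
    \<comment> \<open>The exponent \<open>t\<close> with the power \<open>z^(d - 1)\<close> replaced by \<open>z^j\<close>.\<close>
    define t' where "t' j = Expo (p * int d + int j) (ydeg t)" for j
    have t': "t' j \<in> cone"
      "mpoly_eval (basis_poly (t' j)) u = u coord_x ^ nat p * u coord_z ^ j * (\<Prod>i\<in>UNIV. u (coord_y i) ^ e i)"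
      if "j < d" for j u
      using that p0 e0 by (auto simp: t'_def cone_def basis_poly_def e_def)
    have "(\<lambda>u. c * mpoly_eval (basis_poly (t + zexp)) u +
        (\<Sum>j<d. mpoly_eval (q j) (\<lambda>i. u (coord_y i)) * (- c * mpoly_eval (basis_poly (t' j)) u))) \<in> nf"
      using up t' by (intro nf_add nf_sum nf_mult_ypoly nf_basis_poly) auto
    moreover have "c * mpoly_eval (basis_poly (t + zexp)) u +
        (\<Sum>j<d. mpoly_eval (q j) (\<lambda>i. u (coord_y i)) * (- c * mpoly_eval (basis_poly (t' j)) u)) =
        c * (u coord_z * mpoly_eval (basis_poly t) u)" if "u \<in> V" for u
    proof -
      define K where "K = c * u coord_x ^ nat p * (\<Prod>i\<in>UNIV. u (coord_y i) ^ e i)"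
      have xy: "u coord_x * (\<Prod>i\<in>UNIV. u (coord_y i) ^ k i) =
          u coord_z ^ d + (\<Sum>j<d. mpoly_eval (q j) (\<lambda>i. u (coord_y i)) * u coord_z ^ j)"
        using that by (simp add: danielewski_variety_def)
      have "(\<Sum>j<d. mpoly_eval (q j) (\<lambda>i. u (coord_y i)) * (- c * mpoly_eval (basis_poly (t' j)) u)) =
          - K * (\<Sum>j<d. mpoly_eval (q j) (\<lambda>i. u (coord_y i)) * u coord_z ^ j)"
        unfolding sum_distrib_left by (rule sum.cong) (simp_all add: t'(2) K_def)
      moreover have "c * mpoly_eval (basis_poly (t + zexp)) u = K * (u coord_x * (\<Prod>i\<in>UNIV. u (coord_y i) ^ k i))"
        by (simp add: up K_def)
      moreover have "c * (u coord_z * mpoly_eval (basis_poly t) u) = K * (u coord_z * u coord_z ^ nat r)"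
        by (simp add: bas_t K_def)
      moreover have "u coord_z * u coord_z ^ nat r = u coord_z ^ d"
        unfolding power_Suc[symmetric] using d2 by (simp add: rd nat_diff_distrib)
      ultimately show ?thesis
        unfolding xy by (simp add: algebra_simps)
    qed
    ultimately show ?thesis
      by (rule nf_cong)
  qed
qed

lemma nf_mult_mpoly: "g \<in> nf \<Longrightarrow> (\<lambda>u. mpoly_eval p u * g u) \<in> nf"
proof (induction p arbitrary: g rule: mpoly_induct)
  case (var v)
  then show ?case
    by (cases v) (simp_all add: nf_mult_x nf_mult_y nf_mult_z)
qed (simp_all add: nf_const distrib_right nf_add mult.assoc)

lemma nf_mpoly: "mpoly_eval p \<in> nf"
proof -
  have "(\<lambda>u. mpoly_eval p u * (1 * mpoly_eval (basis_poly 0) u)) \<in> nf"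
    by (intro nf_mult_mpoly nf_basis_poly) (simp add: cone_def)
  then show ?thesis
    by (simp add: basis_poly_def)
qed

definition basis_elt :: "'n expo \<Rightarrow> ('n, 'a) laurent" where
  "basis_elt t = Phi (basis_poly t)"

lemma basis_elt_in_A [simp]: "basis_elt t \<in> A"
  by (simp add: basis_elt_def A_def)

lemma basis_elt_eq:
  "basis_elt t = X ^ nat (zdeg t div int d) * Z ^ nat (zdeg t mod int d) *
     (\<Prod>i\<in>UNIV. Y i ^ nat (ydeg t i + int (k i) * (zdeg t div int d)))"
  by (simp add: basis_elt_def basis_poly_def)

lemma mpoly_normal_form:
  obtains c where "Poly_Mapping.keys c \<subseteq> cone"
    "\<And>u. u \<in> V \<Longrightarrow> mpoly_eval p u = (\<Sum>t\<in>Poly_Mapping.keys c. Poly_Mapping.lookup c t * mpoly_eval (basis_poly t) u)"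
    "Phi p = (\<Sum>t\<in>Poly_Mapping.keys c. const (Poly_Mapping.lookup c t) * basis_elt t)"
proof -
  obtain c where c: "Poly_Mapping.keys c \<subseteq> cone"
    "\<And>u. u \<in> V \<Longrightarrow> mpoly_eval p u = (\<Sum>t\<in>Poly_Mapping.keys c. Poly_Mapping.lookup c t * mpoly_eval (basis_poly t) u)"
    using nf_mpoly[of p] by (auto simp: nf_def)
  have "Phi p = Phi (\<Sum>t\<in>Poly_Mapping.keys c. const (Poly_Mapping.lookup c t) * basis_poly t)"
    by (rule Phi_eqI) (simp add: c)
  then show ?thesis
    using c that by (simp add: basis_elt_def)
qed

lemma const_zlow: "const c \<in> zlow 1"
  by (simp add: const_def zlow_single)

lemma ypoly_zlow: "mpoly_subst Y p \<in> zlow 1"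
proof (induction p rule: mpoly_induct)
  case (mult p p')
  then show ?case
    using zlow_mult[of _ 1 _ 0] by simp
qed (simp_all add: const_zlow Y_def zlow_single zlow_add)

lemma zlead_P: "zlead P (Expo (int d) (\<lambda>_. 0)) 1"
proof -
  have "Expo (int d) (\<lambda>_. 0) = nmult d zexp"
    by (rule expo_eqI) simp_all
  moreover have "mpoly_subst Y (q j) * Z ^ j \<in> zlow (int d)" if "j < d" for j
    using zlow_mult[OF ypoly_zlow, of "Z ^ j" "int j" "q j"] that
    by (auto simp: Z_power zlow_single intro: zlow_mono)
  ultimately show ?thesis
    unfolding P_def by (intro zlead_add_zlow zlow_sum) (simp_all add: Z_power)
qed

lemma zlead_X: "zlead X xexp 1"
proof -
  have "xexp = - mexp + Expo (int d) (\<lambda>_. 0)"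
    by (rule expo_eqI) simp_all
  then show ?thesis
    using zlead_mult[OF zlead_single zlead_P, of "- mexp" 1] by (simp add: X_def)
qed

lemma zlead_basis_elt:
  assumes "t \<in> cone"
  shows "zlead (basis_elt t) t 1"
proof -
  define p where "p = zdeg t div int d"
  define r where "r = zdeg t mod int d"
  have p0: "p \<ge> 0" and r0: "r \<ge> 0" and e0: "ydeg t i + int (k i) * p \<ge> 0" for i
    using assms d2 by (auto simp: cone_def p_def r_def pos_imp_zdiv_nonneg_iff)
  have zt: "zdeg t = p * int d + r"
    by (simp add: p_def r_def)
  have "nmult (nat p) xexp + nmult (nat r) zexp +
      Expo 0 (\<lambda>i. int (nat (ydeg t i + int (k i) * p))) = t"
    using p0 r0 e0 zt by (intro expo_eqI) simp_all
  moreover have "zlead (basis_elt t) (nmult (nat p) xexp + nmult (nat r) zexp +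
      Expo 0 (\<lambda>i. int (nat (ydeg t i + int (k i) * p)))) (1 ^ nat p * 1 * 1)"
    unfolding basis_elt_eq p_def[symmetric] r_def[symmetric] prod_Y_power Z_power
    by (intro zlead_mult zlead_power zlead_X zlead_single)
  ultimately show ?thesis
    by simp
qed

lemma basis_elt_low:
  assumes "t \<in> cone" "zdeg t < int d"
  shows "basis_elt t = Poly_Mapping.single t 1"
proof -
  have "zdeg t \<ge> 0" "zdeg t div int d = 0" "\<And>i. ydeg t i \<ge> 0"
    using assms by (auto simp: cone_def)
  moreover from this have "nmult (nat (zdeg t)) zexp + Expo 0 (\<lambda>i. int (nat (ydeg t i))) = t"
    by (intro expo_eqI) simp_all
  ultimately show ?thesis
    using assms by (simp add: basis_elt_eq prod_Y_power Z_power mult_single)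
qed

text \<open>Distinct basis elements have distinct leading exponents, so no cancellation occurs at the top and the
leading exponent and coefficient of a combination are those of its coefficient family.\<close>

lemma lookup_normal_form:
  assumes "Poly_Mapping.keys c \<subseteq> cone" "bounded_by c t"
  shows "bounded_by (\<Sum>t\<in>Poly_Mapping.keys c. const (Poly_Mapping.lookup c t) * basis_elt t) t"
    "Poly_Mapping.lookup (\<Sum>t\<in>Poly_Mapping.keys c. const (Poly_Mapping.lookup c t) * basis_elt t) t = Poly_Mapping.lookup c t"
proof -
  have b: "bounded_by (basis_elt u) u" "Poly_Mapping.lookup (basis_elt u) u = 1" if "u \<in> Poly_Mapping.keys c" for u
    using zlead_bounded_by[OF zlead_basis_elt, of u] that assms by auto
  have z: "Poly_Mapping.lookup (basis_elt u) v = 0" if "u \<in> Poly_Mapping.keys c" "u < v" for u v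
    using bounded_by_lookup b that by blast
  show "bounded_by (\<Sum>t\<in>Poly_Mapping.keys c. const (Poly_Mapping.lookup c t) * basis_elt t) t"
  proof
    fix v assume v: "v \<in> Poly_Mapping.keys (\<Sum>t\<in>Poly_Mapping.keys c. const (Poly_Mapping.lookup c t) * basis_elt t)"
    show "v \<in> {..t}"
    proof (rule ccontr)
      assume "v \<notin> {..t}"
      then have "Poly_Mapping.lookup (basis_elt u) v = 0" if "u \<in> Poly_Mapping.keys c" for u
        using z[of u v] that assms(2) by fastforce
      then show False
        using v by (simp add: in_keys_iff lookup_sum)
    qed
  qed
  have "Poly_Mapping.lookup (\<Sum>t\<in>Poly_Mapping.keys c. const (Poly_Mapping.lookup c t) * basis_elt t) t =
      (\<Sum>u\<in>Poly_Mapping.keys c. if u = t then Poly_Mapping.lookup c t else 0)"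
    unfolding lookup_sum
  proof (rule sum.cong)
    fix u assume u: "u \<in> Poly_Mapping.keys c"
    then have "u = t \<or> u < t"
      using assms(2) by force
    then show "Poly_Mapping.lookup (const (Poly_Mapping.lookup c u) * basis_elt u) t =
        (if u = t then Poly_Mapping.lookup c t else 0)"
      using b[OF u] z[OF u] by auto
  qed simp
  then show "Poly_Mapping.lookup (\<Sum>t\<in>Poly_Mapping.keys c. const (Poly_Mapping.lookup c t) * basis_elt t) t = Poly_Mapping.lookup c t"
    by (simp add: in_keys_iff)
qed

lemma A_normal_form:
  assumes "a \<in> A"
  obtains c where "Poly_Mapping.keys c \<subseteq> cone"
    "a = (\<Sum>t\<in>Poly_Mapping.keys c. const (Poly_Mapping.lookup c t) * basis_elt t)"
    "\<And>t. bounded_by c t \<longleftrightarrow> bounded_by a t"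
proof -
  obtain p where "a = Phi p"
    using assms by (auto simp: A_def)
  then obtain c where c: "Poly_Mapping.keys c \<subseteq> cone"
    "a = (\<Sum>t\<in>Poly_Mapping.keys c. const (Poly_Mapping.lookup c t) * basis_elt t)"
    using mpoly_normal_form[of p] by metis
  have "bounded_by c t" if "bounded_by a t" for t
  proof (cases "c = 0")
    case False
    have "Poly_Mapping.lookup a (lm c) \<noteq> 0"
      using lookup_normal_form[OF c(1) bounded_by_lm] lookup_lm[OF False] c(2) by simp
    then have "lm c \<le> t"
      using that by (meson atMost_iff in_keys_iff subsetD)
    then show ?thesis
      using lm_le_iff[OF False] by simp
  qed simp
  then show ?thesis
    using c lookup_normal_form(1)[OF c(1)] that[of c] by metis
qed

lemma lm_in_cone:
  assumes "a \<in> A" "bounded_by a t" "Poly_Mapping.lookup a t \<noteq> 0"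
  shows "t \<in> cone"
proof -
  obtain c where c: "Poly_Mapping.keys c \<subseteq> cone"
    "a = (\<Sum>t\<in>Poly_Mapping.keys c. const (Poly_Mapping.lookup c t) * basis_elt t)" "bounded_by c t"
    using A_normal_form[OF assms(1)] assms(2) by metis
  then have "Poly_Mapping.lookup c t \<noteq> 0"
    using lookup_normal_form(2)[OF c(1,3)] assms(3) by simp
  then show ?thesis
    using c(1) by (auto simp: in_keys_iff)
qed

text \<open>The normal form of \<open>p - p'\<close> has to be zero already as a family of coefficients, and the normal form
describes \<open>p - p'\<close> at every point, including those with \<open>M = 0\<close>. Thus the open
set \<open>M \<noteq> 0\<close> is dense in the variety.\<close>

lemma Phi_eqD:
  assumes "Phi p = Phi p'" "u \<in> V"
  shows "mpoly_eval p u = mpoly_eval p' u"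
proof -
  obtain c where c: "Poly_Mapping.keys c \<subseteq> cone"
    "\<And>u. u \<in> V \<Longrightarrow> mpoly_eval (p - p') u = (\<Sum>t\<in>Poly_Mapping.keys c. Poly_Mapping.lookup c t * mpoly_eval (basis_poly t) u)"
    "Phi (p - p') = (\<Sum>t\<in>Poly_Mapping.keys c. const (Poly_Mapping.lookup c t) * basis_elt t)"
    using mpoly_normal_form by blast
  have "c = 0"
    using lookup_normal_form(2)[OF c(1) bounded_by_lm] lookup_lm[of c] c(3) assms(1) by auto
  then show ?thesis
    using c(2)[OF assms(2)] by simp
qed

text \<open>Below \<open>z\<close>-degree \<open>d\<close> the normal form does not involve \<open>x\<close>, and an element is a polynomial in the \<open>y\<^sub>i\<close>
and \<open>z\<close>.\<close>

lemma A_low_keys: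
  assumes "a \<in> A" "a \<in> zlow (int d)"
  shows "Poly_Mapping.keys a \<subseteq> cone"
proof (cases "a = 0")
  case False
  obtain c where c: "Poly_Mapping.keys c \<subseteq> cone"
    "a = (\<Sum>t\<in>Poly_Mapping.keys c. const (Poly_Mapping.lookup c t) * basis_elt t)"
    "\<And>t. bounded_by c t \<longleftrightarrow> bounded_by a t"
    using A_normal_form[OF assms(1)] by blast
  have "zdeg (lm a) < int d"
    using assms(2) lookup_lm[OF False] by (auto simp: zlow_def in_keys_iff)
  then have "zdeg t < int d" if "t \<in> Poly_Mapping.keys c" for t
    using c(3)[of "lm a"] that bounded_by_lm[of a] zdeg_mono[of t "lm a"] by force
  then have "a = (\<Sum>t\<in>Poly_Mapping.keys c. const (Poly_Mapping.lookup c t) * Poly_Mapping.single t 1)"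
    using c(1,2) basis_elt_low by (auto intro!: sum.cong)
  also have "\<dots> = c"
    by (subst (3) poly_mapping_sum_singles) (simp add: const_def mult_single)
  finally show ?thesis
    using c(1) by simp
qed simp

end

section \<open>Locally nilpotent derivations\<close>

context danielewski
begin

text \<open>Here \<open>a i\<close>, \<open>b\<close>, \<open>c\<close> are the weights of
\<open>y\<^sub>i\<close>, \<open>x\<close>, \<open>z\<close> in the grading dual to a homogeneous derivation of degree \<open>e\<close>, normalized such that \<open>e\<close> has
weight \<open>-1\<close>. If \<open>a i > 0\<close>, then adding the exponent of \<open>y\<^sub>i\<close> moves \<open>e\<close> into \<open>cone\<close>, so \<open>e\<close> misses the cone by
exactly one in the direction \<open>i\<close> and by nothing in the other directions. Adding the exponent of \<open>z\<close> also
moves \<open>e\<close> into \<open>cone\<close>, which is possible only if it increases the quotient of the \<open>z\<close>-degree by \<open>d\<close>. With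
\<open>d \<ge> 2\<close> and \<open>k i \<ge> 2\<close> the weight of an exponent of this form is at least 0.\<close>

lemma cone_degree_vanishes:
  fixes a :: "'n \<Rightarrow> int" and b c :: int and e :: "'n expo"
  assumes deg: "zdeg e * c + (\<Sum>i\<in>UNIV. ydeg e i * a i) = - 1"
    and rel: "b + (\<Sum>i\<in>UNIV. int (k i) * a i) = int d * c"
    and nonneg: "b \<ge> 0" "c \<ge> 0" "\<And>i. a i \<ge> 0"
    and z: "c \<noteq> 0 \<Longrightarrow> zexp + e \<in> cone"
    and y: "\<And>i. a i \<noteq> 0 \<Longrightarrow> yexp i + e \<in> cone"
    and e: "e \<notin> cone"
  shows "a i = 0"
proof (rule ccontr)
  assume ai: "a i \<noteq> 0"
  define p where "p = zdeg e div int d"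
  have w0: "zdeg e \<ge> 0" and ui: "ydeg e i + 1 + int (k i) * p \<ge> 0"
    and uj: "\<And>j. j \<noteq> i \<Longrightarrow> ydeg e j + int (k j) * p \<ge> 0"
    using y[OF ai] by (auto simp: cone_def p_def split: if_splits)
  have "\<not> ydeg e i + int (k i) * p \<ge> 0"
  proof
    assume "ydeg e i + int (k i) * p \<ge> 0"
    then have "\<forall>j. ydeg e j + int (k j) * p \<ge> 0"
      using uj by metis
    then have "e \<in> cone"
      using w0 by (simp add: cone_def flip: p_def)
    then show False
      using e by simp
  qed
  then have u: "ydeg e i = - 1 - int (k i) * p"
    using ui by simp
  \<comment> \<open>A second index \<open>j\<close> with positive weight would put \<open>e\<close> on the right side of the wall of \<open>y\<^sub>i\<close>.\<close>
  have a0: "a j = 0" if "j \<noteq> i" for j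
  proof (rule ccontr)
    assume "a j \<noteq> 0"
    from y[OF this] have "ydeg e i + int (k i) * p \<ge> 0"
      using that by (auto simp: cone_def p_def dest!: spec[of _ i])
    then show False
      using u by simp
  qed
  have "(\<Sum>j\<in>UNIV. f j * a j) = f i * a i" for f
    using a0 by (subst sum.remove[of _ i]) auto
  then have deg': "zdeg e * c + ydeg e i * a i = - 1" and rel': "b + int (k i) * a i = int d * c"
    using deg rel by simp_all
  have ki: "int (k i) * a i \<ge> 2 * a i"
    using k2[of i] nonneg(3)[of i] by (intro mult_right_mono) auto
  have "c \<noteq> 0"
  proof
    assume "c = 0"
    then have "b + int (k i) * a i = 0"
      using rel' by simp
    then show False
      using ki nonneg(1) nonneg(3)[of i] ai by linarith
  qed
  from z[OF this] have "ydeg e i + int (k i) * ((1 + zdeg e) div int d) \<ge> 0"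
    by (auto simp: cone_def)
  then have "(1 + zdeg e) div int d \<noteq> p"
    using u by auto
  moreover have r: "zdeg e = p * int d + zdeg e mod int d" "0 \<le> zdeg e mod int d" "zdeg e mod int d < int d"
    using d2 by (auto simp: p_def)
  moreover have "(1 + zdeg e) div int d = p" if "zdeg e mod int d + 1 < int d"
  proof -
    have "1 + zdeg e = (zdeg e mod int d + 1) + p * int d"
      using r(1) by simp
    then show ?thesis
      using that r(2) d2 by (simp only: div_mult_self1) simp
  qed
  ultimately have "zdeg e mod int d = int d - 1"
    by linarith
  then have w: "zdeg e = p * int d + int d - 1"
    using r(1) by simp
  have "p * b + (int d - 1) * c - a i = - 1"
  proof -
    have "p * b = p * (int d * c - int (k i) * a i)"
      using rel' by (metis add_diff_cancel_right')
    then show ?thesis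
      using deg' unfolding w u by (simp add: algebra_simps)
  qed
  moreover have "p \<ge> 0"
    using w0 d2 by (simp add: p_def pos_imp_zdiv_nonneg_iff)
  then have "p * b \<ge> 0"
    using nonneg by simp
  ultimately have "(int d - 1) * c < a i"
    by simp
  moreover have "2 * (int d - 1) * c \<ge> int d * c"
    using d2 nonneg by (intro mult_right_mono) auto
  ultimately show False
    using rel' ki nonneg(1) by (simp only: algebra_simps)
qed

primrec gexp :: "'n coord \<Rightarrow> 'n expo" where
  "gexp coord_x = xexp" | "gexp (coord_y i) = yexp i" | "gexp coord_z = zexp"

lemma gen_lead: "zlead (gen v) (gexp v) 1"
  by (cases v) (simp_all add: zlead_X Y_def Z_def)

lemmas gen_bounded = zlead_bounded_by[OF gen_lead]

lemma gexp_in_cone [simp]: "gexp v \<in> cone"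
  using d2 by (cases v) (auto simp: cone_def)

lemma finite_UNIV_coord: "finite (UNIV :: 'n coord set)"
proof -
  have "(UNIV :: 'n coord set) \<subseteq> {coord_x, coord_z} \<union> range coord_y"
    by (metis UnI1 UnI2 coord.exhaust insertCI rangeI subsetI)
  then show ?thesis
    by (rule finite_subset) simp
qed

end

locale lnd = danielewski k d q
  for k :: "'n::finite \<Rightarrow> nat" and d :: nat and q :: "nat \<Rightarrow> ('n, 'a::field_char_0) mpoly" +
  fixes D :: "('n, 'a) laurent \<Rightarrow> ('n, 'a) laurent"
  assumes D_closed [simp]: "a \<in> A \<Longrightarrow> D a \<in> A"
    and D_add: "a \<in> A \<Longrightarrow> b \<in> A \<Longrightarrow> D (a + b) = D a + D b"
    and D_mult: "a \<in> A \<Longrightarrow> b \<in> A \<Longrightarrow> D (a * b) = a * D b + b * D a"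
    and D_const [simp]: "D (const c) = 0"
    and D_nilpotent: "a \<in> A \<Longrightarrow> \<exists>n. (D ^^ n) a = 0"
    and D_nonzero: "\<exists>a\<in>A. D a \<noteq> 0"
begin

lemma D_scale: "a \<in> A \<Longrightarrow> D (const c * a) = const c * D a"
  by (simp add: D_mult)

lemma D_zero [simp]: "D 0 = 0"
  using D_const[of 0] by simp

lemma D_one [simp]: "D 1 = 0"
  using D_const[of 1] by simp

lemma D_sum: "(\<And>i. i \<in> I \<Longrightarrow> f i \<in> A) \<Longrightarrow> D (\<Sum>i\<in>I. f i) = (\<Sum>i\<in>I. D (f i))"
  by (induction I rule: infinite_finite_induct) (simp_all add: D_add A_sum)

lemma D_gen_nonzero: "\<exists>v. D (gen v) \<noteq> 0"
proof (rule ccontr)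
  assume *: "\<nexists>v. D (gen v) \<noteq> 0"
  have "D a = 0" if "a \<in> A" for a
    using that by (induction rule: A_induct) (use * in \<open>simp_all add: D_add D_mult\<close>)
  then show False
    using D_nonzero by blast
qed

text \<open>The degree of \<open>D\<close>: the largest shift of leading exponents on the generators, attained by at least one of
them.\<close>

definition is_degree :: "'n expo \<Rightarrow> bool" where
  "is_degree e \<longleftrightarrow> (\<forall>v. bounded_by (D (gen v)) (gexp v + e)) \<and>
     (\<exists>v. Poly_Mapping.lookup (D (gen v)) (gexp v + e) \<noteq> 0)"

lemma degree_exists: "\<exists>e. is_degree e"
proof -
  define G where "G = {v. D (gen v) \<noteq> 0}"
  define e where "e = Max ((\<lambda>v. lm (D (gen v)) - gexp v) ` G)"
  have G: "finite G" "G \<noteq> {}"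
    using D_gen_nonzero finite_subset[OF subset_UNIV finite_UNIV_coord] by (auto simp: G_def)
  have "bounded_by (D (gen v)) (gexp v + e)" for v
  proof (cases "v \<in> G")
    case True
    then have "lm (D (gen v)) - gexp v \<le> e"
      using G by (simp add: e_def)
    then have "lm (D (gen v)) \<le> gexp v + e"
      by (simp add: algebra_simps)
    then show ?thesis
      using True lm_le_iff[of "D (gen v)"] by (simp add: G_def)
  qed (simp add: G_def)
  moreover have "e \<in> (\<lambda>v. lm (D (gen v)) - gexp v) ` G"
    unfolding e_def using G by (intro Max_in) auto
  then obtain v where "v \<in> G" "lm (D (gen v)) = gexp v + e"
    by auto
  then have "Poly_Mapping.lookup (D (gen v)) (gexp v + e) \<noteq> 0"
    using lookup_lm[of "D (gen v)"] by (simp add: G_def)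
  ultimately show ?thesis
    unfolding is_degree_def by blast
qed

definition e :: "'n expo" where "e = (SOME e. is_degree e)"

lemma e_degree: "is_degree e"
  unfolding e_def using degree_exists by (rule someI_ex)

text \<open>Bookkeeping for products: \<open>a\<close> has leading term \<open>X^t\<close>, and \<open>l\<close> is the coefficient of \<open>D a\<close> at \<open>t + e\<close>,
which may be zero. The Leibniz rule adds both the exponents and the coefficients \<open>l\<close>.\<close>

definition graded :: "('n, 'a) laurent \<Rightarrow> 'n expo \<Rightarrow> 'a \<Rightarrow> bool" where
  "graded a t l \<longleftrightarrow> a \<in> A \<and> bounded_by a t \<and> Poly_Mapping.lookup a t = 1 \<and>
     bounded_by (D a) (t + e) \<and> Poly_Mapping.lookup (D a) (t + e) = l"

lemma graded_mult:
  assumes "graded a t l" "graded b u m"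
  shows "graded (a * b) (t + u) (l + m)"
proof -
  have "bounded_by (a * D b) (t + (u + e))" "bounded_by (b * D a) (u + (t + e))"
    "bounded_by (a * b) (t + u)"
    using assms unfolding graded_def by (intro bounded_by_mult; simp)+
  moreover have "Poly_Mapping.lookup (a * D b) (t + (u + e)) = m"
    "Poly_Mapping.lookup (b * D a) (u + (t + e)) = l" "Poly_Mapping.lookup (a * b) (t + u) = 1"
    using assms by (auto simp: graded_def lookup_top_mult)
  moreover have "t + (u + e) = t + u + e" "u + (t + e) = t + u + e"
    by (simp_all add: algebra_simps)
  ultimately show ?thesis
    using assms bounded_by_add[of "a * D b" "t + u + e" "b * D a"] unfolding graded_def by (simp add: D_mult lookup_add)
qed

lemma graded_one: "graded 1 0 0"
  by (simp add: graded_def)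

lemma graded_power: "graded a t l \<Longrightarrow> graded (a ^ n) (nmult n t) (of_nat n * l)"
proof (induction n)
  case (Suc n)
  then show ?case
    using graded_mult[of a t l "a ^ n"] by (simp add: distrib_right)
qed (simp add: graded_one)

lemma graded_prod:
  assumes "finite I" "\<And>i. i \<in> I \<Longrightarrow> graded (a i) (t i) (l i)"
  shows "graded (\<Prod>i\<in>I. a i) (\<Sum>i\<in>I. t i) (\<Sum>i\<in>I. l i)"
  using assms by (induction I rule: finite_induct) (simp_all add: graded_one graded_mult)

definition weight :: "'n coord \<Rightarrow> 'a" where
  "weight v = Poly_Mapping.lookup (D (gen v)) (gexp v + e)"

lemma graded_gen: "graded (gen v) (gexp v) (weight v)"
  using e_degree by (simp add: graded_def weight_def is_degree_def gen_bounded)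

lemmas graded_gens = graded_gen[of coord_x, simplified] graded_gen[of "coord_y _", simplified]
  graded_gen[of coord_z, simplified]

definition top_factor :: "'n expo \<Rightarrow> 'a" where
  "top_factor t = Poly_Mapping.lookup (D (basis_elt t)) (t + e)"

text \<open>The additive map on all exponents that extends the weights of the \<open>y\<^sub>i\<close> and of \<open>z\<close>. On \<open>cone\<close> it
agrees with the coefficient by which \<open>D\<close> multiplies leading terms; its value at the degree \<open>e\<close>, which
lies outside \<open>cone\<close>, is needed as well.\<close>

definition L :: "'n expo \<Rightarrow> 'a" where
  "L t = of_int (zdeg t) * weight coord_z + (\<Sum>i\<in>UNIV. of_int (ydeg t i) * weight (coord_y i))"

lemma L_add: "L (t + u) = L t + L u"
  by (simp add: L_def distrib_right sum.distrib)

lemma L_nmult: "L (nmult n t) = of_nat n * L t"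
  by (induction n) (simp_all add: L_add distrib_right, simp add: L_def)

lemma graded_monomial:
  "graded (X ^ p * Z ^ r * (\<Prod>i\<in>UNIV. Y i ^ n i))
     (nmult p xexp + nmult r zexp + (\<Sum>i\<in>UNIV. nmult (n i) (yexp i)))
     (of_nat p * weight coord_x + of_nat r * weight coord_z + (\<Sum>i\<in>UNIV. of_nat (n i) * weight (coord_y i)))"
  by (intro graded_mult graded_power graded_prod graded_gens) simp

lemma sum_nmult_yexp: "(\<Sum>i\<in>UNIV. nmult (n i) (yexp i)) = Expo 0 (\<lambda>i. int (n i))"
  by (rule expo_eqI) (simp_all add: if_distrib cong: if_cong)

lemma graded_basis_elt:
  assumes "t \<in> cone"
  shows "graded (basis_elt t) t (of_int (zdeg t div int d) * weight coord_x + of_int (zdeg t mod int d) * weight coord_z +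
    (\<Sum>i\<in>UNIV. of_int (ydeg t i + int (k i) * (zdeg t div int d)) * weight (coord_y i)))"
proof -
  define p where "p = zdeg t div int d"
  define r where "r = zdeg t mod int d"
  have p0: "p \<ge> 0" and r0: "r \<ge> 0" and e0: "ydeg t i + int (k i) * p \<ge> 0" for i
    using assms d2 by (auto simp: cone_def p_def r_def pos_imp_zdiv_nonneg_iff)
  have zt: "zdeg t = p * int d + r"
    by (simp add: p_def r_def)
  define n where "n i = nat (ydeg t i + int (k i) * p)" for i
  have n: "ydeg t i + int (k i) * p = int (n i)" for i
    using e0 by (simp add: n_def)
  have "nmult (nat p) xexp + nmult (nat r) zexp + (\<Sum>i\<in>UNIV. nmult (n i) (yexp i)) = t"
    unfolding sum_nmult_yexp using p0 r0 e0 zt by (intro expo_eqI) (simp_all add: n_def)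
  then show ?thesis
    using graded_monomial[of "nat p" "nat r" n] p0 r0
    unfolding basis_elt_eq p_def[symmetric] r_def[symmetric] n by simp
qed

text \<open>Through the normal form, the behaviour of \<open>D\<close> on leading terms follows from its behaviour on the basis
elements.\<close>

lemma D_top:
  assumes "a \<in> A" "bounded_by a t"
  shows D_bounded: "bounded_by (D a) (t + e)"
    and D_lookup: "Poly_Mapping.lookup (D a) (t + e) = Poly_Mapping.lookup a t * top_factor t"
proof -
  obtain c where c: "Poly_Mapping.keys c \<subseteq> cone" "bounded_by c t"
    and a: "a = (\<Sum>t\<in>Poly_Mapping.keys c. const (Poly_Mapping.lookup c t) * basis_elt t)"
    using A_normal_form[OF assms(1)] assms(2) by metis
  have ct: "Poly_Mapping.lookup c t = Poly_Mapping.lookup a t"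
    using lookup_normal_form(2)[OF c] a by simp
  have Da: "D a = (\<Sum>t\<in>Poly_Mapping.keys c. const (Poly_Mapping.lookup c t) * D (basis_elt t))"
    unfolding a by (simp add: D_sum D_scale)
  have b: "bounded_by (D (basis_elt u)) (u + e)" if "u \<in> Poly_Mapping.keys c" for u
    using graded_basis_elt[of u] that c(1) by (auto simp: graded_def)
  have z: "Poly_Mapping.lookup (D (basis_elt u)) v = 0" if "u \<in> Poly_Mapping.keys c" "u + e < v" for u v
    using bounded_by_lookup[OF b] that by blast
  have ut: "u \<le> t" if "u \<in> Poly_Mapping.keys c" for u
    using c(2) that by auto
  show "bounded_by (D a) (t + e)"
  proof
    fix v assume v: "v \<in> Poly_Mapping.keys (D a)"
    show "v \<in> {..t + e}"
    proof (rule ccontr)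
      assume "v \<notin> {..t + e}"
      then have "Poly_Mapping.lookup (D (basis_elt u)) v = 0" if "u \<in> Poly_Mapping.keys c" for u
        using z[of u v] that le_less_trans[OF add_right_mono[OF ut[OF that], of e], of v] by simp
      then show False
        using v by (simp add: in_keys_iff lookup_sum Da)
    qed
  qed
  have "Poly_Mapping.lookup (D a) (t + e) =
      (\<Sum>u\<in>Poly_Mapping.keys c. if u = t then Poly_Mapping.lookup c t * top_factor t else 0)"
    unfolding Da lookup_sum
  proof (rule sum.cong)
    fix u assume u: "u \<in> Poly_Mapping.keys c"
    then have "u = t \<or> u < t"
      using ut by force
    then show "Poly_Mapping.lookup (const (Poly_Mapping.lookup c u) * D (basis_elt u)) (t + e) =
        (if u = t then Poly_Mapping.lookup c t * top_factor t else 0)"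
      using z[OF u, of "t + e"] by (auto simp: top_factor_def)
  qed simp
  then show "Poly_Mapping.lookup (D a) (t + e) = Poly_Mapping.lookup a t * top_factor t"
    by (simp add: in_keys_iff ct)
qed

text \<open>Compare \<open>D\<close> on \<open>z^d\<close> and on \<open>x M\<close>, which have the same leading term.\<close>

lemma weight_relation:
  "weight coord_x + (\<Sum>i\<in>UNIV. of_nat (k i) * weight (coord_y i)) = of_nat d * weight coord_z"
proof -
  let ?t = "Expo (int d) (\<lambda>_. 0) :: 'n expo"
  have "nmult 1 xexp + nmult 0 zexp + (\<Sum>i\<in>UNIV. nmult (k i) (yexp i)) = ?t"
    unfolding sum_nmult_yexp by (rule expo_eqI) simp_all
  then have 1: "graded P ?t (weight coord_x + (\<Sum>i\<in>UNIV. of_nat (k i) * weight (coord_y i)))"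
    using graded_monomial[of 1 0 k] by (simp add: X_mult_M flip: M_eq)
  have "nmult d zexp = ?t"
    by (rule expo_eqI) simp_all
  then have 2: "graded (Z ^ d) ?t (of_nat d * weight coord_z)"
    using graded_power[OF graded_gens(3), of d] by simp
  show ?thesis
    using 1 2 D_lookup[of P ?t] D_lookup[of "Z ^ d" ?t] by (auto simp: graded_def)
qed

lemma top_factor_eq_L:
  assumes "t \<in> cone"
  shows "top_factor t = L t"
proof -
  define p where "p = zdeg t div int d"
  define r where "r = zdeg t mod int d"
  have zt: "zdeg t = p * int d + r"
    by (simp add: p_def r_def)
  have "top_factor t = of_int p * weight coord_x + of_int r * weight coord_z +
    (\<Sum>i\<in>UNIV. of_int (ydeg t i + int (k i) * p) * weight (coord_y i))"
    using graded_basis_elt[OF assms] by (simp add: graded_def top_factor_def p_def r_def)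
  also have "(\<Sum>i\<in>UNIV. of_int (ydeg t i + int (k i) * p) * weight (coord_y i)) =
     (\<Sum>i\<in>UNIV. of_int (ydeg t i) * weight (coord_y i)) + of_int p * (\<Sum>i\<in>UNIV. of_nat (k i) * weight (coord_y i))"
    unfolding sum_distrib_left sum.distrib[symmetric] by (rule sum.cong) (simp_all add: algebra_simps)
  also have "(\<Sum>i\<in>UNIV. of_nat (k i) * weight (coord_y i)) = of_nat d * weight coord_z - weight coord_x"
    using weight_relation by (simp add: algebra_simps)
  finally show ?thesis
    by (simp add: L_def zt algebra_simps)
qed

text \<open>Iterating \<open>D\<close> on a basis element multiplies the leading coefficient by \<open>L t\<close>, \<open>L (t + e)\<close>,
\<open>L (t + 2e)\<close> and so on. Since some power of \<open>D\<close> annihilates the element, one of these factors vanishes.\<close>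

lemma L_chain:
  assumes "t \<in> cone"
  shows "\<exists>n. L t = - of_nat n * L e"
proof (rule ccontr)
  assume no: "\<nexists>n. L t = - of_nat n * L e"
  have Lne: "L (t + nmult n e) \<noteq> 0" for n
    using no by (auto simp: L_add L_nmult add_eq_0_iff2)
  have "(D ^^ n) (basis_elt t) \<in> A \<and> bounded_by ((D ^^ n) (basis_elt t)) (t + nmult n e) \<and>
      Poly_Mapping.lookup ((D ^^ n) (basis_elt t)) (t + nmult n e) \<noteq> 0" for n
  proof (induction n)
    case 0
    then show ?case
      using graded_basis_elt[OF assms] by (simp add: graded_def)
  next
    case (Suc n)
    have "t + nmult n e \<in> cone"
      using lm_in_cone Suc by blast
    then have "top_factor (t + nmult n e) \<noteq> 0"
      using top_factor_eq_L Lne by metis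
    moreover have next_eq: "t + nmult (Suc n) e = t + nmult n e + e"
      by (simp add: algebra_simps)
    ultimately show ?case
      using Suc D_top[of "(D ^^ n) (basis_elt t)" "t + nmult n e"] unfolding next_eq by simp
  qed
  moreover obtain n where "(D ^^ n) (basis_elt t) = 0"
    using D_nilpotent[of "basis_elt t"] by auto
  ultimately show False
    by (metis lookup_zero)
qed

lemma cone_shift:
  assumes "t \<in> cone" "L t \<noteq> 0"
  shows "t + e \<in> cone"
proof (rule lm_in_cone)
  show "D (basis_elt t) \<in> A" "bounded_by (D (basis_elt t)) (t + e)" "Poly_Mapping.lookup (D (basis_elt t)) (t + e) \<noteq> 0"
    using graded_basis_elt[OF assms(1)] top_factor_eq_L[OF assms(1)] assms(2) by (auto simp: graded_def top_factor_def)
qed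

lemma L_gexp: "L (gexp v) = weight v"
proof -
  have "top_factor (gexp v) = weight v"
    using D_lookup[of "gen v" "gexp v"] gen_bounded[of v] by (simp add: weight_def)
  then show ?thesis
    using top_factor_eq_L[of "gexp v"] by simp
qed

lemma L_e_nonzero: "L e \<noteq> 0"
proof
  assume "L e = 0"
  then have "L (gexp v) = 0" for v
    using L_chain[of "gexp v"] by auto
  then show False
    using e_degree by (auto simp: L_gexp is_degree_def weight_def)
qed

text \<open>All weights are natural multiples of \<open>- L e \<noteq> 0\<close>. The multipliers satisfy the hypotheses of
\<open>cone_degree_vanishes\<close>, and once the weights of the \<open>y\<^sub>i\<close> vanish, the weight of \<open>e\<close> being \<open>-1\<close> forces
\<open>z\<close>-degree \<open>-1\<close> for \<open>e\<close>.\<close>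

lemma weights:
  shows weight_y: "weight (coord_y i) = 0" and weight_z: "weight coord_z \<noteq> 0" and zdeg_e: "zdeg e = - 1"
proof -
  have "\<exists>n. weight v = - of_nat n * L e" for v
    using L_chain[of "gexp v"] by (simp add: L_gexp)
  then obtain n where n: "weight v = - of_nat (n v) * L e" for v
    by metis
  let ?a = "\<lambda>i. int (n (coord_y i))" and ?b = "int (n coord_x)" and ?c = "int (n coord_z)"
  have "1 * L e = - of_int (zdeg e * ?c + (\<Sum>i\<in>UNIV. ydeg e i * ?a i)) * L e"
    by (subst (1) L_def) (simp add: n sum_distrib_left sum_distrib_right sum_negf algebra_simps)
  then have "1 = - (of_int (zdeg e * ?c + (\<Sum>i\<in>UNIV. ydeg e i * ?a i)) :: 'a)"
    unfolding mult_cancel_right using L_e_nonzero by simp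
  then have "of_int (zdeg e * ?c + (\<Sum>i\<in>UNIV. ydeg e i * ?a i)) = (of_int (- 1) :: 'a)"
    unfolding of_int_minus of_int_1 by (rule equation_minus_iff[THEN iffD1])
  then have deg: "zdeg e * ?c + (\<Sum>i\<in>UNIV. ydeg e i * ?a i) = - 1"
    unfolding of_int_eq_iff .
  have "(of_int (?b + (\<Sum>i\<in>UNIV. int (k i) * ?a i)) :: 'a) * (- L e) = of_int (int d * ?c) * (- L e)"
    using weight_relation by (simp add: n sum_distrib_left sum_distrib_right sum_negf algebra_simps)
  then have "(of_int (?b + (\<Sum>i\<in>UNIV. int (k i) * ?a i)) :: 'a) = of_int (int d * ?c)"
    by (subst (asm) mult_cancel_right) (use L_e_nonzero in simp)
  then have rel: "?b + (\<Sum>i\<in>UNIV. int (k i) * ?a i) = int d * ?c"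
    unfolding of_int_eq_iff .
  have shift: "gexp v + e \<in> cone" if "n v \<noteq> 0" for v
    using cone_shift[of "gexp v"] that L_e_nonzero by (simp add: L_gexp n)
  have "e \<notin> cone"
  proof
    assume "e \<in> cone"
    then obtain m where "L e = - of_nat m * L e"
      using L_chain by blast
    then have "(1 + of_nat m) * L e = 0"
      by (simp add: distrib_right flip: eq_neg_iff_add_eq_0)
    then have "(of_nat (Suc m) :: 'a) = 0"
      using L_e_nonzero by simp
    then show False
      by (simp only: of_nat_eq_0_iff)
  qed
  then have a: "n (coord_y i) = 0" for i
    using cone_degree_vanishes[OF deg rel, of i] shift[of coord_z] shift[of "coord_y _"] by auto
  then show "weight (coord_y i) = 0"
    by (simp add: n)
  have "zdeg e * ?c = - 1"
    using deg a by simp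
  then have "(- zdeg e) * ?c = 1"
    by simp
  then have "?c = 1 \<and> zdeg e = - 1"
    unfolding zmult_eq_1_iff by auto
  then show "weight coord_z \<noteq> 0" "zdeg e = - 1"
    using L_e_nonzero by (simp_all add: n)
qed

lemma L_eq: "L t = of_int (zdeg t) * weight coord_z"
  by (simp add: L_def weight_y)

lemma D_eq_0:
  assumes "a \<in> A" "a \<noteq> 0" "zdeg (lm a) = 0"
  shows "D a = 0"
proof (rule ccontr)
  assume nz: "D a \<noteq> 0"
  have b: "bounded_by (D a) (lm a + e)"
    using D_bounded[OF assms(1) bounded_by_lm] .
  then have "lm (D a) \<le> lm a + e"
    using lm_le_iff[OF nz] by simp
  then have "zdeg (lm (D a)) < 0"
    using zdeg_mono[of "lm (D a)" "lm a + e"] assms(3) zdeg_e by simp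
  moreover have "lm (D a) \<in> cone"
    using lm_in_cone[OF _ bounded_by_lm lookup_lm[OF nz]] assms(1) by simp
  ultimately show False
    by (simp add: cone_def)
qed

lemma D_lowers:
  assumes "a \<in> A" "a \<noteq> 0" "zdeg (lm a) \<noteq> 0"
  shows "D a \<noteq> 0" "zdeg (lm (D a)) = zdeg (lm a) - 1"
proof -
  have "lm a \<in> cone"
    using lm_in_cone[OF assms(1) bounded_by_lm lookup_lm[OF assms(2)]] .
  then have "top_factor (lm a) \<noteq> 0"
    using assms(3) weight_z by (simp add: top_factor_eq_L L_eq)
  then have l: "Poly_Mapping.lookup (D a) (lm a + e) \<noteq> 0"
    using D_lookup[OF assms(1) bounded_by_lm] lookup_lm[OF assms(2)] by simp
  then show "D a \<noteq> 0"
    by auto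
  have "lm (D a) = lm a + e"
    using D_bounded[OF assms(1) bounded_by_lm] l by (rule lm_eqI)
  then show "zdeg (lm (D a)) = zdeg (lm a) - 1"
    by (simp add: zdeg_e)
qed

end

section \<open>The derivation M d/dz\<close>

text \<open>The Euler derivation \<open>z \<partial>/\<partial>z\<close>.\<close>

definition zweight :: "('n, 'a::comm_ring_1) laurent \<Rightarrow> ('n, 'a) laurent" where
  "zweight = lin_ext (\<lambda>t c. Poly_Mapping.single t (of_int (zdeg t) * c))"

lemma zweight_single: "zweight (Poly_Mapping.single t c) = Poly_Mapping.single t (of_int (zdeg t) * c)"
  unfolding zweight_def by (rule lin_ext_single) simp

lemma zweight_add: "zweight (a + b) = zweight a + zweight b"
  unfolding zweight_def by (rule lin_ext_add) (simp_all add: distrib_left single_add)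

lemma zweight_zero [simp]: "zweight 0 = 0"
  by (simp add: zweight_def)

lemma zweight_mult: "zweight (a * b) = a * zweight b + b * zweight a"
proof (induction a rule: poly_mapping_induct)
  case (single t c)
  show ?case
    by (induction b rule: poly_mapping_induct)
       (simp_all add: zweight_single zweight_add mult_single algebra_simps flip: single_add)
qed (simp_all add: zweight_add algebra_simps)

lemma zweight_zlow: "a \<in> zlow n \<Longrightarrow> zweight a \<in> zlow n"
  unfolding zweight_def lin_ext_def
  by (intro zlow_sum zlow_single) (simp add: zlow_def)

text \<open>Inverting all variables exchanges largest and smallest exponents, so statements about leading exponents
also apply to the lowest ones.\<close>

definition reflect :: "('g::ab_group_add \<Rightarrow>\<^sub>0 'b::comm_ring_1) \<Rightarrow> 'g \<Rightarrow>\<^sub>0 'b" where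
  "reflect = lin_ext (\<lambda>t c. Poly_Mapping.single (- t) c)"

lemma reflect_mult: "reflect (a * b) = reflect a * reflect b"
  unfolding reflect_def by (rule lin_ext_mult) (simp_all add: single_add mult_single)

lemma reflect_single [simp]: "reflect (Poly_Mapping.single t c) = Poly_Mapping.single (- t) c"
  unfolding reflect_def by (rule lin_ext_single) simp

lemma lookup_reflect: "Poly_Mapping.lookup (reflect a) t = Poly_Mapping.lookup a (- t)"
proof -
  have "Poly_Mapping.lookup (reflect a) t =
      (\<Sum>s\<in>Poly_Mapping.keys a. if s = - t then Poly_Mapping.lookup a s else 0)"
    unfolding reflect_def lin_ext_def lookup_sum
    by (rule sum.cong) (auto simp: lookup_single when_def)
  then show ?thesis
    by (simp add: in_keys_iff)
qed

text \<open>Largest and smallest exponents are additive under multiplication. They coincide for the product, so they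
coincide for each factor.\<close>

lemma factor_of_monomial:
  fixes a b :: "'g::linordered_ab_group_add \<Rightarrow>\<^sub>0 'b::idom"
  assumes ab: "a * b = Poly_Mapping.single t c" and c: "c \<noteq> 0"
  obtains u c' where "a = Poly_Mapping.single u c'" "c' \<noteq> 0"
proof -
  have a0: "a \<noteq> 0" and b0: "b \<noteq> 0"
    using ab c by (metis lookup_single_eq lookup_zero mult_zero_left mult_zero_right)+
  have refl0: "reflect x \<noteq> 0" if "x \<noteq> 0" for x :: "'g \<Rightarrow>\<^sub>0 'b"
    using lookup_lm[OF that] lookup_reflect[of x "- lm x"] by auto
  have low: "- lm (reflect x) \<le> s" if "s \<in> Poly_Mapping.keys x" for x :: "'g \<Rightarrow>\<^sub>0 'b" and s
  proof -
    have "- s \<in> Poly_Mapping.keys (reflect x)"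
      using that by (simp add: in_keys_iff lookup_reflect)
    then have "- s \<le> lm (reflect x)"
      using bounded_by_lm by blast
    then show ?thesis
      using neg_le_iff_le minus_le_iff by blast
  qed
  \<comment> \<open>\<open>- lm (reflect x)\<close> is the smallest exponent of \<open>x\<close>.\<close>
  have mid: "- lm (reflect x) \<le> lm x" if "x \<noteq> 0" for x :: "'g \<Rightarrow>\<^sub>0 'b"
    using low lookup_lm[OF that] by (simp add: in_keys_iff)
  have "lm a + lm b = t"
    using lm_mult[OF a0 b0] ab c by simp
  moreover have "lm (reflect a) + lm (reflect b) = - t"
    using lm_mult[OF refl0[OF a0] refl0[OF b0]] ab c by (simp flip: reflect_mult)
  ultimately have "lm a + lm b = - lm (reflect a) + - lm (reflect b)"
    by (metis minus_add_distrib minus_minus)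
  then have eq: "- lm (reflect a) = lm a"
    using mid[OF a0] mid[OF b0] by (metis add_le_less_mono add_less_le_mono order_le_less less_irrefl)
  have "s = lm a" if "s \<in> Poly_Mapping.keys a" for s
    using low[OF that] bounded_by_lm[of a] that eq by force
  then have "a = Poly_Mapping.single (lm a) (Poly_Mapping.lookup a (lm a))"
    by (intro poly_mapping_eqI) (metis in_keys_iff lookup_single_eq lookup_single_not_eq)
  then show ?thesis
    using that lookup_lm[OF a0] by metis
qed

context danielewski
begin

text \<open>The derivation \<open>M \<partial>/\<partial>z\<close>.\<close>

definition std_deriv :: "('n, 'a) laurent \<Rightarrow> ('n, 'a) laurent" where
  "std_deriv a = zweight a * Poly_Mapping.single (mexp - zexp) 1"

lemma std_deriv_add: "std_deriv (a + b) = std_deriv a + std_deriv b"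
  by (simp add: std_deriv_def zweight_add distrib_right)

lemma std_deriv_mult: "std_deriv (a * b) = a * std_deriv b + b * std_deriv a"
  by (simp add: std_deriv_def zweight_mult algebra_simps)

lemma std_deriv_const: "std_deriv (const c) = 0"
  by (simp add: std_deriv_def const_def zweight_single)

lemma std_deriv_Y: "std_deriv (Y i) = 0"
  by (simp add: std_deriv_def Y_def zweight_single)

lemma std_deriv_Z: "std_deriv Z = M"
  by (simp add: std_deriv_def Z_def M_def zweight_single mult_single)

lemma std_deriv_M: "std_deriv M = 0"
  by (simp add: std_deriv_def M_def zweight_single)

lemma std_deriv_sum: "std_deriv (\<Sum>i\<in>I. f i) = (\<Sum>i\<in>I. std_deriv (f i))"
  using std_deriv_const[of 0] by (induction I rule: infinite_finite_induct) (simp_all add: std_deriv_add)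

lemma std_deriv_ypoly: "std_deriv (mpoly_subst Y p) = 0"
  by (induction p rule: mpoly_induct) (simp_all add: std_deriv_const std_deriv_Y std_deriv_add std_deriv_mult)

lemma ypoly_in_A [simp]: "mpoly_subst Y p \<in> A"
  by (induction p rule: mpoly_induct) simp_all

lemma std_deriv_Z_power: "\<exists>g\<in>A. std_deriv (Z ^ n) = M * g"
proof (induction n)
  case 0
  then show ?case
    using std_deriv_const[of 1] by (intro bexI[of _ 0]) simp_all
next
  case (Suc n)
  then obtain g where g: "g \<in> A" "std_deriv (Z ^ n) = M * g"
    by blast
  have "std_deriv (Z ^ Suc n) = M * (Z * g + Z ^ n)"
    by (simp add: std_deriv_mult g std_deriv_Z algebra_simps)
  moreover have "Z * g + Z ^ n \<in> A"
    using g by simp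
  ultimately show ?case
    by blast
qed

lemma std_deriv_P: "\<exists>g\<in>A. std_deriv P = M * g"
proof -
  obtain g where g: "\<And>n. g n \<in> A" "\<And>n. std_deriv (Z ^ n) = M * g n"
    using std_deriv_Z_power by metis
  have "std_deriv P = M * (g d + (\<Sum>j<d. mpoly_subst Y (q j) * g j))"
    by (simp add: P_def std_deriv_add std_deriv_sum std_deriv_mult g std_deriv_ypoly distrib_left sum_distrib_left ac_simps)
  moreover have "g d + (\<Sum>j<d. mpoly_subst Y (q j) * g j) \<in> A"
    using g by (intro A_closed(5) A_sum A_closed(7)) simp_all
  ultimately show ?thesis
    by blast
qed

lemma M_nonzero: "M \<noteq> 0"
  by (metis M_def lookup_single_eq lookup_zero zero_neq_one)

text \<open>Applying \<open>M \<partial>/\<partial>z\<close> to \<open>x M = P\<close> and cancelling \<open>M\<close> shows that \<open>x\<close> is sent to \<open>\<partial>P/\<partial>z\<close>.\<close>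

lemma std_deriv_X: "std_deriv X \<in> A"
proof -
  obtain g where g: "g \<in> A" "std_deriv P = M * g"
    using std_deriv_P by blast
  then have "M * std_deriv X = M * g"
    using std_deriv_mult[of X M] by (auto simp: X_mult_M std_deriv_M)
  then show ?thesis
    using g M_nonzero by auto
qed

lemma std_deriv_closed: "a \<in> A \<Longrightarrow> std_deriv a \<in> A"
proof (induction rule: A_induct)
  case (gen v)
  then show ?case
    by (cases v) (simp_all add: std_deriv_X std_deriv_Y std_deriv_Z)
qed (simp_all add: std_deriv_const std_deriv_add std_deriv_mult)

lemma A_zlow_0: "a \<in> A \<Longrightarrow> a \<in> zlow 0 \<Longrightarrow> a = 0"
proof (rule ccontr)
  assume a: "a \<in> A" "a \<in> zlow 0" "a \<noteq> 0"
  have "lm a \<in> cone"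
    using lm_in_cone[OF a(1) bounded_by_lm lookup_lm[OF a(3)]] .
  moreover have "zdeg (lm a) < 0"
    using a(2) lookup_lm[OF a(3)] by (simp add: zlow_def in_keys_iff)
  ultimately show False
    by (simp add: cone_def)
qed

lemma zlow_iff_lm: "a \<noteq> 0 \<Longrightarrow> a \<in> zlow n \<longleftrightarrow> zdeg (lm a) < n" for a :: "('n, 'a) laurent"
proof
  assume "a \<noteq> 0" "a \<in> zlow n"
  then show "zdeg (lm a) < n"
    using lookup_lm[of a] by (simp add: zlow_def in_keys_iff)
next
  assume "zdeg (lm a) < n"
  then show "a \<in> zlow n"
    using bounded_by_lm[of a] zdeg_mono[of _ "lm a"] by (fastforce simp: zlow_def)
qed

lemma std_deriv_zlow: "a \<in> zlow n \<Longrightarrow> std_deriv a \<in> zlow (n - 1)"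
  using zlow_mult[OF zweight_zlow, of a n "Poly_Mapping.single (mexp - zexp) 1" "- 1"]
  by (simp add: std_deriv_def zlow_single)

lemma std_deriv_power_zlow: "a \<in> A \<Longrightarrow> a \<in> zlow n \<Longrightarrow> (std_deriv ^^ m) a \<in> A \<and> (std_deriv ^^ m) a \<in> zlow (n - int m)"
  by (induction m) (auto simp: std_deriv_closed dest: std_deriv_zlow[of _ "n - int _"] simp: algebra_simps)

lemma std_deriv_nilpotent:
  assumes "a \<in> A"
  shows "\<exists>n. (std_deriv ^^ n) a = 0"
proof (cases "a = 0")
  case False
  define n where "n = nat (zdeg (lm a) + 1)"
  have "a \<in> zlow (int n)"
    using zlow_iff_lm[OF False] by (simp add: n_def)
  then show ?thesis
    using std_deriv_power_zlow[OF assms, of "int n" n] A_zlow_0 by auto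
qed (auto intro: exI[of _ 0])

lemma lnd_std_deriv: "lnd k d q std_deriv"
proof
  show "\<exists>a\<in>A. std_deriv a \<noteq> 0"
    using M_nonzero by (intro bexI[of _ Z]) (simp_all add: std_deriv_Z)
qed (simp_all add: std_deriv_closed std_deriv_add std_deriv_mult std_deriv_const std_deriv_nilpotent)

text \<open>The polynomials in the \<open>y\<^sub>i\<close>.\<close>

definition A0 :: "('n, 'a) laurent set" where "A0 = A \<inter> zlow 1"

lemma A0_keys:
  assumes "a \<in> A0" "t \<in> Poly_Mapping.keys a"
  shows "zdeg t = 0" "ydeg t i \<ge> 0"
proof -
  have "t \<in> cone"
    using A_low_keys[of a] zlow_mono[of a 1 "int d"] assms d2 by (auto simp: A0_def)
  moreover have "zdeg t < 1"
    using assms by (simp add: A0_def zlow_def)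
  ultimately show "zdeg t = 0"
    by (simp add: cone_def)
  then show "ydeg t i \<ge> 0"
    using \<open>t \<in> cone\<close> by (simp add: cone_def)
qed

lemma single_in_A0:
  assumes "zdeg t = 0" "\<And>i. ydeg t i \<ge> 0"
  shows "Poly_Mapping.single t c = const c * (\<Prod>i\<in>UNIV. Y i ^ nat (ydeg t i))"
    "Poly_Mapping.single t c \<in> A0"
proof -
  have "Expo 0 (\<lambda>i. int (nat (ydeg t i))) = t"
    using assms by (intro expo_eqI) simp_all
  then show 1: "Poly_Mapping.single t c = const c * (\<Prod>i\<in>UNIV. Y i ^ nat (ydeg t i))"
    by (simp add: prod_Y_power const_def mult_single)
  have "Poly_Mapping.single t c \<in> A"
    unfolding 1 by (intro A_closed(7) A_prod) simp_all
  then show "Poly_Mapping.single t c \<in> A0"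
    using assms by (simp add: A0_def zlow_single)
qed

lemma A0_sum: "(\<And>i. i \<in> I \<Longrightarrow> f i \<in> A0) \<Longrightarrow> (\<Sum>i\<in>I. f i) \<in> A0"
  by (auto simp: A0_def intro: A_sum zlow_sum)

lemma A0_in_A: "a \<in> A0 \<Longrightarrow> a \<in> A"
  by (simp add: A0_def)

lemma A0_mult: "a \<in> A0 \<Longrightarrow> b \<in> A0 \<Longrightarrow> a * b \<in> A0"
  using zlow_mult[of a 1 b 0] by (simp add: A0_def)

lemma A0_gens: "Y i \<in> A0" "const c \<in> A0" "mpoly_subst Y p \<in> A0" "M \<in> A0"
  by (simp_all add: A0_def ypoly_zlow const_zlow) (simp_all add: Y_def M_def zlow_single)

lemma A0_unit:
  assumes "a \<in> A0" "b \<in> A0" "a * b = 1"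
  obtains c where "a = const c" "c \<noteq> 0"
proof -
  obtain t c where a: "a = Poly_Mapping.single t c" "c \<noteq> 0"
    using factor_of_monomial[of a b 0 1] assms(3) by auto
  obtain u c' where b: "b = Poly_Mapping.single u c'" "c' \<noteq> 0"
    using factor_of_monomial[of b a 0 1] assms(3) by (auto simp: mult.commute)
  have "Poly_Mapping.single (t + u) (c * c') = Poly_Mapping.single 0 1"
    using assms(3) a b by (simp add: mult_single)
  then have "t + u = 0"
    using a(2) b(2) lm_single[of "c * c'" "t + u"] lm_single[of "1::'a" "0::'n expo"] by simp
  moreover have "t \<ge> 0" "u \<ge> 0"
    using A0_keys[OF assms(1), of t] A0_keys[OF assms(2), of u] a b by (auto intro!: nonneg_expo)
  ultimately have "t = 0"
    by (metis add_nonneg_eq_0_iff)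
  then show ?thesis
    using that[of c] a by (simp add: const_def)
qed

lemma linear_decomposition:
  assumes "a \<in> A" "a \<in> zlow 2"
  obtains a1 a0 where "a1 \<in> A0" "a0 \<in> A0" "a = a1 * Z + a0"
proof -
  have cone: "Poly_Mapping.keys a \<subseteq> cone"
    using A_low_keys[of a] zlow_mono[of a 2 "int d"] assms d2 by auto
  define K where "K n = {t \<in> Poly_Mapping.keys a. zdeg t = n}" for n
  have "zdeg t = 1 \<or> zdeg t = 0" if "t \<in> Poly_Mapping.keys a" for t
  proof -
    have "zdeg t \<ge> 0" "zdeg t < 2"
      using that cone assms(2) by (auto simp: cone_def zlow_def)
    then show ?thesis
      by linarith
  qed
  then have K: "Poly_Mapping.keys a = K 1 \<union> K 0" "K 1 \<inter> K 0 = {}" "finite (K n)" for n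
    by (auto simp: K_def)
  define a1 where "a1 = (\<Sum>t\<in>K 1. Poly_Mapping.single (t - zexp) (Poly_Mapping.lookup a t))"
  define a0 where "a0 = (\<Sum>t\<in>K 0. Poly_Mapping.single t (Poly_Mapping.lookup a t))"
  have nn: "ydeg t i \<ge> 0" if "t \<in> K 1 \<union> K 0" for t i
  proof -
    have "t \<in> cone" "zdeg t div int d = 0"
      using that cone d2 by (auto simp: K_def)
    then show ?thesis
      by (simp add: cone_def)
  qed
  have "a1 \<in> A0" "a0 \<in> A0"
    unfolding a1_def a0_def using nn by (auto intro!: A0_sum single_in_A0 simp: K_def)
  moreover have "a = a1 * Z + a0"
  proof -
    have "a1 * Z = (\<Sum>t\<in>K 1. Poly_Mapping.single t (Poly_Mapping.lookup a t))"
      by (simp add: a1_def sum_distrib_right Z_def mult_single)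
    then have "a1 * Z + a0 = (\<Sum>t\<in>K 1 \<union> K 0. Poly_Mapping.single t (Poly_Mapping.lookup a t))"
      using K(2,3) by (simp add: sum.union_disjoint a0_def)
    then show ?thesis
      using poly_mapping_sum_singles[of a] K(1) by simp
  qed
  ultimately show ?thesis
    using that by blast
qed

end

section \<open>Automorphisms of the coordinate ring\<close>

locale A_auto = danielewski k d q
  for k :: "'n::finite \<Rightarrow> nat" and d :: nat and q :: "nat \<Rightarrow> ('n, 'a::field_char_0) mpoly" +
  fixes \<phi> \<psi> :: "('n, 'a) laurent \<Rightarrow> ('n, 'a) laurent"
  assumes phi_closed [simp]: "a \<in> A \<Longrightarrow> \<phi> a \<in> A"
    and phi_add: "a \<in> A \<Longrightarrow> b \<in> A \<Longrightarrow> \<phi> (a + b) = \<phi> a + \<phi> b"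
    and phi_mult: "a \<in> A \<Longrightarrow> b \<in> A \<Longrightarrow> \<phi> (a * b) = \<phi> a * \<phi> b"
    and phi_const [simp]: "\<phi> (const c) = const c"
    and psi_closed [simp]: "a \<in> A \<Longrightarrow> \<psi> a \<in> A"
    and phi_psi [simp]: "a \<in> A \<Longrightarrow> \<phi> (\<psi> a) = a"
    and psi_phi [simp]: "a \<in> A \<Longrightarrow> \<psi> (\<phi> a) = a"
begin

lemma phi_inj: "a \<in> A \<Longrightarrow> b \<in> A \<Longrightarrow> \<phi> a = \<phi> b \<Longrightarrow> a = b"
  by (metis psi_phi)

lemma psi_const [simp]: "\<psi> (const c) = const c"
  by (metis A_closed(3) phi_const psi_phi)

lemma psi_add: "a \<in> A \<Longrightarrow> b \<in> A \<Longrightarrow> \<psi> (a + b) = \<psi> a + \<psi> b"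
  by (rule phi_inj) (simp_all add: phi_add)

lemma psi_mult: "a \<in> A \<Longrightarrow> b \<in> A \<Longrightarrow> \<psi> (a * b) = \<psi> a * \<psi> b"
  by (rule phi_inj) (simp_all add: phi_mult)

lemma swap: "A_auto k d q \<psi> \<phi>"
  by standard (simp_all add: psi_add psi_mult)

lemma phi_zero [simp]: "\<phi> 0 = 0"
  using phi_const[of 0] by simp

lemma phi_one [simp]: "\<phi> 1 = 1"
  using phi_const[of 1] by simp

lemma phi_eq_0_iff: "a \<in> A \<Longrightarrow> \<phi> a = 0 \<longleftrightarrow> a = 0"
  using phi_inj[of a 0] by auto

lemma phi_power: "a \<in> A \<Longrightarrow> \<phi> (a ^ n) = \<phi> a ^ n"
  by (induction n) (simp_all add: phi_mult)

lemma phi_sum: "(\<And>i. i \<in> I \<Longrightarrow> f i \<in> A) \<Longrightarrow> \<phi> (\<Sum>i\<in>I. f i) = (\<Sum>i\<in>I. \<phi> (f i))"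
  by (induction I rule: infinite_finite_induct) (simp_all add: phi_add A_sum)

lemma phi_prod: "(\<And>i. i \<in> I \<Longrightarrow> f i \<in> A) \<Longrightarrow> \<phi> (\<Prod>i\<in>I. f i) = (\<Prod>i\<in>I. \<phi> (f i))"
  by (induction I rule: infinite_finite_induct) (simp_all add: phi_mult A_prod)

definition conj_deriv :: "('n, 'a) laurent \<Rightarrow> ('n, 'a) laurent" where
  "conj_deriv a = \<phi> (std_deriv (\<psi> a))"

lemma conj_deriv_phi: "a \<in> A \<Longrightarrow> conj_deriv (\<phi> a) = \<phi> (std_deriv a)"
  by (simp add: conj_deriv_def)

lemma lnd_conj_deriv: "lnd k d q conj_deriv"
proof
  fix a assume a: "a \<in> A"
  have A: "(std_deriv ^^ n) (\<psi> a) \<in> A" for n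
    using a by (induction n) (simp_all add: std_deriv_closed)
  have "(conj_deriv ^^ n) a = \<phi> ((std_deriv ^^ n) (\<psi> a))" for n
    using a by (induction n) (simp_all add: conj_deriv_phi A)
  then show "\<exists>n. (conj_deriv ^^ n) a = 0"
    using std_deriv_nilpotent[of "\<psi> a"] a by (metis psi_closed phi_zero)
next
  show "\<exists>a\<in>A. conj_deriv a \<noteq> 0"
    using M_nonzero by (intro bexI[of _ "\<phi> Z"]) (simp_all add: conj_deriv_phi std_deriv_Z phi_eq_0_iff)
qed (simp_all add: conj_deriv_def std_deriv_closed psi_add phi_add std_deriv_add psi_mult std_deriv_mult phi_mult std_deriv_const)

text \<open>The standard derivation and its conjugate both lower positive \<open>z\<close>-degrees by one and kill
degree zero, so the \<open>z\<close>-degree of \<open>a\<close> and that of \<open>\<phi> a\<close> count the same number of steps until zero.\<close>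

lemma zdeg_phi:
  assumes "a \<in> A" "a \<noteq> 0"
  shows "zdeg (lm (\<phi> a)) = zdeg (lm a)"
proof -
  interpret std_deriv: lnd k d q std_deriv by (rule lnd_std_deriv)
  interpret conj_deriv: lnd k d q conj_deriv by (rule lnd_conj_deriv)
  have "zdeg (lm (\<phi> a)) = int n" if "a \<in> A" "a \<noteq> 0" "zdeg (lm a) = int n" for n a
    using that
  proof (induction n arbitrary: a)
    case 0
    then have "conj_deriv (\<phi> a) = 0"
      using std_deriv.D_eq_0[of a] by (simp add: conj_deriv_phi)
    then show ?case
      using conj_deriv.D_lowers(1)[of "\<phi> a"] 0 by (auto simp: phi_eq_0_iff)
  next
    case (Suc n)
    have "std_deriv a \<noteq> 0" "zdeg (lm (std_deriv a)) = int n"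
      using std_deriv.D_lowers[of a] Suc.prems by simp_all
    then have n: "zdeg (lm (conj_deriv (\<phi> a))) = int n" and nz: "conj_deriv (\<phi> a) \<noteq> 0"
      using Suc by (simp_all add: conj_deriv_phi std_deriv_closed phi_eq_0_iff)
    have "zdeg (lm (\<phi> a)) \<noteq> 0"
      using conj_deriv.D_eq_0[of "\<phi> a"] nz Suc.prems by (auto simp: phi_eq_0_iff)
    then show ?case
      using conj_deriv.D_lowers(2)[of "\<phi> a"] n Suc.prems by (simp add: phi_eq_0_iff)
  qed
  moreover have "zdeg (lm a) \<ge> 0"
    using lm_in_cone[OF assms(1) bounded_by_lm lookup_lm[OF assms(2)]] by (simp add: cone_def)
  ultimately show ?thesis
    using assms by (metis nonneg_int_cases)
qed

lemma phi_zlow: "a \<in> A \<Longrightarrow> a \<in> zlow n \<Longrightarrow> \<phi> a \<in> zlow n"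
  by (cases "a = 0") (simp_all add: zlow_iff_lm zdeg_phi phi_eq_0_iff)

lemma phi_A0: "a \<in> A0 \<Longrightarrow> \<phi> a \<in> A0"
  by (simp add: A0_def phi_zlow)

lemma phi_Z_linear: "\<exists>a1\<in>A0. \<exists>a0\<in>A0. \<phi> Z = a1 * Z + a0"
proof -
  have "Z \<in> zlow 2"
    by (simp add: Z_def zlow_single)
  then show ?thesis
    using linear_decomposition[of "\<phi> Z"] phi_zlow[of Z 2] by (metis A_gens(3) phi_closed)
qed

text \<open>Applying \<open>\<phi>\<close> to the linear form of \<open>\<psi> z\<close> and inserting that of \<open>\<phi> z\<close> gives \<open>z\<close>, so the leading
coefficients are units among the polynomials in the \<open>y\<^sub>i\<close>, hence constants.\<close>

lemma phi_Z: "\<exists>c b. c \<noteq> 0 \<and> b \<in> A0 \<and> \<phi> Z = const c * Z + b"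
proof -
  interpret inv: A_auto k d q \<psi> \<phi> by (rule swap)
  obtain a1 a0 where a: "a1 \<in> A0" "a0 \<in> A0" "\<phi> Z = a1 * Z + a0"
    using phi_Z_linear by blast
  obtain b1 b0 where b: "b1 \<in> A0" "b0 \<in> A0" "\<psi> Z = b1 * Z + b0"
    using inv.phi_Z_linear by blast
  define r where "r = 1 - \<phi> b1 * a1"
  have "Z = \<phi> (\<psi> Z)"
    by simp
  also have "\<dots> = \<phi> b1 * (a1 * Z + a0) + \<phi> b0"
    using b by (simp only: b(3) A0_in_A A_closed A_gens phi_add phi_mult a(3))
  finally have rZ: "r * Z = \<phi> b1 * a0 + \<phi> b0"
    by (simp add: r_def algebra_simps)
  have "r = 0"
  proof (rule ccontr)
    assume r0: "r \<noteq> 0"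
    have "r \<in> A"
      using a b by (simp add: r_def A0_in_A)
    then have "zdeg (lm r) \<ge> 0"
      using lm_in_cone[OF _ bounded_by_lm lookup_lm[OF r0]] by (simp add: cone_def)
    moreover have Z0: "Z \<noteq> 0"
      by (metis Z_def lookup_single_eq lookup_zero zero_neq_one)
    then have "lm (r * Z) = lm r + zexp"
      using lm_mult[OF r0 Z0] by (simp add: Z_def)
    moreover have "\<phi> b1 * a0 + \<phi> b0 \<in> zlow 1"
      using a b A0_mult[OF phi_A0, of b1 a0] phi_A0[of b0] by (simp add: A0_def zlow_add)
    then have "zdeg (lm (r * Z)) < 1"
      using zlow_iff_lm[of "r * Z" 1] r0 Z0 by (simp add: rZ[symmetric])
    ultimately show False
      by simp
  qed
  then have "a1 * \<phi> b1 = 1"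
    by (simp add: r_def mult.commute)
  then obtain c where "a1 = const c" "c \<noteq> 0"
    using A0_unit[of a1 "\<phi> b1"] a b phi_A0 by metis
  then show ?thesis
    using a by blast
qed

lemma zlead_phi_P: "\<exists>c. c \<noteq> 0 \<and> zlead (\<phi> P) (Expo (int d) (\<lambda>_. 0)) c"
proof -
  obtain c b where cb: "c \<noteq> 0" "b \<in> A0" "\<phi> Z = const c * Z + b"
    using phi_Z by blast
  have "zlead (\<phi> Z) zexp c"
    unfolding cb(3) by (rule zlead_add_zlow) (use cb(2) in \<open>simp_all add: Z_def const_def mult_single A0_def\<close>)
  then have l: "zlead (\<phi> Z ^ n) (nmult n zexp) (c ^ n)" for n
    by (rule zlead_power)
  have "\<phi> (mpoly_subst Y (q j)) * \<phi> Z ^ j \<in> zlow (int d)" if "j < d" for j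
  proof -
    have "\<phi> (mpoly_subst Y (q j)) \<in> zlow 1"
      using phi_A0[OF A0_gens(3)] by (simp add: A0_def)
    moreover have "\<phi> Z ^ j \<in> zlow (int j + 1)"
      using zlead_in_zlow[OF l[of j]] by simp
    ultimately show ?thesis
      using zlow_mult[of _ 1 _ "int j"] that by (force intro: zlow_mono)
  qed
  then have "(\<Sum>j<d. \<phi> (mpoly_subst Y (q j)) * \<phi> Z ^ j) \<in> zlow (int d)"
    by (intro zlow_sum) simp
  moreover have "\<phi> P = \<phi> Z ^ d + (\<Sum>j<d. \<phi> (mpoly_subst Y (q j)) * \<phi> Z ^ j)"
    by (simp add: P_def phi_add phi_sum phi_mult phi_power A_sum)
  moreover have "Expo (int d) (\<lambda>_. 0) = nmult d zexp"
    by (rule expo_eqI) simp_all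
  ultimately have "zlead (\<phi> P) (Expo (int d) (\<lambda>_. 0)) (c ^ d)"
    using zlead_add_zlow[OF l[of d], of "\<Sum>j<d. \<phi> (mpoly_subst Y (q j)) * \<phi> Z ^ j"] by simp
  then show ?thesis
    using cb(1) by (metis power_not_zero)
qed

text \<open>In the normal form of \<open>\<phi> x\<close>, which has \<open>z\<close>-degree at most \<open>d\<close>, a basis element of degree \<open>d\<close> contributes
exactly its leading term to degree \<open>d\<close>, and the others contribute nothing.\<close>

lemma phi_X_top:
  "\<exists>T. Poly_Mapping.keys T \<subseteq> cone \<inter> {t. zdeg t = int d} \<and> \<phi> X - T \<in> zlow (int d)"
proof -
  obtain c where c: "Poly_Mapping.keys c \<subseteq> cone"
    "\<phi> X = (\<Sum>t\<in>Poly_Mapping.keys c. const (Poly_Mapping.lookup c t) * basis_elt t)"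
    "\<And>t. bounded_by c t \<longleftrightarrow> bounded_by (\<phi> X) t"
    using A_normal_form[of "\<phi> X"] by auto
  have "X \<in> zlow (int d + 1)"
    using zlead_in_zlow[OF zlead_X] by simp
  then have "\<phi> X \<in> zlow (int d + 1)"
    by (rule phi_zlow[rotated]) simp
  then have "\<phi> X \<noteq> 0 \<Longrightarrow> zdeg (lm (\<phi> X)) \<le> int d"
    using zlow_iff_lm[of "\<phi> X"] by simp
  then have deg: "zdeg t \<le> int d" if "t \<in> Poly_Mapping.keys c" for t
    using c(3)[of "lm (\<phi> X)"] bounded_by_lm[of "\<phi> X"] that zdeg_mono[of t "lm (\<phi> X)"] c
      lookup_normal_form(2)[OF c(1) bounded_by_lm] lookup_lm[of c]
    by (cases "\<phi> X = 0") force+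
  define K where "K = {t \<in> Poly_Mapping.keys c. zdeg t = int d}"
  define T where "T = (\<Sum>t\<in>K. Poly_Mapping.single t (Poly_Mapping.lookup c t))"
  have "Poly_Mapping.lookup T t = 0" if "t \<notin> K" for t
    unfolding T_def lookup_sum using that by (intro sum.neutral) (auto simp: lookup_single when_def)
  then have "Poly_Mapping.keys T \<subseteq> K"
    by (auto simp: in_keys_iff)
  then have "Poly_Mapping.keys T \<subseteq> cone \<inter> {t. zdeg t = int d}"
    using c(1) by (auto simp: K_def)
  moreover have "\<phi> X - T = (\<Sum>t\<in>Poly_Mapping.keys c. const (Poly_Mapping.lookup c t) * basis_elt t -
      (if t \<in> K then Poly_Mapping.single t (Poly_Mapping.lookup c t) else 0))"
    unfolding sum_subtractf c(2)[symmetric] T_def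
    by (subst sum.inter_restrict[symmetric]) (auto simp: K_def intro: sum.cong)
  moreover have "const (Poly_Mapping.lookup c t) * basis_elt t -
      (if t \<in> K then Poly_Mapping.single t (Poly_Mapping.lookup c t) else 0) \<in> zlow (int d)"
    if t: "t \<in> Poly_Mapping.keys c" for t
  proof (cases "t \<in> K")
    case True
    have "zlead (const (Poly_Mapping.lookup c t) * basis_elt t) (0 + t) (Poly_Mapping.lookup c t * 1)"
      using zlead_basis_elt[of t] t c(1) by (intro zlead_mult) (auto simp: const_def)
    then show ?thesis
      using True by (simp add: zlead_def K_def)
  next
    case False
    then have "zdeg t < int d"
      using deg[OF t] t by (simp add: K_def)
    then show ?thesis
      using basis_elt_low[of t] t c(1) False by (auto simp: const_def mult_single zlow_single)
  qed
  ultimately show ?thesis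
    by (metis (no_types, lifting) zlow_sum)
qed

text \<open>The terms of \<open>z\<close>-degree \<open>d\<close> in \<open>\<phi> M \<cdot> \<phi> x = \<phi> P\<close>: on the right the single term \<open>c z^d\<close>, on the left
\<open>\<phi> M\<close> times the terms \<open>T\<close> of \<open>\<phi> x\<close> of that degree.\<close>

lemma phi_M_divides:
  "\<exists>T c. c \<noteq> 0 \<and> Poly_Mapping.keys T \<subseteq> cone \<inter> {t. zdeg t = int d} \<and>
     \<phi> M * T = Poly_Mapping.single (Expo (int d) (\<lambda>_. 0)) c"
proof -
  obtain c where c: "c \<noteq> 0" "zlead (\<phi> P) (Expo (int d) (\<lambda>_. 0)) c"
    using zlead_phi_P by blast
  obtain T where T: "Poly_Mapping.keys T \<subseteq> cone \<inter> {t. zdeg t = int d}" "\<phi> X - T \<in> zlow (int d)"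
    using phi_X_top by blast
  have M0: "\<phi> M \<in> A0"
    by (rule phi_A0[OF A0_gens(4)])
  let ?S = "Poly_Mapping.single (Expo (int d) (\<lambda>_. 0)) c :: ('n, 'a) laurent"
  have "\<phi> X * \<phi> M = \<phi> P"
    by (simp flip: X_mult_M phi_mult)
  then have eq: "\<phi> M * T - ?S = (\<phi> P - ?S) - (\<phi> X - T) * \<phi> M"
    by (simp add: algebra_simps)
  moreover have "(\<phi> X - T) * \<phi> M \<in> zlow (int d)"
    using zlow_mult[OF T(2), of "\<phi> M" 0] M0 by (simp add: A0_def)
  moreover have "\<phi> P - ?S \<in> zlow (int d)"
    using c(2) by (simp add: zlead_def)
  ultimately have low: "\<phi> M * T - ?S \<in> zlow (int d)"
    by (simp only: zlow_diff)
  have "zdeg t = int d" if t: "t \<in> Poly_Mapping.keys (\<phi> M * T - ?S)" for t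
  proof -
    have "t \<in> Poly_Mapping.keys (\<phi> M * T) \<or> t = Expo (int d) (\<lambda>_. 0)"
      using t by (auto simp: in_keys_iff lookup_minus lookup_single when_def split: if_splits)
    then show ?thesis
    proof
      assume "t \<in> Poly_Mapping.keys (\<phi> M * T)"
      then obtain u v where "t = u + v" "u \<in> Poly_Mapping.keys (\<phi> M)" "v \<in> Poly_Mapping.keys T"
        using keys_mult[of "\<phi> M" T] by blast
      then show ?thesis
        using A0_keys(1)[OF M0, of u] T(1) by auto
    qed simp
  qed
  then have "Poly_Mapping.keys (\<phi> M * T - ?S) = {}"
    using low by (fastforce simp: zlow_def)
  then have "\<phi> M * T - ?S = 0"
    using keys_nonempty by blast
  then have "\<phi> M * T = ?S"
    by simp
  then show ?thesis
    using c T by blast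
qed

text \<open>Each \<open>\<phi> y\<^sub>i\<close> divides \<open>\<phi> M\<close>, hence a monomial. In the factorization of that monomial the cofactor \<open>T\<close>
has \<open>y\<^sub>l\<close>-degree at least \<open>- k\<^sub>l\<close>, which bounds the exponents of \<open>\<phi> M\<close>.\<close>

lemma phi_Y_monomials:
  obtains \<mu> c where "\<And>i. c i \<noteq> 0" "\<And>i. \<phi> (Y i) = Poly_Mapping.single (\<mu> i) (c i)"
    "\<And>i. zdeg (\<mu> i) = 0" "\<And>i l. ydeg (\<mu> i) l \<ge> 0"
    "\<And>l. (\<Sum>j\<in>UNIV. int (k j) * ydeg (\<mu> j) l) \<le> int (k l)"
proof -
  obtain T c where T: "c \<noteq> 0" "Poly_Mapping.keys T \<subseteq> cone \<inter> {t. zdeg t = int d}"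
    "\<phi> M * T = Poly_Mapping.single (Expo (int d) (\<lambda>_. 0)) c"
    using phi_M_divides by blast
  have phiM: "\<phi> M = (\<Prod>i\<in>UNIV. \<phi> (Y i) ^ k i)"
    by (simp add: M_eq phi_prod phi_power)
  have "\<exists>u c'. \<phi> (Y i) = Poly_Mapping.single u c' \<and> c' \<noteq> 0" for i
  proof -
    have "\<phi> (Y i) ^ k i = \<phi> (Y i) * \<phi> (Y i) ^ (k i - 1)"
      using power_minus_mult[of "k i" "\<phi> (Y i)"] k2[of i] by (simp add: mult.commute)
    then have "\<phi> M = \<phi> (Y i) * (\<phi> (Y i) ^ (k i - 1) * (\<Prod>i\<in>UNIV - {i}. \<phi> (Y i) ^ k i))"
      unfolding phiM by (subst prod.remove[of _ i]) (simp_all add: mult.assoc)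
    then have "\<phi> (Y i) * (\<phi> (Y i) ^ (k i - 1) * (\<Prod>i\<in>UNIV - {i}. \<phi> (Y i) ^ k i) * T) =
        Poly_Mapping.single (Expo (int d) (\<lambda>_. 0)) c"
      using T(3) by (simp only: mult.assoc)
    then show ?thesis
      by (rule factor_of_monomial[OF _ T(1)]) blast
  qed
  then obtain \<mu> c' where \<mu>: "\<phi> (Y i) = Poly_Mapping.single (\<mu> i) (c' i)" "c' i \<noteq> 0" for i
    by metis
  have pos: "zdeg (\<mu> i) = 0" "ydeg (\<mu> i) l \<ge> 0" for i l
    using A0_keys[OF phi_A0[OF A0_gens(1)], of "\<mu> i" i] \<mu>[of i] by simp_all
  obtain v b where v: "T = Poly_Mapping.single v b" "b \<noteq> 0"
    using factor_of_monomial[of T "\<phi> M", OF _ T(1)] T(3) by (metis mult.commute)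
  have "Poly_Mapping.single (\<mu> i) (c' i) ^ n = Poly_Mapping.single (nmult n (\<mu> i)) (c' i ^ n)" for i n
    by (induction n) (simp_all add: mult_single)
  moreover have "(\<Prod>i\<in>I. Poly_Mapping.single (f i) (g i :: 'a)) = Poly_Mapping.single (\<Sum>i\<in>I. f i :: 'n expo) (\<Prod>i\<in>I. g i)"
    for I :: "'n set" and f g by (induction I rule: infinite_finite_induct) (simp_all add: mult_single)
  ultimately have "\<phi> M = Poly_Mapping.single (\<Sum>i\<in>UNIV. nmult (k i) (\<mu> i)) (\<Prod>i\<in>UNIV. c' i ^ k i)"
    unfolding phiM \<mu>(1) by simp
  then have "Poly_Mapping.single ((\<Sum>i\<in>UNIV. nmult (k i) (\<mu> i)) + v) ((\<Prod>i\<in>UNIV. c' i ^ k i) * b) =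
      Poly_Mapping.single (Expo (int d) (\<lambda>_. 0)) c"
    using T(3) v by (simp add: mult_single)
  then have "lm (Poly_Mapping.single ((\<Sum>i\<in>UNIV. nmult (k i) (\<mu> i)) + v) ((\<Prod>i\<in>UNIV. c' i ^ k i) * b)) =
      lm (Poly_Mapping.single (Expo (int d) (\<lambda>_. 0 :: int)) c)"
    by (rule arg_cong)
  then have sum: "(\<Sum>i\<in>UNIV. nmult (k i) (\<mu> i)) + v = Expo (int d) (\<lambda>_. 0)"
    using T(1) v(2) \<mu>(2) by simp
  have "v \<in> cone" "zdeg v = int d"
    using T(2) v by simp_all
  then have v_ge: "ydeg v l + int (k l) \<ge> 0" for l
    using d2 by (auto simp: cone_def)
  have v_eq: "(\<Sum>j\<in>UNIV. int (k j) * ydeg (\<mu> j) l) + ydeg v l = 0" for l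
    using arg_cong[OF sum, of "\<lambda>t. ydeg t l"] by simp
  have le: "(\<Sum>j\<in>UNIV. int (k j) * ydeg (\<mu> j) l) \<le> int (k l)" for l
    using v_ge[of l] v_eq[of l] by linarith
  show ?thesis
    using \<mu>(2,1) pos le by (rule that)
qed

text \<open>The exponent matrices of \<open>\<phi>\<close> and \<open>\<psi>\<close> on the \<open>y\<^sub>i\<close> have natural entries and are inverse to each
other, so they are permutation matrices. The bound on the exponents of \<open>\<phi> M\<close> reads \<open>k i \<le> k (\<sigma> i)\<close>, and a
permutation that never decreases \<open>k\<close> preserves it.\<close>

lemma phi_Y:
  "\<exists>\<sigma> c. bij \<sigma> \<and> (\<forall>i. k (\<sigma> i) = k i) \<and> (\<forall>i. c i \<noteq> 0 \<and> \<phi> (Y i) = Poly_Mapping.single (yexp (\<sigma> i)) (c i))"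
proof -
  interpret inv: A_auto k d q \<psi> \<phi> by (rule swap)
  obtain \<mu> c where \<mu>: "\<And>i. c i \<noteq> 0" "\<And>i. \<phi> (Y i) = Poly_Mapping.single (\<mu> i) (c i)" "\<And>i. zdeg (\<mu> i) = 0"
     "\<And>i l. ydeg (\<mu> i) l \<ge> 0" "\<And>l. (\<Sum>j\<in>UNIV. int (k j) * ydeg (\<mu> j) l) \<le> int (k l)"
    by (rule phi_Y_monomials) (rule that)
  obtain \<nu> b where \<nu>: "\<And>i. b i \<noteq> 0" "\<And>i. \<psi> (Y i) = Poly_Mapping.single (\<nu> i) (b i)" "\<And>i. zdeg (\<nu> i) = 0"
     "\<And>i l. ydeg (\<nu> i) l \<ge> 0"
    by (rule inv.phi_Y_monomials) (rule that)
  have single_pow: "Poly_Mapping.single (\<mu> i) (c i) ^ n = Poly_Mapping.single (nmult n (\<mu> i)) (c i ^ n)" for i n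
    by (induction n) (simp_all add: mult_single)
  have single_prod: "(\<Prod>i\<in>I. Poly_Mapping.single (f i) (g i :: 'a)) = Poly_Mapping.single (\<Sum>i\<in>I. f i :: 'n expo) (\<Prod>i\<in>I. g i)"
    for I :: "'n set" and f g by (induction I rule: infinite_finite_induct) (simp_all add: mult_single)
  have "\<exists>j. \<mu> j = yexp i" for i
  proof -
    have "Y i = \<phi> (\<psi> (Y i))"
      by simp
    also have "\<dots> = const (b i) * (\<Prod>j\<in>UNIV. \<phi> (Y j) ^ nat (ydeg (\<nu> i) j))"
      unfolding \<nu>(2) single_in_A0(1)[OF \<nu>(3,4)] by (simp add: phi_mult phi_prod phi_power A_prod)
    also have "\<dots> = Poly_Mapping.single (\<Sum>j\<in>UNIV. nmult (nat (ydeg (\<nu> i) j)) (\<mu> j))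
        (b i * (\<Prod>j\<in>UNIV. c j ^ nat (ydeg (\<nu> i) j)))"
      by (simp add: \<mu>(2) single_pow single_prod const_def mult_single)
    finally have "lm (Y i) = lm (Poly_Mapping.single (\<Sum>j\<in>UNIV. nmult (nat (ydeg (\<nu> i) j)) (\<mu> j))
        (b i * (\<Prod>j\<in>UNIV. c j ^ nat (ydeg (\<nu> i) j))))"
      by simp
    then have e: "yexp i = (\<Sum>j\<in>UNIV. nmult (nat (ydeg (\<nu> i) j)) (\<mu> j))"
      using \<nu>(1) \<mu>(1) by (simp add: Y_def)
    have el: "(if l = i then 1 else 0) = (\<Sum>j\<in>UNIV. ydeg (\<nu> i) j * ydeg (\<mu> j) l)" for l
      using arg_cong[OF e, of "\<lambda>t. ydeg t l"] \<nu>(4) by simp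
    obtain j where j: "ydeg (\<nu> i) j * ydeg (\<mu> j) i \<noteq> 0"
      using el[of i] by (metis (no_types, lifting) sum.neutral zero_neq_one)
    then have j1: "ydeg (\<nu> i) j \<ge> 1"
      using \<nu>(4)[of i j] by (cases "ydeg (\<nu> i) j = 0") auto
    have le: "ydeg (\<mu> j) l \<le> (if l = i then 1 else 0)" for l
    proof -
      have "ydeg (\<mu> j) l \<le> ydeg (\<nu> i) j * ydeg (\<mu> j) l"
        using mult_right_mono[OF j1 \<mu>(4)[of j l]] by simp
      also have "\<dots> \<le> (\<Sum>j\<in>UNIV. ydeg (\<nu> i) j * ydeg (\<mu> j) l)"
        by (rule member_le_sum) (use \<mu>(4) \<nu>(4) in simp_all)
      finally show ?thesis
        by (simp add: el)
    qed
    have "ydeg (\<mu> j) l = (if l = i then 1 else 0)" for l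
      using le[of l] \<mu>(4)[of j l] j by (cases "l = i") (auto simp: order_antisym)
    then show ?thesis
      using \<mu>(3) by (intro exI[of _ j] expo_eqI) simp_all
  qed
  then obtain \<tau> where \<tau>: "\<mu> (\<tau> i) = yexp i" for i
    by metis
  have yexp_inj: "i = j" if "yexp i = yexp j" for i j
    using arg_cong[OF that, of "\<lambda>t. ydeg t i"] by (simp split: if_splits)
  have "inj \<tau>"
    by (rule injI) (metis \<tau> yexp_inj)
  then have "bij \<tau>"
    by (simp add: bij_def finite_UNIV_inj_surj)
  define \<sigma> where "\<sigma> = inv_into UNIV \<tau>"
  have bij: "bij \<sigma>"
    using \<open>bij \<tau>\<close> by (simp add: \<sigma>_def bij_imp_bij_inv)
  have \<mu>\<sigma>: "\<mu> i = yexp (\<sigma> i)" for i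
    using \<tau>[of "\<sigma> i"] \<open>bij \<tau>\<close> by (simp add: \<sigma>_def bij_is_surj surj_f_inv_f)
  have le: "k i \<le> k (\<sigma> i)" for i
  proof -
    have "int (k i) * ydeg (\<mu> i) (\<sigma> i) \<le> (\<Sum>j\<in>UNIV. int (k j) * ydeg (\<mu> j) (\<sigma> i))"
      by (rule member_le_sum) (use \<mu>(4) in simp_all)
    then have "int (k i) \<le> (\<Sum>j\<in>UNIV. int (k j) * ydeg (\<mu> j) (\<sigma> i))"
      by (simp add: \<mu>\<sigma>)
    then show ?thesis
      using \<mu>(5)[of "\<sigma> i"] by linarith
  qed
  have "k (\<sigma> i) = k i" for i
  proof (rule ccontr)
    assume "k (\<sigma> i) \<noteq> k i"
    then have "k i < k (\<sigma> i)"
      using le[of i] by linarith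
    then have "(\<Sum>i\<in>UNIV. k i) < (\<Sum>i\<in>UNIV. k (\<sigma> i))"
      using le by (intro sum_strict_mono_ex1) auto
    moreover have "(\<Sum>i\<in>UNIV. k (\<sigma> i)) = (\<Sum>i\<in>UNIV. k i)"
      using sum.reindex_bij_betw[OF bij, of k] by simp
    ultimately show False
      by simp
  qed
  then show ?thesis
    using bij \<mu>(1,2) unfolding \<mu>\<sigma> by (intro exI[of _ \<sigma>] exI[of _ c]) blast
qed

end

section \<open>Solvability and permutations of four letters\<close>

lemma (in group) solvable_by_chain:
  assumes T0: "T 0 = carrier G" and Tn: "T n = {\<one>}"
    and sub: "\<And>j. subgroup (T j) G"
    and comm: "\<And>j x y. j < n \<Longrightarrow> x \<in> T j \<Longrightarrow> y \<in> T j \<Longrightarrow> x \<otimes> y \<otimes> inv x \<otimes> inv y \<in> T (Suc j)"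
  shows "solvable G"
proof -
  have "(derived G ^^ j) (carrier G) \<subseteq> T j" if "j \<le> n" for j
    using that
  proof (induction j)
    case (Suc j)
    have "derived G (T j) \<subseteq> T (Suc j)"
      unfolding derived_def using comm[of j] Suc.prems by (intro generate_subgroup_incl sub) auto
    then show ?case
      using Suc mono_derived[of "(derived G ^^ j) (carrier G)" "T j"] by auto
  qed (simp add: T0)
  then have "(derived G ^^ n) (carrier G) \<subseteq> {\<one>}"
    using Tn by blast
  moreover have "\<one> \<in> (derived G ^^ n) (carrier G)"
    using subgroup.one_closed[OF exp_of_derived_is_subgroup[OF subgroup_self]] .
  ultimately show ?thesis
    using solvable_iff_trivial_derived_seq by blast
qed

datatype four = F0 | F1 | F2 | F3

lemma UNIV_four: "(UNIV :: four set) = {F0, F1, F2, F3}"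
  using four.exhaust by blast

text \<open>The four values of a permutation, so that statements about the finite group can be decided by
rewriting.\<close>

datatype perm4 = Perm four four four four

fun app :: "perm4 \<Rightarrow> four \<Rightarrow> four" where
  "app (Perm a b c d) F0 = a" | "app (Perm a b c d) F1 = b"
| "app (Perm a b c d) F2 = c" | "app (Perm a b c d) F3 = d"

fun pcomp :: "perm4 \<Rightarrow> perm4 \<Rightarrow> perm4" where
  "pcomp p (Perm a b c d) = Perm (app p a) (app p b) (app p c) (app p d)"

definition pid :: perm4 where "pid = Perm F0 F1 F2 F3"

definition perm_of_fun :: "(four \<Rightarrow> four) \<Rightarrow> perm4" where
  "perm_of_fun p = Perm (p F0) (p F1) (p F2) (p F3)"

lemma app_perm_of_fun [simp]: "app (perm_of_fun p) x = p x"
  by (cases x) (simp_all add: perm_of_fun_def)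

lemma perm_of_fun_comp: "perm_of_fun (p \<circ> p') = pcomp (perm_of_fun p) (perm_of_fun p')"
  by (subst (1 3) perm_of_fun_def) simp

definition sym4 :: "perm4 list" where
  "sym4 = [Perm a b c d. a \<leftarrow> [F0, F1, F2, F3], b \<leftarrow> [F0, F1, F2, F3], c \<leftarrow> [F0, F1, F2, F3],
     d \<leftarrow> [F0, F1, F2, F3], distinct [a, b, c, d]]"

definition alt4 :: "perm4 list" where
  "alt4 = [Perm F0 F1 F2 F3, Perm F0 F2 F3 F1, Perm F0 F3 F1 F2, Perm F1 F0 F3 F2,
     Perm F1 F2 F0 F3, Perm F1 F3 F2 F0, Perm F2 F0 F1 F3, Perm F2 F1 F3 F0,
     Perm F2 F3 F0 F1, Perm F3 F0 F2 F1, Perm F3 F1 F0 F2, Perm F3 F2 F1 F0]"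

definition klein4 :: "perm4 list" where
  "klein4 = [Perm F0 F1 F2 F3, Perm F1 F0 F3 F2, Perm F2 F3 F0 F1, Perm F3 F2 F1 F0]"

definition pinv :: "perm4 \<Rightarrow> perm4" where
  "pinv p = (let g = (\<lambda>x. if app p F0 = x then F0 else if app p F1 = x then F1 else if app p F2 = x then F2 else F3)
     in Perm (g F0) (g F1) (g F2) (g F3))"

definition pcommutator :: "perm4 \<Rightarrow> perm4 \<Rightarrow> perm4" where
  "pcommutator p r = pcomp (pcomp (pcomp p r) (pinv p)) (pinv r)"

fun layer4 :: "nat \<Rightarrow> perm4 list" where
  "layer4 0 = sym4" | "layer4 (Suc 0) = alt4" | "layer4 (Suc (Suc 0)) = klein4" | "layer4 _ = [pid]"

lemma in_sym4: "distinct [a, b, c, e] \<Longrightarrow> Perm a b c e \<in> set sym4"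
  unfolding sym4_def by (cases a; cases b; cases c; cases e; simp)

lemma perm_of_fun_in_sym4: "inj p \<Longrightarrow> perm_of_fun p \<in> set sym4"
  unfolding perm_of_fun_def by (rule in_sym4) (auto dest: injD)

text \<open>The symmetric group on four letters has derived length three; checked over all pairs.\<close>

lemma sym4_checks:
  "list_all (\<lambda>p. list_all (\<lambda>r. pcommutator p r \<in> set alt4) sym4) sym4"
  by code_simp

lemma sym4_inv: "list_all (\<lambda>p. list_all (\<lambda>r. pcomp p r = pid \<longrightarrow> r = pinv p) sym4) sym4"
  by code_simp

lemma alt4_checks: "list_all (\<lambda>p. pinv p \<in> set alt4 \<and> list_all (\<lambda>r. pcomp p r \<in> set alt4 \<and> pcommutator p r \<in> set klein4) alt4) alt4"
  by code_simp

lemma klein4_checks: "list_all (\<lambda>p. pinv p \<in> set klein4 \<and> list_all (\<lambda>r. pcomp p r \<in> set klein4 \<and> pcommutator p r = pid) klein4) klein4"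
  by code_simp

section \<open>From automorphisms of the variety to automorphisms of its ring\<close>

lemma (in A_auto) phi_X_fixed:
  assumes Y: "\<And>i. \<phi> (Y i) = Y i" and Z: "\<phi> Z = Z"
  shows "\<phi> X = X"
proof -
  have yp: "\<phi> (mpoly_subst Y p) = mpoly_subst Y p" for p
    by (induction p rule: mpoly_induct) (simp_all add: Y phi_add phi_mult)
  have "\<phi> P = P"
    by (simp add: P_def phi_add phi_sum phi_mult phi_power A_sum yp Z)
  moreover have "\<phi> M = M"
    by (simp add: M_eq phi_prod phi_power Y)
  ultimately have "\<phi> X * M = X * M"
    using phi_mult[of X M] by (simp add: X_mult_M)
  then show ?thesis
    using M_nonzero by auto
qed

lemma const_mult_single: "const c * Poly_Mapping.single t 1 = Poly_Mapping.single t c"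
  for t :: "'g::monoid_add" and c :: "'b::comm_semiring_1"
  by (simp add: const_def mult_single)

context danielewski
begin

text \<open>Composition with \<open>f\<close>, transported to \<open>A\<close>. The choice is immaterial for regular \<open>f\<close>, since elements of
\<open>A\<close> correspond to functions on the variety.\<close>

definition pull :: "(('n coord \<Rightarrow> 'a) \<Rightarrow> ('n coord \<Rightarrow> 'a)) \<Rightarrow> ('n, 'a) laurent \<Rightarrow> ('n, 'a) laurent" where
  "pull f a = Phi (SOME p'. \<exists>p. a = Phi p \<and> (\<forall>u\<in>V. mpoly_eval p' u = mpoly_eval p (f u)))"

lemma pull_eq:
  assumes f: "f \<in> V \<rightarrow> V" and p': "\<And>u. u \<in> V \<Longrightarrow> mpoly_eval p' u = mpoly_eval p (f u)"
  shows "pull f (Phi p) = Phi p'"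
proof -
  define r where "r = (SOME p'. \<exists>p0. Phi p = Phi p0 \<and> (\<forall>u\<in>V. mpoly_eval p' u = mpoly_eval p0 (f u)))"
  have "\<exists>p0. Phi p = Phi p0 \<and> (\<forall>u\<in>V. mpoly_eval r u = mpoly_eval p0 (f u))"
    unfolding r_def by (rule someI[of _ p']) (use p' in blast)
  then obtain p0 where p0: "Phi p = Phi p0" "\<And>u. u \<in> V \<Longrightarrow> mpoly_eval r u = mpoly_eval p0 (f u)"
    by blast
  have "mpoly_eval r u = mpoly_eval p' u" if "u \<in> V" for u
    using p0(2)[OF that] p'[OF that] Phi_eqD[OF p0(1) funcset_mem[OF f that]] by simp
  then have "Phi r = Phi p'"
    by (rule Phi_eqI)
  then show ?thesis
    by (simp add: pull_def r_def)
qed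

lemma pull_poly:
  assumes "regular_map V V f"
  obtains p' where "\<And>u. u \<in> V \<Longrightarrow> mpoly_eval p' u = mpoly_eval p (f u)" "pull f (Phi p) = Phi p'"
proof -
  have f: "f \<in> V \<rightarrow> V"
    using assms by (simp add: regular_map_def)
  have "regular_map V UNIV (\<lambda>u (_::unit). mpoly_eval p u)"
    by (auto simp: regular_map_def)
  then have "regular_map V UNIV (compose V (\<lambda>u (_::unit). mpoly_eval p u) f)"
    by (rule regular_map_compose[OF assms])
  then obtain p' where "\<forall>u\<in>V. compose V (\<lambda>u (_::unit). mpoly_eval p u) f u () = mpoly_eval p' u"
    unfolding regular_map_def by blast
  then have "mpoly_eval p' u = mpoly_eval p (f u)" if "u \<in> V" for u
    using that by (simp add: compose_eq)
  then show ?thesis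
    using that[of p'] pull_eq[OF f, of p' p] by blast
qed

lemma A_auto_pull:
  assumes f: "regular_map V V f" and g: "regular_map V V g"
    and gf: "\<And>u. u \<in> V \<Longrightarrow> g (f u) = u" and fg: "\<And>u. u \<in> V \<Longrightarrow> f (g u) = u"
  shows "A_auto k d q (pull f) (pull g)"
proof
  have fV: "f \<in> V \<rightarrow> V" and gV: "g \<in> V \<rightarrow> V"
    using f g by (simp_all add: regular_map_def)
  have inverse: "pull h (pull h' a) = a"
    if h: "regular_map V V h" "regular_map V V h'" "\<And>u. u \<in> V \<Longrightarrow> h' (h u) = u" and a: "a \<in> A" for h h' a
  proof -
    have hV: "h \<in> V \<rightarrow> V"
      using h by (simp add: regular_map_def)
    obtain p where p: "a = Phi p"
      using a by (auto simp: A_def)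
    obtain p' where p': "\<And>u. u \<in> V \<Longrightarrow> mpoly_eval p' u = mpoly_eval p (h' u)" "pull h' (Phi p) = Phi p'"
      using pull_poly[OF h(2)] by metis
    have "mpoly_eval p u = mpoly_eval p' (h u)" if "u \<in> V" for u
      using p'(1)[OF funcset_mem[OF hV that]] h(3)[OF that] by simp
    then show ?thesis
      using pull_eq[OF hV, of p p'] p p'(2) by simp
  qed
  have closed: "pull h a \<in> A" if h: "regular_map V V h" and a: "a \<in> A" for h a
  proof -
    obtain p where p: "a = Phi p"
      using a by (auto simp: A_def)
    obtain p' where "pull h (Phi p) = Phi p'"
      by (rule pull_poly[OF h])
    then show ?thesis
      by (simp add: p A_def)
  qed
  fix a b c
  show "pull f (const c) = const c"
    using pull_eq[OF fV, of "const c" "const c"] by simp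
  assume a: "a \<in> A"
  show "pull f a \<in> A" "pull g a \<in> A"
    using closed f g a by auto
  show "pull f (pull g a) = a" "pull g (pull f a) = a"
    using inverse f g gf fg a by auto
  assume b: "b \<in> A"
  obtain p r where pr: "a = Phi p" "b = Phi r"
    using a b by (auto simp: A_def)
  obtain p' r' where p': "\<And>u. u \<in> V \<Longrightarrow> mpoly_eval p' u = mpoly_eval p (f u)" "pull f (Phi p) = Phi p'"
    and r': "\<And>u. u \<in> V \<Longrightarrow> mpoly_eval r' u = mpoly_eval r (f u)" "pull f (Phi r) = Phi r'"
    using pull_poly[OF f] by metis
  show "pull f (a + b) = pull f a + pull f b"
    using pull_eq[OF fV, of "p' + r'" "p + r"] p' r' by (simp add: pr)
  show "pull f (a * b) = pull f a * pull f b"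
    using pull_eq[OF fV, of "p' * r'" "p * r"] p' r' by (simp add: pr)
qed

definition autos :: "(('n coord \<Rightarrow> 'a) \<Rightarrow> ('n coord \<Rightarrow> 'a)) set" where
  "autos = carrier (Aut V)"

lemma auto_pull:
  assumes "f \<in> autos"
  shows "A_auto k d q (pull f) (pull (inv_into V f))" "regular_map V V f"
proof -
  have f: "f \<in> Bij V" "regular_map V V f" "regular_map V V (inv_into V f)"
    using assms by (simp_all add: autos_def Aut_def variety_automorphisms_def)
  then have "bij_betw f V V"
    by (simp add: Bij_def)
  then show "A_auto k d q (pull f) (pull (inv_into V f))"
    by (intro A_auto_pull f) (auto simp: bij_betw_def f_inv_into_f)
  show "regular_map V V f"
    by (rule f)
qed

lemma pull_gen:
  assumes "f \<in> autos" "pull f (gen v) = Phi p" "u \<in> V"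
  shows "f u v = mpoly_eval p u"
proof -
  obtain p' where p': "\<And>u. u \<in> V \<Longrightarrow> mpoly_eval p' u = mpoly_eval (var v) (f u)" "pull f (Phi (var v)) = Phi p'"
    using pull_poly[OF auto_pull(2)[OF assms(1)]] by metis
  then show ?thesis
    using Phi_eqD[of p' p u] assms by simp
qed

definition ymap :: "('n coord \<Rightarrow> 'a) \<Rightarrow> 'n \<Rightarrow> 'a" where
  "ymap u = (\<lambda>i. u (coord_y i))"

lemma A0_Phi:
  assumes "b \<in> A0"
  obtains p h where "b = Phi p" "\<And>u. mpoly_eval p u = h (ymap u)"
proof -
  define p where "p = (\<Sum>t\<in>Poly_Mapping.keys b. const (Poly_Mapping.lookup b t) * (\<Prod>i\<in>UNIV. var (coord_y i) ^ nat (ydeg t i)))"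
  define h where "h y = (\<Sum>t\<in>Poly_Mapping.keys b. Poly_Mapping.lookup b t * (\<Prod>i\<in>UNIV. y i ^ nat (ydeg t i)))" for y :: "'n \<Rightarrow> 'a"
  have "b = (\<Sum>t\<in>Poly_Mapping.keys b. Poly_Mapping.single t (Poly_Mapping.lookup b t))"
    by (rule poly_mapping_sum_singles)
  also have "\<dots> = Phi p"
    unfolding p_def Phi_simps
    by (rule sum.cong) (simp_all add: single_in_A0(1)[OF A0_keys[OF assms]])
  finally show ?thesis
    using that[of p h] by (simp add: p_def h_def ymap_def)
qed

text \<open>The structure of ring automorphisms, read as formulas for the coordinates of a point.\<close>

lemma auto_form:
  assumes f: "f \<in> autos"
  obtains \<sigma> c a h where "bij \<sigma>" "\<And>i. k (\<sigma> i) = k i" "\<And>i. c i \<noteq> 0" "a \<noteq> 0"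
    "\<And>u i. u \<in> V \<Longrightarrow> f u (coord_y i) = c i * u (coord_y (\<sigma> i))"
    "\<And>u. u \<in> V \<Longrightarrow> f u coord_z = a * u coord_z + h (ymap u)"
proof -
  interpret A_auto k d q "pull f" "pull (inv_into V f)"
    by (rule auto_pull[OF f])
  obtain \<sigma> c where \<sigma>: "bij \<sigma>" "\<And>i. k (\<sigma> i) = k i" "\<And>i. c i \<noteq> 0"
    "\<And>i. pull f (Y i) = Poly_Mapping.single (yexp (\<sigma> i)) (c i)"
    using phi_Y by blast
  obtain a b where ab: "a \<noteq> 0" "b \<in> A0" "pull f Z = const a * Z + b"
    using phi_Z by blast
  obtain p h where p: "b = Phi p" "\<And>u. mpoly_eval p u = h (ymap u)"
    using A0_Phi[OF ab(2)] by blast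
  have "f u (coord_y i) = c i * u (coord_y (\<sigma> i))" if "u \<in> V" for u i
  proof -
    have "Phi (const (c i) * var (coord_y (\<sigma> i))) = Poly_Mapping.single (yexp (\<sigma> i)) (c i)"
      by (simp add: Y_def const_mult_single)
    then have "pull f (gen (coord_y i)) = Phi (const (c i) * var (coord_y (\<sigma> i)))"
      by (simp only: gen.simps \<sigma>(4))
    from pull_gen[OF f this that] show ?thesis
      by simp
  qed
  moreover have "f u coord_z = a * u coord_z + h (ymap u)" if "u \<in> V" for u
  proof -
    have "pull f (gen coord_z) = Phi (const a * var coord_z + p)"
      by (simp add: ab(3) p(1))
    from pull_gen[OF f this that] show ?thesis
      by (simp add: p(2))
  qed
  ultimately show ?thesis
    using that \<sigma>(1,2,3) ab(1) by blast
qed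

lemma Phi_eq_const_Y:
  assumes "\<And>u. u \<in> V \<Longrightarrow> c * u (coord_y i) = c' * u (coord_y j)" "c \<noteq> 0"
  shows "i = j"
proof -
  have "Phi (const c * var (coord_y i)) = Phi (const c' * var (coord_y j))"
    by (rule Phi_eqI) (simp add: assms(1))
  then have "Poly_Mapping.single (yexp i) c = Poly_Mapping.single (yexp j) c'"
    by (simp add: Y_def const_mult_single)
  then have "yexp i = yexp j"
    using assms(2) by (metis lookup_single_eq lookup_single_not_eq)
  from arg_cong[OF this, of "\<lambda>t. ydeg t i"] show ?thesis
    by (simp split: if_splits)
qed

text \<open>The coordinate \<open>x\<close> is determined by the others as an element of the ring, hence also at the points with
\<open>M = 0\<close>.\<close>

lemma auto_eq_one:
  assumes f: "f \<in> autos" and y: "\<And>u i. u \<in> V \<Longrightarrow> f u (coord_y i) = u (coord_y i)"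
    and z: "\<And>u. u \<in> V \<Longrightarrow> f u coord_z = u coord_z"
  shows "f = (\<lambda>u\<in>V. u)"
proof -
  interpret A_auto k d q "pull f" "pull (inv_into V f)"
    by (rule auto_pull[OF f])
  have fV: "f \<in> V \<rightarrow> V"
    using auto_pull(2)[OF f] by (simp add: regular_map_def)
  have "pull f (Y i) = Y i" for i
    using pull_eq[OF fV, of "var (coord_y i)" "var (coord_y i)"] y by simp
  moreover have "pull f Z = Z"
    using pull_eq[OF fV, of "var coord_z" "var coord_z"] z by simp
  ultimately have "pull f (gen coord_x) = Phi (var coord_x)"
    using phi_X_fixed by simp
  from pull_gen[OF f this] have x: "f u coord_x = u coord_x" if "u \<in> V" for u
    using that by simp
  have "f u v = u v" if "u \<in> V" for u v
    by (cases v) (simp_all add: x y z that)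
  moreover have "f \<in> extensional V"
    using f by (simp add: autos_def Aut_def variety_automorphisms_def Bij_def)
  ultimately show ?thesis
    by (auto simp: extensional_def fun_eq_iff restrict_def)
qed

section \<open>A chain of subgroups with abelian steps\<close>

lemma group_V: "group (Aut V)"
  by (rule group_Aut)

lemma autos_Bij: "f \<in> autos \<Longrightarrow> f \<in> Bij V"
  by (simp add: autos_def Aut_def variety_automorphisms_def)

lemma autos_mem: "f \<in> autos \<Longrightarrow> u \<in> V \<Longrightarrow> f u \<in> V"
  using autos_Bij[of f] by (auto simp: Bij_def bij_betw_def)

lemma mult_apply: "f \<in> autos \<Longrightarrow> g \<in> autos \<Longrightarrow> u \<in> V \<Longrightarrow> (f \<otimes>\<^bsub>Aut V\<^esub> g) u = f (g u)"
  using autos_Bij[of f] autos_Bij[of g] by (simp add: Aut_def BijGroup_def compose_eq)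

lemma one_eq: "\<one>\<^bsub>Aut V\<^esub> = (\<lambda>u\<in>V. u)"
  by (simp add: Aut_def BijGroup_def)

lemma autos_closed:
  "f \<in> autos \<Longrightarrow> g \<in> autos \<Longrightarrow> f \<otimes>\<^bsub>Aut V\<^esub> g \<in> autos" "f \<in> autos \<Longrightarrow> inv\<^bsub>Aut V\<^esub> f \<in> autos"
  "\<one>\<^bsub>Aut V\<^esub> \<in> autos"
  using group_V by (simp_all add: autos_def group.is_monoid monoid.m_closed group.inv_closed monoid.one_closed)

lemma inv_apply:
  assumes "f \<in> autos" "u \<in> V"
  shows "f ((inv\<^bsub>Aut V\<^esub> f) u) = u" "(inv\<^bsub>Aut V\<^esub> f) (f u) = u"
proof -
  have "f \<otimes>\<^bsub>Aut V\<^esub> (inv\<^bsub>Aut V\<^esub> f) = \<one>\<^bsub>Aut V\<^esub>" "(inv\<^bsub>Aut V\<^esub> f) \<otimes>\<^bsub>Aut V\<^esub> f = \<one>\<^bsub>Aut V\<^esub>"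
    using group.r_inv[OF group_V] group.l_inv[OF group_V] assms(1) by (simp_all add: autos_def)
  then show "f ((inv\<^bsub>Aut V\<^esub> f) u) = u" "(inv\<^bsub>Aut V\<^esub> f) (f u) = u"
    using mult_apply[OF assms(1) autos_closed(2)[OF assms(1)] assms(2)]
      mult_apply[OF autos_closed(2)[OF assms(1)] assms(1) assms(2)] assms(2) by (simp_all add: one_eq)
qed

abbreviation commutator where
  "commutator f g \<equiv> f \<otimes>\<^bsub>Aut V\<^esub> g \<otimes>\<^bsub>Aut V\<^esub> inv\<^bsub>Aut V\<^esub> f \<otimes>\<^bsub>Aut V\<^esub> inv\<^bsub>Aut V\<^esub> g"

lemma commutator_in_autos: "f \<in> autos \<Longrightarrow> g \<in> autos \<Longrightarrow> commutator f g \<in> autos"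
  by (simp add: autos_closed)

text \<open>Writing the point as \<open>g (f u)\<close> compares \<open>f g\<close> with \<open>g f\<close> and avoids formulas for inverses.\<close>

lemma commutator_apply:
  assumes "f \<in> autos" "g \<in> autos" "v \<in> V"
  obtains u where "u \<in> V" "v = g (f u)" "commutator f g v = f (g u)"
proof -
  define w where "w = (inv\<^bsub>Aut V\<^esub> g) v"
  define u where "u = (inv\<^bsub>Aut V\<^esub> f) w"
  have fi: "inv\<^bsub>Aut V\<^esub> f \<in> autos" and gi: "inv\<^bsub>Aut V\<^esub> g \<in> autos"
    using assms autos_closed by blast+
  have w: "w \<in> V"
    unfolding w_def using gi assms(3) by (rule autos_mem)
  have u: "u \<in> V"
    unfolding u_def using fi w by (rule autos_mem)
  have gu: "g u \<in> V"
    using assms(2) u by (rule autos_mem)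
  have "v = g (f u)"
    using inv_apply(1)[OF assms(1) w] inv_apply(1)[OF assms(2,3)] by (simp add: u_def w_def)
  moreover have "commutator f g v = f (g u)"
    using mult_apply[OF autos_closed(1)[OF autos_closed(1)[OF assms(1,2)] fi] gi assms(3)]
      mult_apply[OF autos_closed(1)[OF assms(1,2)] fi w] mult_apply[OF assms(1,2) u]
    by (simp add: u_def w_def)
  ultimately show ?thesis
    using that u by blast
qed

lemma subgroup_autosI:
  assumes "\<And>f. f \<in> T \<Longrightarrow> f \<in> autos" "\<one>\<^bsub>Aut V\<^esub> \<in> T"
    "\<And>f g. f \<in> T \<Longrightarrow> g \<in> T \<Longrightarrow> f \<otimes>\<^bsub>Aut V\<^esub> g \<in> T" "\<And>f. f \<in> T \<Longrightarrow> inv\<^bsub>Aut V\<^esub> f \<in> T"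
  shows "subgroup T (Aut V)"
  using assms by (unfold_locales) (auto simp: autos_def)

text \<open>The permutation is indexed such that composition of automorphisms corresponds to composition of
permutations in the same order: the value of \<open>y\<^sub>i\<close> is carried to the coordinate with index \<open>\<pi> i\<close>.\<close>

definition permutes_coords :: "(('n coord \<Rightarrow> 'a) \<Rightarrow> ('n coord \<Rightarrow> 'a)) \<Rightarrow> ('n \<Rightarrow> 'n) \<Rightarrow> bool" where
  "permutes_coords f \<pi> \<longleftrightarrow> bij \<pi> \<and> (\<forall>i. k (\<pi> i) = k i) \<and>
     (\<forall>i. \<exists>c. c \<noteq> 0 \<and> (\<forall>u\<in>V. f u (coord_y (\<pi> i)) = c * u (coord_y i)))"

lemma permutes_coords_exists:
  assumes "f \<in> autos"
  shows "\<exists>\<pi>. permutes_coords f \<pi>"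
proof -
  obtain \<sigma> c where \<sigma>: "bij \<sigma>" "\<And>i. k (\<sigma> i) = k i" "\<And>i. c i \<noteq> 0"
    "\<And>u i. u \<in> V \<Longrightarrow> f u (coord_y i) = c i * u (coord_y (\<sigma> i))"
    using auto_form[OF assms] by metis
  define \<pi> where "\<pi> = inv_into UNIV \<sigma>"
  have \<sigma>\<pi>: "\<sigma> (\<pi> i) = i" for i
    using \<sigma>(1) by (simp add: \<pi>_def bij_is_surj surj_f_inv_f)
  have "bij \<pi>"
    using \<sigma>(1) by (simp add: \<pi>_def bij_imp_bij_inv)
  moreover have "k (\<pi> i) = k i" for i
    using \<sigma>(2)[of "\<pi> i"] \<sigma>\<pi> by simp
  moreover have "f u (coord_y (\<pi> i)) = c (\<pi> i) * u (coord_y i)" if "u \<in> V" for u i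
    using \<sigma>(4)[OF that, of "\<pi> i"] \<sigma>\<pi> by simp
  ultimately show ?thesis
    unfolding permutes_coords_def using \<sigma>(3) by blast
qed

lemma permutes_coords_unique:
  assumes "permutes_coords f \<pi>" "permutes_coords f \<pi>'"
  shows "\<pi> = \<pi>'"
proof
  fix i
  obtain j where j: "\<pi>' i = \<pi> j"
    using assms(1) by (metis bij_pointE permutes_coords_def)
  obtain c where c: "c \<noteq> 0" "\<And>u. u \<in> V \<Longrightarrow> f u (coord_y (\<pi> j)) = c * u (coord_y j)"
    using assms(1) unfolding permutes_coords_def by blast
  obtain c' where c': "\<And>u. u \<in> V \<Longrightarrow> f u (coord_y (\<pi>' i)) = c' * u (coord_y i)"
    using assms(2) unfolding permutes_coords_def by blast
  have "j = i"
    by (rule Phi_eq_const_Y[of c j c' i]) (use c c' j in metis)+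
  then show "\<pi> i = \<pi>' i"
    using j by simp
qed

definition perm_of :: "(('n coord \<Rightarrow> 'a) \<Rightarrow> ('n coord \<Rightarrow> 'a)) \<Rightarrow> ('n \<Rightarrow> 'n)" where
  "perm_of f = (THE \<pi>. permutes_coords f \<pi>)"

lemma perm_of_eqI: "permutes_coords f \<pi> \<Longrightarrow> perm_of f = \<pi>"
  unfolding perm_of_def using permutes_coords_unique by blast

lemma perm_of: "f \<in> autos \<Longrightarrow> permutes_coords f (perm_of f)"
  using permutes_coords_exists perm_of_eqI by metis

lemma perm_of_mult:
  assumes "f \<in> autos" "g \<in> autos"
  shows "perm_of (f \<otimes>\<^bsub>Aut V\<^esub> g) = perm_of f \<circ> perm_of g"
proof (rule perm_of_eqI)
  have f: "permutes_coords f (perm_of f)" and g: "permutes_coords g (perm_of g)"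
    using assms by (simp_all add: perm_of)
  have "\<exists>c. c \<noteq> 0 \<and> (\<forall>u\<in>V. (f \<otimes>\<^bsub>Aut V\<^esub> g) u (coord_y ((perm_of f \<circ> perm_of g) i)) = c * u (coord_y i))" for i
  proof -
    obtain c where c: "c \<noteq> 0" "\<And>u. u \<in> V \<Longrightarrow> f u (coord_y (perm_of f (perm_of g i))) = c * u (coord_y (perm_of g i))"
      using f unfolding permutes_coords_def by blast
    obtain c' where c': "c' \<noteq> 0" "\<And>u. u \<in> V \<Longrightarrow> g u (coord_y (perm_of g i)) = c' * u (coord_y i)"
      using g unfolding permutes_coords_def by blast
    show ?thesis
      using c c' assms by (intro exI[of _ "c * c'"]) (simp add: mult_apply autos_mem)
  qed
  then show "permutes_coords (f \<otimes>\<^bsub>Aut V\<^esub> g) (perm_of f \<circ> perm_of g)"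
    using f g by (simp add: permutes_coords_def bij_comp)
qed

lemma perm_of_one: "perm_of \<one>\<^bsub>Aut V\<^esub> = id"
  by (rule perm_of_eqI) (auto simp: permutes_coords_def one_eq intro!: exI[of _ 1])

lemma perm_of_inv:
  assumes "f \<in> autos"
  shows "perm_of f \<circ> perm_of (inv\<^bsub>Aut V\<^esub> f) = id"
  using perm_of_mult[OF assms autos_closed(2)[OF assms]] group.r_inv[OF group_V] assms
  by (simp add: autos_def perm_of_one)

text \<open>The last three steps of the chain: automorphisms that fix all \<open>y\<^sub>i\<close> act on \<open>z\<close> by affine maps
\<open>z \<mapsto> b z + h(y)\<close>, whose commutators are translations on each fibre.\<close>

definition y_fixing :: "(('n coord \<Rightarrow> 'a) \<Rightarrow> ('n coord \<Rightarrow> 'a)) set" where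
  "y_fixing = {f \<in> autos. \<forall>u\<in>V. ymap (f u) = ymap u}"

definition shears :: "(('n coord \<Rightarrow> 'a) \<Rightarrow> ('n coord \<Rightarrow> 'a)) set" where
  "shears = {f \<in> y_fixing. \<exists>h. \<forall>u\<in>V. f u coord_z = u coord_z + h (ymap u)}"

lemma subgroup_y_fixing: "subgroup y_fixing (Aut V)"
proof (rule subgroup_autosI)
  fix f assume f: "f \<in> y_fixing"
  then have fa: "f \<in> autos"
    by (simp add: y_fixing_def)
  have "ymap ((inv\<^bsub>Aut V\<^esub> f) u) = ymap u" if "u \<in> V" for u
  proof -
    have "(inv\<^bsub>Aut V\<^esub> f) u \<in> V"
      using autos_mem autos_closed(2) fa that by blast
    then have "ymap (f ((inv\<^bsub>Aut V\<^esub> f) u)) = ymap ((inv\<^bsub>Aut V\<^esub> f) u)"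
      using f by (simp add: y_fixing_def)
    then show ?thesis
      by (simp add: inv_apply fa that)
  qed
  then show "inv\<^bsub>Aut V\<^esub> f \<in> y_fixing"
    by (simp add: y_fixing_def autos_closed fa)
qed (auto simp: y_fixing_def autos_closed autos_closed(3)[unfolded one_eq] one_eq mult_apply autos_mem)

lemma subgroup_shears: "subgroup shears (Aut V)"
proof (rule subgroup_autosI)
  show "\<one>\<^bsub>Aut V\<^esub> \<in> shears"
    using subgroup.one_closed[OF subgroup_y_fixing]
    by (auto simp: shears_def one_eq intro!: exI[of _ "\<lambda>_. 0"])
next
  fix f g assume f: "f \<in> shears" and g: "g \<in> shears"
  then have a: "f \<in> autos" "g \<in> autos" "f \<in> y_fixing" "g \<in> y_fixing"
    by (auto simp: shears_def y_fixing_def)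
  obtain h h' where h: "\<And>u. u \<in> V \<Longrightarrow> f u coord_z = u coord_z + h (ymap u)"
    and h': "\<And>u. u \<in> V \<Longrightarrow> g u coord_z = u coord_z + h' (ymap u)"
    using f g unfolding shears_def by blast
  have "(f \<otimes>\<^bsub>Aut V\<^esub> g) u coord_z = u coord_z + (h' (ymap u) + h (ymap u))" if "u \<in> V" for u
    using a that by (simp add: mult_apply h h' autos_mem y_fixing_def)
  moreover have "f \<otimes>\<^bsub>Aut V\<^esub> g \<in> y_fixing"
    using subgroup.m_closed[OF subgroup_y_fixing] a by blast
  ultimately show "f \<otimes>\<^bsub>Aut V\<^esub> g \<in> shears"
    unfolding shears_def by (auto intro!: exI[of _ "\<lambda>y. h' y + h y"])
next
  fix f assume f: "f \<in> shears"
  then have a: "f \<in> autos" "f \<in> y_fixing"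
    by (auto simp: shears_def y_fixing_def)
  have i: "inv\<^bsub>Aut V\<^esub> f \<in> y_fixing"
    using subgroup.m_inv_closed[OF subgroup_y_fixing a(2)] .
  obtain h where h: "\<And>u. u \<in> V \<Longrightarrow> f u coord_z = u coord_z + h (ymap u)"
    using f unfolding shears_def by blast
  have "(inv\<^bsub>Aut V\<^esub> f) u coord_z = u coord_z + - h (ymap u)" if u: "u \<in> V" for u
  proof -
    have "(inv\<^bsub>Aut V\<^esub> f) u \<in> V" "ymap ((inv\<^bsub>Aut V\<^esub> f) u) = ymap u"
      using i u a by (auto simp: y_fixing_def autos_mem autos_closed)
    then show ?thesis
      using h[of "(inv\<^bsub>Aut V\<^esub> f) u"] inv_apply(1)[OF a(1) u] by simp
  qed
  then show "inv\<^bsub>Aut V\<^esub> f \<in> shears"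
    unfolding shears_def using i by (auto intro!: exI[of _ "\<lambda>y. - h y"])
qed (auto simp: shears_def y_fixing_def)

lemma commutator_y_fixing:
  assumes a: "f \<in> autos" "g \<in> autos" and id: "perm_of f = id" "perm_of g = id"
  shows "commutator f g \<in> y_fixing"
proof -
  have "commutator f g v (coord_y i) = v (coord_y i)" if v: "v \<in> V" for v i
  proof -
    obtain u where u: "u \<in> V" "v = g (f u)" "commutator f g v = f (g u)"
      using commutator_apply[OF a v] by metis
    obtain c where c: "\<And>u. u \<in> V \<Longrightarrow> f u (coord_y i) = c * u (coord_y i)"
      using perm_of[OF a(1)] unfolding id permutes_coords_def id_apply by blast
    obtain c' where c': "\<And>u. u \<in> V \<Longrightarrow> g u (coord_y i) = c' * u (coord_y i)"
      using perm_of[OF a(2)] unfolding id permutes_coords_def id_apply by blast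
    show ?thesis
      unfolding u(3) unfolding u(2) using u(1) a by (simp add: c c' autos_mem)
  qed
  then show ?thesis
    using a by (simp add: y_fixing_def ymap_def commutator_in_autos fun_eq_iff)
qed

lemma commutator_shears:
  assumes "f \<in> y_fixing" "g \<in> y_fixing"
  shows "commutator f g \<in> shears"
proof -
  have a: "f \<in> autos" "g \<in> autos"
    using assms by (auto simp: y_fixing_def)
  have sg: "commutator f g \<in> y_fixing"
    using assms subgroup.m_closed[OF subgroup_y_fixing] subgroup.m_inv_closed[OF subgroup_y_fixing] by simp
  obtain b h where h: "\<And>u. u \<in> V \<Longrightarrow> f u coord_z = b * u coord_z + h (ymap u)"
    using auto_form[OF a(1)] by metis
  obtain b' h' where h': "\<And>u. u \<in> V \<Longrightarrow> g u coord_z = b' * u coord_z + h' (ymap u)"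
    using auto_form[OF a(2)] by metis
  have fy: "ymap (f u) = ymap u" and gy: "ymap (g u) = ymap u" if "u \<in> V" for u
    using assms that by (auto simp: y_fixing_def)
  have "commutator f g v coord_z = v coord_z + (b * h' (ymap v) + h (ymap v) - b' * h (ymap v) - h' (ymap v))"
    if v: "v \<in> V" for v
  proof -
    obtain u where u: "u \<in> V" "v = g (f u)" "commutator f g v = f (g u)"
      using commutator_apply[OF a v] by metis
    show ?thesis
      unfolding u(3) unfolding u(2) using u(1) a by (simp add: h h' autos_mem fy gy algebra_simps)
  qed
  then show ?thesis
    unfolding shears_def using sg
    by (auto intro!: exI[of _ "\<lambda>y. b * h' y + h y - b' * h y - h' y"])
qed

lemma commutator_one:
  assumes "f \<in> shears" "g \<in> shears"
  shows "commutator f g = \<one>\<^bsub>Aut V\<^esub>"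
proof -
  have y: "f \<in> y_fixing" "g \<in> y_fixing"
    using assms by (auto simp: shears_def)
  then have a: "f \<in> autos" "g \<in> autos"
    by (auto simp: y_fixing_def)
  have sg: "commutator f g \<in> y_fixing"
    using commutator_shears[OF y] by (simp add: shears_def)
  obtain h where h: "\<And>u. u \<in> V \<Longrightarrow> f u coord_z = u coord_z + h (ymap u)"
    using assms(1) unfolding shears_def by blast
  obtain h' where h': "\<And>u. u \<in> V \<Longrightarrow> g u coord_z = u coord_z + h' (ymap u)"
    using assms(2) unfolding shears_def by blast
  have fy: "ymap (f u) = ymap u" and gy: "ymap (g u) = ymap u" if "u \<in> V" for u
    using y that by (auto simp: y_fixing_def)
  have z: "commutator f g v coord_z = v coord_z" if v: "v \<in> V" for v
  proof -
    obtain u where u: "u \<in> V" "v = g (f u)" "commutator f g v = f (g u)"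
      using commutator_apply[OF a v] by metis
    show ?thesis
      unfolding u(3) unfolding u(2) using u(1) a by (simp add: h h' autos_mem fy gy)
  qed
  have "commutator f g v (coord_y i) = v (coord_y i)" if "v \<in> V" for v i
    using sg that by (simp add: y_fixing_def ymap_def fun_eq_iff)
  then show ?thesis
    unfolding one_eq using auto_eq_one[OF commutator_in_autos[OF a]] z by blast
qed

section \<open>Permutations of the level sets of the exponents\<close>

text \<open>The action of \<open>\<pi>\<close> on the level set \<open>k = n\<close>, transported along a labelling \<open>e\<close> that is injective on level
sets; letters that label no element of the level set are fixed.\<close>

definition on_level :: "('n \<Rightarrow> four) \<Rightarrow> nat \<Rightarrow> ('n \<Rightarrow> 'n) \<Rightarrow> four \<Rightarrow> four" where
  "on_level e n \<pi> x = (if \<exists>i. k i = n \<and> e i = x then e (\<pi> (SOME i. k i = n \<and> e i = x)) else x)"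

definition level_perm :: "('n \<Rightarrow> four) \<Rightarrow> nat \<Rightarrow> (('n coord \<Rightarrow> 'a) \<Rightarrow> ('n coord \<Rightarrow> 'a)) \<Rightarrow> perm4" where
  "level_perm e n f = perm_of_fun (on_level e n (perm_of f))"

text \<open>The automorphisms that act on every level set through the \<open>j\<close>-th term of the derived series of the
symmetric group on four letters.\<close>

definition layer :: "('n \<Rightarrow> four) \<Rightarrow> nat \<Rightarrow> (('n coord \<Rightarrow> 'a) \<Rightarrow> ('n coord \<Rightarrow> 'a)) set" where
  "layer e j = {f \<in> autos. \<forall>n. level_perm e n f \<in> set (layer4 j)}"

context
  fixes e :: "'n \<Rightarrow> four"
  assumes e: "\<And>i j. k i = k j \<Longrightarrow> e i = e j \<Longrightarrow> i = j"
begin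

lemma on_level_eq: "k i = n \<Longrightarrow> on_level e n \<pi> (e i) = e (\<pi> i)"
proof -
  assume i: "k i = n"
  then have "(SOME j. k j = n \<and> e j = e i) = i"
    by (intro some_equality) (auto intro: e)
  then show ?thesis
    using i by (auto simp: on_level_def)
qed

lemma on_level_out: "\<nexists>i. k i = n \<and> e i = x \<Longrightarrow> on_level e n \<pi> x = x"
  by (auto simp: on_level_def)

lemma on_level_comp:
  assumes "\<And>i. k (\<pi>' i) = k i"
  shows "on_level e n (\<pi> \<circ> \<pi>') = on_level e n \<pi> \<circ> on_level e n \<pi>'"
proof
  fix x
  show "on_level e n (\<pi> \<circ> \<pi>') x = (on_level e n \<pi> \<circ> on_level e n \<pi>') x"
  proof (cases "\<exists>i. k i = n \<and> e i = x")
    case True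
    then obtain i where "k i = n" "x = e i"
      by blast
    then show ?thesis
      using assms[of i] by (simp add: on_level_eq)
  next
    case False
    then show ?thesis
      by (simp add: on_level_out)
  qed
qed

lemma on_level_id: "on_level e n id = id"
proof
  fix x show "on_level e n id x = id x"
    by (cases "\<exists>i. k i = n \<and> e i = x") (auto simp: on_level_eq on_level_out)
qed

lemma level_perm_mult:
  assumes "f \<in> autos" "g \<in> autos"
  shows "level_perm e n (f \<otimes>\<^bsub>Aut V\<^esub> g) = pcomp (level_perm e n f) (level_perm e n g)"
  using perm_of[OF assms(2)]
  by (simp add: level_perm_def perm_of_mult[OF assms] on_level_comp permutes_coords_def flip: perm_of_fun_comp)

lemma perm_of_fun_id: "perm_of_fun id = pid"
  by (simp add: perm_of_fun_def pid_def)

lemma level_perm_one: "level_perm e n \<one>\<^bsub>Aut V\<^esub> = pid"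
  by (simp add: level_perm_def perm_of_one on_level_id perm_of_fun_id)

lemma level_perm_sym4:
  assumes f: "f \<in> autos"
  shows "level_perm e n f \<in> set sym4"
proof -
  have k1: "k (perm_of (inv\<^bsub>Aut V\<^esub> f) i) = k i" and k2: "k (perm_of f i) = k i" for i
    using perm_of[OF f] perm_of[OF autos_closed(2)[OF f]] by (simp_all add: permutes_coords_def)
  have "on_level e n (perm_of f) \<circ> on_level e n (perm_of (inv\<^bsub>Aut V\<^esub> f)) = id"
    using on_level_comp[OF k1, of n "perm_of f"] perm_of_inv[OF f] on_level_id by metis
  then have "surj (on_level e n (perm_of f))"
    by (metis comp_apply id_apply surjI)
  then have "inj (on_level e n (perm_of f))"
    using finite_UNIV_surj_inj UNIV_four by (metis finite.emptyI finite_insert)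
  then show ?thesis
    unfolding level_perm_def by (rule perm_of_fun_in_sym4)
qed

lemma level_perm_inv:
  assumes f: "f \<in> autos"
  shows "level_perm e n (inv\<^bsub>Aut V\<^esub> f) = pinv (level_perm e n f)"
proof -
  have "pcomp (level_perm e n f) (level_perm e n (inv\<^bsub>Aut V\<^esub> f)) = pid"
    using level_perm_mult[OF f autos_closed(2)[OF f]] group.r_inv[OF group_V] f level_perm_one
    by (simp add: autos_def)
  then show ?thesis
    using sym4_inv level_perm_sym4[OF f, of n] level_perm_sym4[OF autos_closed(2)[OF f], of n]
    by (auto simp: list_all_iff)
qed

lemma level_perm_commutator:
  assumes "f \<in> autos" "g \<in> autos"
  shows "level_perm e n (commutator f g) = pcommutator (level_perm e n f) (level_perm e n g)"
  using assms by (simp add: level_perm_mult level_perm_inv autos_closed pcommutator_def)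

lemma layer_0: "layer e 0 = carrier (Aut V)"
  using level_perm_sym4 by (auto simp: layer_def autos_def)

lemma layer4_closed:
  assumes "j > 0"
  shows "pid \<in> set (layer4 j)"
    "p \<in> set (layer4 j) \<Longrightarrow> r \<in> set (layer4 j) \<Longrightarrow> pcomp p r \<in> set (layer4 j)"
    "p \<in> set (layer4 j) \<Longrightarrow> pinv p \<in> set (layer4 j)"
proof -
  consider "j = Suc 0" | "j = Suc (Suc 0)" | m where "j = Suc (Suc (Suc m))"
    using assms by (metis not0_implies_Suc not_gr_zero)
  then have "pid \<in> set (layer4 j) \<and>
    (p \<in> set (layer4 j) \<longrightarrow> r \<in> set (layer4 j) \<longrightarrow> pcomp p r \<in> set (layer4 j)) \<and>
    (p \<in> set (layer4 j) \<longrightarrow> pinv p \<in> set (layer4 j))"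
  proof cases
    case 1
    then show ?thesis
      using alt4_checks by (auto simp: list_all_iff) (simp add: pid_def alt4_def)
  next
    case 2
    then show ?thesis
      using klein4_checks by (auto simp: list_all_iff) (simp add: pid_def klein4_def)
  next
    case 3
    then show ?thesis
      by (auto simp: pid_def pinv_def)
  qed
  then show "pid \<in> set (layer4 j)"
    "p \<in> set (layer4 j) \<Longrightarrow> r \<in> set (layer4 j) \<Longrightarrow> pcomp p r \<in> set (layer4 j)"
    "p \<in> set (layer4 j) \<Longrightarrow> pinv p \<in> set (layer4 j)"
    by blast+
qed

lemma subgroup_layer: "subgroup (layer e j) (Aut V)"
proof (cases "j = 0")
  case True
  then show ?thesis
    using layer_0 group.subgroup_self[OF group_V] by simp
next
  case False
  then show ?thesis
    by (intro subgroup_autosI)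
       (auto simp: layer_def autos_closed level_perm_one level_perm_mult level_perm_inv layer4_closed)
qed

lemma layer_autos: "f \<in> layer e j \<Longrightarrow> f \<in> autos"
  by (simp add: layer_def)

lemma commutator_layer:
  assumes "j < 3" "f \<in> layer e j" "g \<in> layer e j"
  shows "commutator f g \<in> layer e (Suc j)"
proof -
  have "pcommutator p r \<in> set (layer4 (Suc j))" if "p \<in> set (layer4 j)" "r \<in> set (layer4 j)" for p r
  proof -
    consider "j = 0" | "j = Suc 0" | "j = Suc (Suc 0)"
      using assms(1) by linarith
    then show ?thesis
      using that sym4_checks alt4_checks klein4_checks by cases (auto simp: list_all_iff)
  qed
  then show ?thesis
    using assms(2,3) by (simp add: layer_def level_perm_commutator autos_closed)
qed

lemma layer_3_fixes:
  assumes f: "f \<in> layer e 3"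
  shows "perm_of f = id"
proof
  fix i
  have "level_perm e (k i) f = pid"
    using f by (simp add: layer_def numeral_3_eq_3)
  then have "app (level_perm e (k i) f) (e i) = app (perm_of_fun id) (e i)"
    by (simp only: perm_of_fun_id)
  then have "e (perm_of f i) = e i"
    by (simp add: level_perm_def on_level_eq)
  moreover have "k (perm_of f i) = k i"
    using perm_of[of f] f by (simp add: layer_def permutes_coords_def)
  ultimately show "perm_of f i = id i"
    using e by simp
qed

lemma solvable_Aut: "solvable (Aut V)"
proof -
  define T where "T j = (if j \<le> 3 then layer e j else if j = 4 then y_fixing
    else if j = 5 then shears else {\<one>\<^bsub>Aut V\<^esub>})" for j :: nat
  show ?thesis
  proof (rule group.solvable_by_chain[OF group_V])
    show "T 0 = carrier (Aut V)"
      by (simp add: T_def layer_0)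
    show "T 6 = {\<one>\<^bsub>Aut V\<^esub>}"
      by (simp add: T_def)
    show "subgroup (T j) (Aut V)" for j
      using subgroup_layer subgroup_y_fixing subgroup_shears group.triv_subgroup[OF group_V]
      by (simp add: T_def)
    fix j f g assume j: "j < 6" and fg: "f \<in> T j" "g \<in> T j"
    consider "j < 3" | "j = 3" | "j = 4" | "j = 5"
      using j by linarith
    then show "commutator f g \<in> T (Suc j)"
      using fg by cases
        (simp_all add: T_def commutator_layer commutator_y_fixing layer_3_fixes layer_autos
          commutator_shears commutator_one)
  qed
qed

end

end

text \<open>Without five distinct indices of equal \<open>k\<close>, each level set embeds into a set of four letters.\<close>

lemma level_labelling:
  fixes k :: "'n::finite \<Rightarrow> nat"
  assumes "\<not> (\<exists>i1 i2 i3 i4 i5. distinct [i1, i2, i3, i4, i5] \<and>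
               k i1 = k i2 \<and> k i2 = k i3 \<and> k i3 = k i4 \<and> k i4 = k i5)"
  obtains e :: "'n \<Rightarrow> four" where "\<And>i j. k i = k j \<Longrightarrow> e i = e j \<Longrightarrow> i = j"
proof -
  have "\<exists>e :: 'n \<Rightarrow> four. inj_on e {i. k i = n}" for n
  proof -
    have "card {i. k i = n} \<le> 4"
    proof (rule ccontr)
      assume "\<not> card {i. k i = n} \<le> 4"
      then have "5 \<le> card {i. k i = n}"
        by simp
      then obtain B where B: "B \<subseteq> {i. k i = n}" "card B = 5"
        using obtain_subset_with_card_n by metis
      obtain xs where xs: "set xs = B" "distinct xs"
        using finite_distinct_list[of B] by auto
      then have "length xs = 5"
        using B(2) distinct_card by force
      then obtain i1 i2 i3 i4 i5 where "xs = [i1, i2, i3, i4, i5]"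
        by (auto simp: length_Suc_conv numeral_eq_Suc)
      then have "distinct [i1, i2, i3, i4, i5] \<and> k i1 = k i2 \<and> k i2 = k i3 \<and> k i3 = k i4 \<and> k i4 = k i5"
        using xs B(1) by auto
      then show False
        using assms by blast
    qed
    also have "4 = card (UNIV :: four set)"
      by (simp add: UNIV_four)
    finally show ?thesis
      using card_le_inj[of "{i. k i = n}" "UNIV :: four set"] by (auto simp: UNIV_four)
  qed
  then obtain e :: "nat \<Rightarrow> 'n \<Rightarrow> four" where e: "\<And>n. inj_on (e n) {i. k i = n}"
    by metis
  show ?thesis
    by (rule that[of "\<lambda>i. e (k i) i"]) (use e in \<open>auto simp: inj_on_def\<close>)
qed

theorem corollary7p17:
  fixes k :: "'n::finite \<Rightarrow> nat"
    and d :: nat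
    and s :: "nat \<Rightarrow> ('n, 'a::{alg_closed_field, field_char_0}) mpoly"
  assumes "d \<ge> 2"
    and "\<And>i. k i \<ge> 2"
    and "\<not> (\<exists>i1 i2 i3 i4 i5. distinct [i1, i2, i3, i4, i5] \<and>
               k i1 = k i2 \<and> k i2 = k i3 \<and> k i3 = k i4 \<and> k i4 = k i5)"
  shows "solvable (Aut (danielewski_variety k d s))"
proof -
  interpret danielewski k d s
    by standard (rule assms(1), rule assms(2))
  obtain e :: "'n \<Rightarrow> four" where "\<And>i j. k i = k j \<Longrightarrow> e i = e j \<Longrightarrow> i = j"
    using level_labelling[OF assms(3)] by metis
  then show ?thesis
    by (rule solvable_Aut)
qed

end
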